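(* For every $\varepsilon>0$, $$N_{\mathrm{loc}}(P)=\tau_{\mathrm{loc}}P^4+O(P^{4-1/8+\varepsilon})\qquad (P\to\infty),$$ where the implied constant depends only on $\varepsilon$. Here $\tau_{\mathrm{loc}}=\prod_{v}\tau_{\mathrm{loc},v}$, the product being over all places $v$ of $\mathbb{Q}$ (all primes $p$ and $v=\infty$), and $\tau_{\mathrm{loc},v}$ is the density of points in $U(\mathbb{Q}_v)/G(\mathbb{Q}_v)$ whose associated surface has $\mathbb{Q}_v$-points.
   Context: For $(a,b,c,d)\in\mathbb{Q}^4$ with $abcd\neq0$ and $ad-bc\neq 0$, let $X_{a,b,c,d}$ be a smooth proper model of the affine Châtelet surface $Y^2+Z^2=(aT^2+b)(cT^2+d)$. Let $U=\{[a,b,c,d]\in\mathbb{P}^3: abcd(ad-bc)\neq0\}$, acted on by $G=\mathbb{G}_{m}^2\times R_{\mathbb{Q}(i)/\mathbb{Q}}(\mathbb{G}_m)^2\rtimes(\mathbb{Z}/2\mathbb{Z})^2$ via $(a,b,c,d)\mapsto(\lambda^2a,\mu^2b,\lambda^2c,\mu^2d)$, $(a,b,c,d)\mapsto(N(\xi)a,N(\xi)b,N(\eta)c,N(\eta)d)$ ($N$ the norm from $\mathbb{Q}(i)$), $(a,b,c,d)\mapsto(c,d,a,b)$ and $(a,b,c,d)\mapsto(b,a,d,c)$; these do not change the surface. Let $\mathcal{M}=U(\mathbb{Q})/G(\mathbb{Q})$. Let $\mathcal{A}$ be the set of squarefree positive integers and $\mathcal{B}$ the set of $n\in\mathcal{A}$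 all of whose prime factors are $\equiv 3\pmod 4$ (so $1\in\mathcal{B}$). Let $S_{\mathrm{tot}}$ be the set of $(a,b,c,d)\in\mathbb{Z}^4$ with $\gcd(a,b,c,d)=1$, modulo $(a,b,c,d)\sim-(a,b,c,d)$, such that $abcd(ad-bc)\neq0$, $\gcd(a,c),\gcd(b,d)\in\mathcal{A}$ and $\gcd(a,b),\gcd(c,d)\in\mathcal{B}$; the elements of $\mathcal{M}$ are in $1:4$ correspondence with $S_{\mathrm{tot}}$, and the height of an element is $\max(|a|,|b|,|c|,|d|)$ of a representative. Define $$N_{\mathrm{loc}}(P)=\tfrac14\#\{(a,b,c,d)\in S_{\mathrm{tot}}:\max(|a|,|b|,|c|,|d|)\le P,\ X_{a,b,c,d}(\mathbb{Q}_v)\neq\emptyset\ \text{for all places } v\},$$ i.e. the number of elements of $\mathcal{M}$ of height at most $P$ whose surface is everywhere locally soluble. Explicitly, $\tau_{\mathrm{loc},\infty}=7/4$ and for a prime $p$, $$\tau_{\mathrm{loc},p}=\lim_{k\to\infty}p^{-4k}\#\Big\{(a,b,c,d)\in(\mathbb{Z}/p^k\mathbb{Z})^4\setminus p(\mathbb{Z}/p^k\mathbb{Z})^4:\ X_{a,b,c,d}(\mathbb{Q}_p)\neq\emptyset,\ \min\{v_p(a),v_p(c)\}\le1,\ \min\{v_p(b),v_p(d)\}\le1,\ \min\{v_p(a),v_p(b)\}\le\delta_p,\ \min\{v_p(c),v_p(d)\}\le\delta_p\Big\},$$ where $\delta_p=1$ if $p\equiv3\pmod4$ and $\delta_p=0$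 otherwise. *)

theory Defs
  imports
    "HOL-Analysis.Analysis"
    "HOL-Algebra.QuotRing"
    "HOL-Algebra.Algebraic_Closure_Type"
    "HOL-Number_Theory.Cong"
    "HOL-Library.Extended_Nat"
    "HOL-Library.Landau_Symbols"
begin

hide_const (open) Divisibility.prime

subsection \<open>The field of p-adic numbers\<close>

definition padic_abs :: "nat \<Rightarrow> rat \<Rightarrow> real" where
  "padic_abs p x =
     (if x = 0 then 0
      else real p powi (int (multiplicity (int p) (snd (quotient_of x)))
                      - int (multiplicity (int p) (fst (quotient_of x)))))"

definition padic_Cauchy :: "nat \<Rightarrow> (nat \<Rightarrow> rat) \<Rightarrow> bool" where
  "padic_Cauchy p x \<longleftrightarrow>
     (\<forall>e>0. \<exists>N. \<forall>m\<ge>N. \<forall>n\<ge>N. padic_abs p (x m - x n) < e)"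

definition padic_null :: "nat \<Rightarrow> (nat \<Rightarrow> rat) \<Rightarrow> bool" where
  "padic_null p x \<longleftrightarrow> (\<lambda>n. padic_abs p (x n)) \<longlonglongrightarrow> 0"

definition padic_Cauchy_ring :: "nat \<Rightarrow> (nat \<Rightarrow> rat) ring" where
  "padic_Cauchy_ring p =
     \<lparr> carrier = {x. padic_Cauchy p x},
       mult = (\<lambda>x y n. x n * y n), one = (\<lambda>n. 1),
       zero = (\<lambda>n. 0), add = (\<lambda>x y n. x n + y n) \<rparr>"

text \<open>The completion of the rationals with respect to the p-adic absolute value.\<close>

definition padic_field :: "nat \<Rightarrow> (nat \<Rightarrow> rat) set ring" where
  "padic_field p = padic_Cauchy_ring p Quot {x. padic_null p x}"

lemma padic_abs_quotient:
  assumes p: "prime p" and "a \<noteq> 0" "b \<noteq> 0" and x: "x = of_int a / of_int b"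
  shows "padic_abs p x
    = real p powi (int (multiplicity (int p) b) - int (multiplicity (int p) a))"
proof -
  obtain n d where q: "quotient_of x = (n, d)" by (cases "quotient_of x") auto
  have d: "d > 0" using quotient_of_denom_pos[OF q] .
  have xnd: "x = of_int n / of_int d" using quotient_of_div[OF q] .
  have x0: "x \<noteq> 0" using assms by simp
  then have n0: "n \<noteq> 0" using xnd by auto
  have "(of_int n * of_int b :: rat) = of_int a * of_int d"
    using xnd x d \<open>b \<noteq> 0\<close> by (simp add: field_simps)
  then have eq: "n * b = a * d" by (metis of_int_eq_iff of_int_mult)
  have pe: "prime_elem (int p)" using p by auto
  have "multiplicity (int p) n + multiplicity (int p) b
      = multiplicity (int p) a + multiplicity (int p) d"
    using arg_cong[OF eq, of "multiplicity (int p)"] pe n0 d assms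
    by (simp add: prime_elem_multiplicity_mult_distrib)
  then have "int (multiplicity (int p) d) - int (multiplicity (int p) n)
           = int (multiplicity (int p) b) - int (multiplicity (int p) a)" by linarith
  then show ?thesis using x0 q by (simp add: padic_abs_def)
qed

lemma padic_abs_0 [simp]: "padic_abs p 0 = 0"
  by (simp add: padic_abs_def)

lemma padic_abs_1 [simp]: "padic_abs p 1 = 1"
  by (simp add: padic_abs_def)

lemma padic_abs_nonneg [simp]: "padic_abs p x \<ge> 0"
  by (simp add: padic_abs_def)

lemma padic_abs_pos: "prime p \<Longrightarrow> x \<noteq> 0 \<Longrightarrow> padic_abs p x > 0"
  by (auto simp add: padic_abs_def prime_gt_0_nat intro!: zero_less_power_int)

lemma padic_abs_mult:
  assumes p: "prime p"
  shows "padic_abs p (x * y) = padic_abs p x * padic_abs p y"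
proof (cases "x = 0 \<or> y = 0")
  case False
  obtain a b where x: "x = of_int a / of_int b" "b \<noteq> 0"
    by (metis Rat_cases Fract_of_int_quotient less_irrefl)
  obtain c d where y: "y = of_int c / of_int d" "d \<noteq> 0"
    by (metis Rat_cases Fract_of_int_quotient less_irrefl)
  have nz: "a \<noteq> 0" "c \<noteq> 0" using False x y by auto
  have xy: "x * y = of_int (a * c) / of_int (b * d)" using x y by simp
  have pe: "prime_elem (int p)" using p by auto
  have p0: "real p \<noteq> 0" using p prime_gt_0_nat by fastforce
  show ?thesis
    using padic_abs_quotient[OF p _ _ xy] padic_abs_quotient[OF p nz(1) x(2) x(1)]
      padic_abs_quotient[OF p nz(2) y(2) y(1)] nz x(2) y(2) pe p0
    by (simp add: prime_elem_multiplicity_mult_distrib flip: power_int_add)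
       (simp add: algebra_simps)
qed auto

lemma padic_abs_add_le:
  assumes p: "prime p"
  shows "padic_abs p (x + y) \<le> max (padic_abs p x) (padic_abs p y)"
proof (cases "x = 0 \<or> y = 0 \<or> x + y = 0")
  case False
  obtain a b where x: "x = of_int a / of_int b" "b \<noteq> 0"
    by (metis Rat_cases Fract_of_int_quotient less_irrefl)
  obtain c d where y: "y = of_int c / of_int d" "d \<noteq> 0"
    by (metis Rat_cases Fract_of_int_quotient less_irrefl)
  define r s e where "r = a * d" and "s = c * b" and "e = b * d"
  have e: "e \<noteq> 0" using x y e_def by simp
  have xe: "x = of_int r / of_int e" and ye: "y = of_int s / of_int e"
    using x y by (auto simp: r_def s_def e_def field_simps)
  have xye: "x + y = of_int (r + s) / of_int e" using xe ye by (simp add: add_divide_distrib)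
  have nz: "r \<noteq> 0" "s \<noteq> 0" "r + s \<noteq> 0" using False xe ye xye by (auto simp del: of_int_add)
  let ?m = "multiplicity (int p)"
  have "int p ^ min (?m r) (?m s) dvd r + s"
    by (intro dvd_add multiplicity_dvd') auto
  then have "min (?m r) (?m s) \<le> ?m (r + s)"
    using nz p by (intro multiplicity_geI) auto
  then have "?m r \<le> ?m (r + s) \<or> ?m s \<le> ?m (r + s)" by auto
  moreover have "real p \<ge> 1" using p prime_ge_1_nat by auto
  ultimately show ?thesis
    using padic_abs_quotient[OF p nz(1) e xe] padic_abs_quotient[OF p nz(2) e ye]
      padic_abs_quotient[OF p nz(3) e xye]
    by (auto simp: le_max_iff_disj intro!: power_int_increasing)
qed (auto simp: le_max_iff_disj)

lemma padic_abs_minus [simp]: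
  assumes "prime p" shows "padic_abs p (- x) = padic_abs p x"
proof -
  have "padic_abs p (-1) = 1" by (simp add: padic_abs_def)
  then show ?thesis using padic_abs_mult[OF assms, of "-1" x] by simp
qed

lemma padic_abs_triangle:
  assumes "prime p" shows "padic_abs p (x + y) \<le> padic_abs p x + padic_abs p y"
  using padic_abs_add_le[OF assms, of x y] padic_abs_nonneg[of p x] padic_abs_nonneg[of p y]
  by linarith

lemma padic_abs_diff_le:
  assumes "prime p" shows "\<bar>padic_abs p x - padic_abs p y\<bar> \<le> padic_abs p (x - y)"
  using padic_abs_triangle[OF assms, of "x - y" y] padic_abs_triangle[OF assms, of "y - x" x]
    padic_abs_minus[OF assms, of "x - y"]
  by simp

lemma padic_Cauchy_Cauchy:
  assumes p: "prime p" and x: "padic_Cauchy p x"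
  shows "Cauchy (\<lambda>n. padic_abs p (x n))"
  unfolding Cauchy_def dist_real_def
  using x padic_abs_diff_le[OF p] unfolding padic_Cauchy_def by (meson le_less_trans)

lemma padic_Cauchy_bounded:
  assumes p: "prime p" and x: "padic_Cauchy p x"
  obtains B where "B > 0" "\<And>n. padic_abs p (x n) \<le> B"
proof -
  have "Bseq (\<lambda>n. padic_abs p (x n))"
    using padic_Cauchy_Cauchy[OF p x] Cauchy_Bseq by blast
  then show ?thesis using that unfolding Bseq_def by auto
qed

lemma padic_Cauchy_const: "padic_Cauchy p (\<lambda>n. c)"
  by (simp add: padic_Cauchy_def)

lemma padic_Cauchy_add:
  assumes p: "prime p" and "padic_Cauchy p x" "padic_Cauchy p y"
  shows "padic_Cauchy p (\<lambda>n. x n + y n)"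
  unfolding padic_Cauchy_def
proof (intro allI impI)
  fix e :: real assume e: "e > 0"
  obtain N M where N: "\<forall>m\<ge>N. \<forall>n\<ge>N. padic_abs p (x m - x n) < e"
    and M: "\<forall>m\<ge>M. \<forall>n\<ge>M. padic_abs p (y m - y n) < e"
    using assms e unfolding padic_Cauchy_def by meson
  have "padic_abs p ((x m + y m) - (x n + y n)) < e" if "m \<ge> max N M" "n \<ge> max N M" for m n
    using padic_abs_add_le[OF p, of "x m - x n" "y m - y n"] N M that
    by (auto simp: algebra_simps le_max_iff_disj) (meson le_less_trans)+
  then show "\<exists>N. \<forall>m\<ge>N. \<forall>n\<ge>N. padic_abs p (x m + y m - (x n + y n)) < e" by blast
qed

lemma padic_Cauchy_minus:
  assumes p: "prime p" and "padic_Cauchy p x"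
  shows "padic_Cauchy p (\<lambda>n. - x n)"
proof -
  have "padic_abs p (- x m - - x n) = padic_abs p (x m - x n)" for m n
    using padic_abs_minus[OF p, of "x m - x n"] by simp
  then show ?thesis using assms unfolding padic_Cauchy_def by simp
qed

lemma padic_Cauchy_mult:
  assumes p: "prime p" and x: "padic_Cauchy p x" and y: "padic_Cauchy p y"
  shows "padic_Cauchy p (\<lambda>n. x n * y n)"
  unfolding padic_Cauchy_def
proof (intro allI impI)
  fix e :: real assume e: "e > 0"
  obtain B where B: "B > 0" "\<And>n. padic_abs p (x n) \<le> B"
    using padic_Cauchy_bounded[OF p x] by metis
  obtain C where C: "C > 0" "\<And>n. padic_abs p (y n) \<le> C"
    using padic_Cauchy_bounded[OF p y] by metis
  have eC: "e / C > 0" and eB: "e / B > 0" using e B C by auto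
  obtain N M where N: "\<forall>m\<ge>N. \<forall>n\<ge>N. padic_abs p (x m - x n) < e / C"
    and M: "\<forall>m\<ge>M. \<forall>n\<ge>M. padic_abs p (y m - y n) < e / B"
    using x y eB eC unfolding padic_Cauchy_def by meson
  have "padic_abs p (x m * y m - x n * y n) < e" if "m \<ge> max N M" "n \<ge> max N M" for m n
  proof -
    have eq: "x m * y m - x n * y n = (x m - x n) * y m + x n * (y m - y n)"
      by (simp add: algebra_simps)
    have "padic_abs p ((x m - x n) * y m) \<le> padic_abs p (x m - x n) * C"
      using C by (simp add: padic_abs_mult[OF p] mult_left_mono)
    also have "\<dots> < e" using N that C by (simp add: pos_less_divide_eq)
    finally have 1: "padic_abs p ((x m - x n) * y m) < e" .
    have "padic_abs p (x n * (y m - y n)) \<le> B * padic_abs p (y m - y n)"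
      using B by (simp add: padic_abs_mult[OF p] mult_right_mono)
    also have "\<dots> < e" using M that B by (simp add: pos_less_divide_eq mult.commute)
    finally have 2: "padic_abs p (x n * (y m - y n)) < e" .
    show ?thesis using padic_abs_add_le[OF p, of "(x m - x n) * y m" "x n * (y m - y n)"] 1 2
      unfolding eq by linarith
  qed
  then show "\<exists>N. \<forall>m\<ge>N. \<forall>n\<ge>N. padic_abs p (x m * y m - x n * y n) < e" by blast
qed

lemma padic_null_Cauchy:
  assumes p: "prime p" and x: "padic_null p x"
  shows "padic_Cauchy p x"
  unfolding padic_Cauchy_def
proof (intro allI impI)
  fix e :: real assume e: "e > 0"
  then obtain N where N: "\<forall>n\<ge>N. padic_abs p (x n) < e"
    using x unfolding padic_null_def lim_sequentially dist_real_def by fastforce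
  have "padic_abs p (x m - x n) < e" if "m \<ge> N" "n \<ge> N" for m n
    using padic_abs_add_le[OF p, of "x m" "- x n"] N[rule_format, OF that(1)]
      N[rule_format, OF that(2)] padic_abs_minus[OF p, of "x n"] by simp
  then show "\<exists>N. \<forall>m\<ge>N. \<forall>n\<ge>N. padic_abs p (x m - x n) < e" by blast
qed

lemma padic_Cauchy_inverse:
  assumes p: "prime p" and x: "padic_Cauchy p x" and nn: "\<not> padic_null p x"
  shows "padic_Cauchy p (\<lambda>n. inverse (x n))"
    and "padic_null p (\<lambda>n. x n * inverse (x n) - 1)"
proof -
  obtain L where L: "(\<lambda>n. padic_abs p (x n)) \<longlonglongrightarrow> L"
    using padic_Cauchy_Cauchy[OF p x] Cauchy_convergent_iff convergent_def by blast
  have "L \<ge> 0" using LIMSEQ_le_const[OF L, of 0] by simp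
  moreover have "L \<noteq> 0" using nn L unfolding padic_null_def by auto
  ultimately have L0: "L > 0" by simp
  define h where "h = L / 2"
  have h: "h > 0" "h < L" using L0 by (auto simp: h_def)
  obtain K where K: "\<And>n. n \<ge> K \<Longrightarrow> padic_abs p (x n) > h"
    using order_tendstoD(1)[OF L h(2)] by (auto simp: eventually_sequentially)
  have nz: "x n \<noteq> 0" if "n \<ge> K" for n using K[OF that] h by auto
  show "padic_Cauchy p (\<lambda>n. inverse (x n))"
    unfolding padic_Cauchy_def
  proof (intro allI impI)
    fix e :: real assume e: "e > 0"
    then have "e * h * h > 0" using h by simp
    then obtain N where N: "\<forall>m\<ge>N. \<forall>n\<ge>N. padic_abs p (x m - x n) < e * h * h"
      using x unfolding padic_Cauchy_def by meson
    have "padic_abs p (inverse (x m) - inverse (x n)) < e"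
      if "m \<ge> max N K" "n \<ge> max N K" for m n
    proof -
      let ?A = "padic_abs p (inverse (x m) - inverse (x n))"
      have "(inverse (x m) - inverse (x n)) * (x m * x n) = - (x m - x n)"
        using nz that by (simp add: field_simps)
      then have "?A * (padic_abs p (x m) * padic_abs p (x n)) = padic_abs p (x m - x n)"
        by (metis padic_abs_mult[OF p] padic_abs_minus[OF p])
      moreover have "?A * (h * h) \<le> ?A * (padic_abs p (x m) * padic_abs p (x n))"
        using K[of m] K[of n] h that by (intro mult_left_mono mult_mono) auto
      moreover have "padic_abs p (x m - x n) < e * h * h" using N that by auto
      ultimately have "?A * (h * h) < e * (h * h)" by (simp only: mult.assoc)
      then show ?thesis using h by (simp add: mult_less_cancel_right)
    qed
    then show "\<exists>N. \<forall>m\<ge>N. \<forall>n\<ge>N. padic_abs p (inverse (x m) - inverse (x n)) < e" by blast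
  qed
  have "\<forall>\<^sub>F n in sequentially. padic_abs p (x n * inverse (x n) - 1) = 0"
    using nz by (auto simp: eventually_sequentially intro!: exI[of _ K])
  then show "padic_null p (\<lambda>n. x n * inverse (x n) - 1)"
    unfolding padic_null_def by (rule tendsto_eventually)
qed

lemma padic_Cauchy_cring:
  assumes p: "prime p" shows "cring (padic_Cauchy_ring p)"
proof (intro cringI abelian_groupI comm_monoidI)
  fix x assume x: "x \<in> carrier (padic_Cauchy_ring p)"
  show "\<exists>y\<in>carrier (padic_Cauchy_ring p). y \<oplus>\<^bsub>padic_Cauchy_ring p\<^esub> x = \<zero>\<^bsub>padic_Cauchy_ring p\<^esub>"
    using padic_Cauchy_minus[OF p] x
    by (intro bexI[of _ "\<lambda>n. - x n"]) (auto simp: padic_Cauchy_ring_def)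
qed (auto simp: padic_Cauchy_ring_def padic_Cauchy_const padic_Cauchy_add[OF p]
    padic_Cauchy_mult[OF p] algebra_simps)

lemma padic_null_ideal:
  assumes p: "prime p" shows "ideal {x. padic_null p x} (padic_Cauchy_ring p)"
proof -
  interpret R: cring "padic_Cauchy_ring p" by (rule padic_Cauchy_cring[OF p])
  have add: "padic_null p (\<lambda>n. x n + y n)" if "padic_null p x" "padic_null p y" for x y
    unfolding padic_null_def
    by (rule tendsto_sandwich[OF _ _ tendsto_const tendsto_add_zero[OF that[unfolded padic_null_def]]])
       (auto simp: padic_abs_triangle[OF p])
  have mult: "padic_null p (\<lambda>n. x n * y n)" if x: "padic_Cauchy p x" and y: "padic_null p y" for x y
  proof -
    obtain B where B: "B > 0" "\<And>n. padic_abs p (x n) \<le> B"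
      using padic_Cauchy_bounded[OF p x] by metis
    have lim: "(\<lambda>n. B * padic_abs p (y n)) \<longlonglongrightarrow> 0"
      using y unfolding padic_null_def by (rule tendsto_mult_right_zero)
    show ?thesis unfolding padic_null_def
      by (rule tendsto_sandwich[OF _ _ tendsto_const lim])
         (auto simp: padic_abs_mult[OF p] B mult_right_mono)
  qed
  have mult': "padic_null p (\<lambda>n. y n * x n)" if "padic_Cauchy p x" "padic_null p y" for x y
    using mult[OF that] by (simp add: mult.commute)
  have inv: "\<ominus>\<^bsub>padic_Cauchy_ring p\<^esub> x = (\<lambda>n. - x n)" if "padic_Cauchy p x" for x
    using that padic_Cauchy_minus[OF p that]
    by (intro R.minus_equality) (auto simp: padic_Cauchy_ring_def)
  have neg: "padic_null p (\<lambda>n. - x n)" if "padic_null p x" for x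
    using that by (simp add: padic_null_def padic_abs_minus[OF p])
  show ?thesis
  proof (rule idealI)
    show "ring (padic_Cauchy_ring p)" by unfold_locales
    show "subgroup {x. padic_null p x} (add_monoid (padic_Cauchy_ring p))"
    proof (rule R.add.subgroupI)
      fix a assume a: "a \<in> {x. padic_null p x}"
      then have "padic_Cauchy p a" using padic_null_Cauchy[OF p] by auto
      then show "\<ominus>\<^bsub>padic_Cauchy_ring p\<^esub> a \<in> {x. padic_null p x}" using inv neg a by simp
    next
      have "padic_null p (\<lambda>n. 0)" by (simp add: padic_null_def)
      then show "{x. padic_null p x} \<noteq> {}" by blast
    qed (auto simp: padic_Cauchy_ring_def padic_null_Cauchy[OF p] add)
  qed (auto simp: padic_Cauchy_ring_def mult mult')
qed

lemma padic_field_field: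
  assumes p: "prime p" shows "field (padic_field p)"
proof -
  let ?R = "padic_Cauchy_ring p" and ?I = "{x. padic_null p x}"
  interpret R: cring ?R by (rule padic_Cauchy_cring[OF p])
  interpret I: ideal ?I ?R by (rule padic_null_ideal[OF p])
  have one: "(\<lambda>n. 1) \<notin> ?I" by (simp add: padic_null_def LIMSEQ_const_iff)
  have "maximalideal ?I ?R"
  proof (rule maximalidealI[OF padic_null_ideal[OF p]])
    show "carrier ?R \<noteq> ?I" using one by (auto simp: padic_Cauchy_ring_def padic_Cauchy_const)
  next
    fix J assume J: "ideal J ?R" "?I \<subseteq> J" "J \<subseteq> carrier ?R"
    interpret J: ideal J ?R by (rule J)
    show "J = ?I \<or> J = carrier ?R"
    proof (cases "J \<subseteq> ?I")
      case False
      then obtain x where x: "x \<in> J" "\<not> padic_null p x" by auto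
      have xC: "padic_Cauchy p x" using x J by (auto simp: padic_Cauchy_ring_def)
      note inv = padic_Cauchy_inverse[OF p xC x(2)]
      have "(\<lambda>n. inverse (x n)) \<otimes>\<^bsub>?R\<^esub> x \<in> J"
        using x(1) inv(1) by (intro J.I_l_closed) (auto simp: padic_Cauchy_ring_def)
      then have 1: "(\<lambda>n. x n * inverse (x n)) \<in> J"
        by (simp add: padic_Cauchy_ring_def mult.commute)
      have "padic_null p (\<lambda>n. 1 - x n * inverse (x n))"
        using inv(2) padic_abs_minus[OF p, of "x n * inverse (x n) - 1" for n]
        by (simp add: padic_null_def)
      then have "(\<lambda>n. 1 - x n * inverse (x n)) \<in> J" using J by auto
      then have "(\<lambda>n. x n * inverse (x n)) \<oplus>\<^bsub>?R\<^esub> (\<lambda>n. 1 - x n * inverse (x n)) \<in> J"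
        by (rule J.a_closed[OF 1])
      then have "\<one>\<^bsub>?R\<^esub> \<in> J" by (simp add: padic_Cauchy_ring_def)
      then show ?thesis using J.one_imp_carrier by blast
    qed (use J in auto)
  qed
  then show ?thesis unfolding padic_field_def
    using maximalideal.quotient_is_field R.is_cring by blast
qed


subsection \<open>The Chatelet surfaces\<close>

text \<open>
  The smooth proper model of \<open>Y\<^sup>2 + Z\<^sup>2 = (a T\<^sup>2 + b) (c T\<^sup>2 + d)\<close> is the conic bundle
  \<open>y\<^sup>2 + z\<^sup>2 = (a t\<^sup>2 + b s\<^sup>2) (c t\<^sup>2 + d s\<^sup>2) w\<^sup>2\<close> over the projective line with coordinate
  \<open>[t : s]\<close>, inside the projective plane bundle with fibre coordinates \<open>[y : z : w]\<close>;
  the affine surface is the open subset \<open>s \<noteq> 0, w \<noteq> 0\<close>.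
  The points over a field \<open>K\<close> are the tuples \<open>(t, s, y, z, w)\<close> below modulo the scalings
  \<open>(\<lambda> t, \<lambda> s, \<mu> y, \<mu> z, \<mu> \<lambda>\<^sup>-\<^sup>2 w)\<close> with \<open>\<lambda>, \<mu>\<close> nonzero.
  By the Lang-Nishimura lemma the existence of points does not depend on the model chosen.
\<close>

definition chatelet_coords ::
    "('k, 'm) ring_scheme \<Rightarrow> int \<Rightarrow> int \<Rightarrow> int \<Rightarrow> int \<Rightarrow> ('k \<times> 'k \<times> 'k \<times> 'k \<times> 'k) set" where
  "chatelet_coords K a b c d =
     {(t, s, y, z, w).
        t \<in> carrier K \<and> s \<in> carrier K \<and> y \<in> carrier K \<and> z \<in> carrier K \<and> w \<in> carrier K \<and>
        (t, s) \<noteq> (\<zero>\<^bsub>K\<^esub>, \<zero>\<^bsub>K\<^esub>) \<and> (y, z, w) \<noteq> (\<zero>\<^bsub>K\<^esub>, \<zero>\<^bsub>K\<^esub>, \<zero>\<^bsub>K\<^esub>) \<and>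
        (y \<otimes>\<^bsub>K\<^esub> y) \<oplus>\<^bsub>K\<^esub> (z \<otimes>\<^bsub>K\<^esub> z) =
          (([a] \<cdot>\<^bsub>K\<^esub> (t \<otimes>\<^bsub>K\<^esub> t)) \<oplus>\<^bsub>K\<^esub> ([b] \<cdot>\<^bsub>K\<^esub> (s \<otimes>\<^bsub>K\<^esub> s))) \<otimes>\<^bsub>K\<^esub>
          (([c] \<cdot>\<^bsub>K\<^esub> (t \<otimes>\<^bsub>K\<^esub> t)) \<oplus>\<^bsub>K\<^esub> ([d] \<cdot>\<^bsub>K\<^esub> (s \<otimes>\<^bsub>K\<^esub> s))) \<otimes>\<^bsub>K\<^esub> (w \<otimes>\<^bsub>K\<^esub> w)}"

definition chatelet_scaling ::
    "('k, 'm) ring_scheme \<Rightarrow> (('k \<times> 'k \<times> 'k \<times> 'k \<times> 'k) \<times> ('k \<times> 'k \<times> 'k \<times> 'k \<times> 'k)) set" where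
  "chatelet_scaling K =
     {((t, s, y, z, w), (t', s', y', z', w')).
        \<exists>l\<in>carrier K - {\<zero>\<^bsub>K\<^esub>}. \<exists>m\<in>carrier K - {\<zero>\<^bsub>K\<^esub>}.
          t' = l \<otimes>\<^bsub>K\<^esub> t \<and> s' = l \<otimes>\<^bsub>K\<^esub> s \<and> y' = m \<otimes>\<^bsub>K\<^esub> y \<and> z' = m \<otimes>\<^bsub>K\<^esub> z \<and>
          l \<otimes>\<^bsub>K\<^esub> l \<otimes>\<^bsub>K\<^esub> w' = m \<otimes>\<^bsub>K\<^esub> w \<and> w' \<in> carrier K}"

definition chatelet_points ::
    "('k, 'm) ring_scheme \<Rightarrow> int \<Rightarrow> int \<Rightarrow> int \<Rightarrow> int \<Rightarrow> ('k \<times> 'k \<times> 'k \<times> 'k \<times> 'k) set set" where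
  "chatelet_points K a b c d = chatelet_coords K a b c d // chatelet_scaling K"

definition soluble_real :: "int \<Rightarrow> int \<Rightarrow> int \<Rightarrow> int \<Rightarrow> bool" where
  "soluble_real a b c d \<longleftrightarrow> chatelet_points (ring_of_type_algebra :: real ring) a b c d \<noteq> {}"

definition soluble_padic :: "nat \<Rightarrow> int \<Rightarrow> int \<Rightarrow> int \<Rightarrow> int \<Rightarrow> bool" where
  "soluble_padic p a b c d \<longleftrightarrow> chatelet_points (padic_field p) a b c d \<noteq> {}"

definition everywhere_locally_soluble :: "int \<Rightarrow> int \<Rightarrow> int \<Rightarrow> int \<Rightarrow> bool" where
  "everywhere_locally_soluble a b c d \<longleftrightarrow>
     soluble_real a b c d \<and> (\<forall>p. prime p \<longrightarrow> soluble_padic p a b c d)"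

definition nondegenerate :: "int \<Rightarrow> int \<Rightarrow> int \<Rightarrow> int \<Rightarrow> bool" where
  "nondegenerate a b c d \<longleftrightarrow> a * b * c * d * (a * d - b * c) \<noteq> 0"


subsection \<open>The counting function\<close>

definition set_A :: "int set" where
  "set_A = {n. n > 0 \<and> squarefree n}"

definition set_B :: "int set" where
  "set_B = {n \<in> set_A. \<forall>q. prime q \<and> q dvd n \<longrightarrow> [q = 3] (mod 4)}"

definition sign_rel :: "((int \<times> int \<times> int \<times> int) \<times> (int \<times> int \<times> int \<times> int)) set" where
  "sign_rel =
     {((a, b, c, d), (a', b', c', d')).
        (a', b', c', d') = (a, b, c, d) \<or> (a', b', c', d') = (- a, - b, - c, - d)}"

definition S_tot :: "(int \<times> int \<times> int \<times> int) set set" where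
  "S_tot =
     {(a, b, c, d). Gcd {a, b, c, d} = 1 \<and> nondegenerate a b c d \<and>
        gcd a c \<in> set_A \<and> gcd b d \<in> set_A \<and> gcd a b \<in> set_B \<and> gcd c d \<in> set_B} // sign_rel"

definition N_loc :: "real \<Rightarrow> real" where
  "N_loc P = 1 / 4 * real (card
     {x \<in> S_tot. \<exists>(a, b, c, d) \<in> x.
        real_of_int (Max {\<bar>a\<bar>, \<bar>b\<bar>, \<bar>c\<bar>, \<bar>d\<bar>}) \<le> P \<and> everywhere_locally_soluble a b c d})"


subsection \<open>The local densities\<close>

definition val :: "nat \<Rightarrow> int \<Rightarrow> enat" where
  "val p a = (if a = 0 then \<infinity> else enat (multiplicity (int p) a))"

definition delta :: "nat \<Rightarrow> enat" where
  "delta p = (if [p = 3] (mod 4) then 1 else 0)"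

text \<open>
  A residue class modulo \<open>p\<^sup>k\<close> does not determine a surface; we count it as soluble if it
  contains some nondegenerate integer quadruple whose surface has a p-adic point. As solubility
  is locally constant in nondegenerate coefficients, other choices change the counts below
  by \<open>o(p\<^sup>4\<^sup>k)\<close> only.
\<close>

definition residue_soluble :: "nat \<Rightarrow> nat \<Rightarrow> int \<Rightarrow> int \<Rightarrow> int \<Rightarrow> int \<Rightarrow> bool" where
  "residue_soluble p k a b c d \<longleftrightarrow>
     (\<exists>a' b' c' d'.
        [a' = a] (mod int p ^ k) \<and> [b' = b] (mod int p ^ k) \<and>
        [c' = c] (mod int p ^ k) \<and> [d' = d] (mod int p ^ k) \<and>
        nondegenerate a' b' c' d' \<and> soluble_padic p a' b' c' d')"

text \<open>Residue classes modulo \<open>p\<^sup>k\<close> are represented by \<open>{0..<p\<^sup>k}\<close>.\<close>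

definition local_count :: "nat \<Rightarrow> nat \<Rightarrow> nat" where
  "local_count p k = card
     {(a, b, c, d).
        {a, b, c, d} \<subseteq> {0..<int p ^ k} \<and>
        \<not> (int p dvd a \<and> int p dvd b \<and> int p dvd c \<and> int p dvd d) \<and>
        residue_soluble p k a b c d \<and>
        min (val p a) (val p c) \<le> 1 \<and> min (val p b) (val p d) \<le> 1 \<and>
        min (val p a) (val p b) \<le> delta p \<and> min (val p c) (val p d) \<le> delta p}"

definition tau_prime :: "nat \<Rightarrow> real" where
  "tau_prime p = lim (\<lambda>k. real (local_count p k) / real p ^ (4 * k))"

definition tau_infinity :: real where
  "tau_infinity = 7 / 4"

definition tau_loc :: real where
  "tau_loc = tau_infinity * prodinf (\<lambda>n. if prime n then tau_prime n else 1)"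

end

theory Submission
  imports Defs "HOL-Number_Theory.Number_Theory"
begin

text \<open>
  Fix a prime \<open>p\<close> that is 2 or 3 modulo 4 (if \<open>p \<equiv> 1\<close> modulo 4, then \<open>y\<^sup>2 + z\<^sup>2 = 0\<close>,
  \<open>w = 0\<close> has a nontrivial solution). The surface has
  a \<open>p\<close>-adic point iff \<open>(a t\<^sup>2 + b s\<^sup>2) (c t\<^sup>2 + d s\<^sup>2)\<close> represents a nonzero norm from
  \<open>\<rat>\<^sub>p(i)\<close>. If \<open>- a b\<close> or \<open>- c d\<close> is a \<open>p\<close>-adic square this always happens, near a root of the
  form; otherwise both forms are anisotropic, and then the norm class of their values depends only
  on the leading digits of \<open>a, b, c, d\<close>. So the residue class modulo \<open>p\<^sup>k\<close> decides solubility
  unless \<open>p\<^sup>k\<close> (up to a bounded power of 2) divides one of the coefficients. Together with the remark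
  that for odd \<open>p\<close> a failure forces \<open>p\<close> to divide two coefficients, this shows that the classes modulo
  \<open>p\<^sup>k\<close> all of whose members are bad, but whose reduction modulo \<open>p\<^sup>k\<^sup>-\<^sup>1\<close> still has a good member,
  have density \<open>O(p\<^sup>-\<^sup>m)\<close> with \<open>m = max k 2\<close>.

  Writing the indicator function of badness at \<open>p\<close> as the sum over \<open>k\<close> of the indicator functions of
  these classes and expanding the product over \<open>p\<close> gives a signed sum over moduli \<open>q\<close> of indicator
  functions that are periodic modulo \<open>q\<close>. Moduli up to \<open>Q = N\<^bsup>2/5\<^esup>\<close> are counted by covering
  each orthant of the box with cubes of side \<open>q\<close>. If a point is bad for a larger modulus composed of
  prime powers up to \<open>R = N\<^bsup>3/5\<^esup>\<close>, then it is bad for a modulus between \<open>Q\<close> and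
  \<open>Q R = N\<close>, and these are rare. The Euler product is the same expansion for the densities.
\<close>

subsection \<open>Norm classes of integers\<close>

text \<open>The sum over moduli is controlled by Rankin's method. Level \<open>k\<close> of a prime
  has density O(p^(-max k 2)), so the weights (p^k)^(1/3) still leave a convergent Euler product
  (the worst level, k = 2, contributes p^(-4/3)), and a tail beyond X gains X^(-1/3). The obstacle
  is that the expansion contains moduli far beyond the box, about which periodicity says nothing. At
  one point the number of nonzero terms is 2 to the number of its bad primes; these primes divide
  2abcd, so a divisor bound applies and the large moduli cost only a small power of N. The exponents
  2/5 and 3/5 balance two losses under Q R = N: the tail Q^(-1/3) and the factor R^(-2/9) from
  badness visible only beyond R are both N^(-2/15). Since 2/15 = 1/8 + 1/120, the surplus 1/120 pays
  for the divisor bound. The real place enters through signs only: real solubility fails in 2 of the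
  16 orthants. Halving for the sign relation and the factor 1/4 turn the other 14 into 14/8 =
  7/4.\<close>

lemma prime_power_decompose:
  fixes n :: int
  assumes "prime p" "n \<noteq> 0"
  obtains k u where "n = int p ^ k * u" "\<not> int p dvd u"
proof -
  have "\<not> is_unit (int p)" using assms(1) by (metis not_prime_unit prime_nat_int_transfer)
  then show ?thesis using multiplicity_decompose'[of n "int p"] assms(2) that by blast
qed

lemma prime_power_dvd_mult_iff:
  fixes u :: int
  assumes "prime p" "\<not> int p dvd u"
  shows "int p ^ i dvd int p ^ k * u \<longleftrightarrow> i \<le> k"
proof
  assume L: "int p ^ i dvd int p ^ k * u"
  show "i \<le> k"
  proof (rule ccontr)
    assume "\<not> i \<le> k"
    then have "int p ^ Suc k dvd int p ^ k * u" using L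
      by (meson dvd_trans le_imp_power_dvd not_less_eq_eq)
    then have "int p dvd u" using assms(1) by (auto simp: prime_gt_0_nat)
    then show False using assms by simp
  qed
qed (simp add: le_imp_power_dvd)

text \<open>Valuations add, so v(a) <= i and v(b) < j would give v(ab) < i + j. The asymmetric
  \<open>Suc i\<close> suits uses in which one factor is known not to be divisible by
  \<open>int p ^ Suc i\<close>: the other one then carries the whole power \<open>j\<close>.\<close>

lemma prime_power_dvd_split:
  fixes a b :: int
  assumes p: "prime p" and "int p ^ (i + j) dvd a * b"
  shows "int p ^ Suc i dvd a \<or> int p ^ j dvd b"
proof (cases "a = 0 \<or> b = 0")
  case False
  obtain k u where a: "a = int p ^ k * u" "\<not> int p dvd u" using prime_power_decompose[OF p] False by metis
  obtain l v where b: "b = int p ^ l * v" "\<not> int p dvd v" using prime_power_decompose[OF p] False by metis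
  have pi: "prime (int p)" using p by simp
  have "\<not> int p dvd u * v" using a b pi by (simp add: prime_dvd_mult_iff)
  moreover have "a * b = int p ^ (k + l) * (u * v)" using a b by (simp add: power_add)
  ultimately have "i + j \<le> k + l" using assms(2) prime_power_dvd_mult_iff[OF p] by metis
  then have "Suc i \<le> k \<or> j \<le> l" by linarith
  then show ?thesis using a b by (auto intro!: dvd_mult2 le_imp_power_dvd simp del: power_Suc)
qed auto

text \<open>
  For \<open>p = 2\<close> or \<open>p \<equiv> 3\<close> modulo 4 this says that \<open>n\<close> is a nonzero norm from \<open>\<rat>\<^sub>p(i)\<close>.
\<close>

definition locnorm :: "nat \<Rightarrow> int \<Rightarrow> bool" where
  "locnorm p n \<longleftrightarrow> n \<noteq> 0 \<and>
     (if p = 2 then (n div 2 ^ multiplicity 2 n) mod 4 = 1 else even (multiplicity (int p) n))"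

lemma locnorm_iff:
  assumes p: "prime p" and u: "\<not> int p dvd u"
  shows "locnorm p (int p ^ k * u) \<longleftrightarrow> (if p = 2 then u mod 4 = 1 else even k)"
proof -
  have "multiplicity (int p) (int p ^ k * u) = k"
    by (intro multiplicity_eqI) (simp_all add: prime_power_dvd_mult_iff[OF p u] del: power_Suc)
  moreover have "int p \<noteq> 0" "u \<noteq> 0" using p u by (auto simp: prime_gt_0_nat)
  ultimately show ?thesis by (auto simp: locnorm_def)
qed

lemma locnorm_nonzero: "locnorm p n \<Longrightarrow> n \<noteq> 0"
  by (simp add: locnorm_def)

text \<open>The condition is the kernel of a homomorphism onto a group of order two: parity of the
  valuation for odd p, odd part modulo 4 for p = 2. Hence two non-norms multiply to a norm, and the
  two quadratic forms can be classified separately.\<close>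

lemma locnorm_mult:
  assumes p: "prime p" and "m \<noteq> 0" "n \<noteq> 0"
  shows "locnorm p (m * n) \<longleftrightarrow> (locnorm p m \<longleftrightarrow> locnorm p n)"
proof -
  obtain k u where a: "m = int p ^ k * u" "\<not> int p dvd u" using prime_power_decompose[OF p] assms by metis
  obtain l v where b: "n = int p ^ l * v" "\<not> int p dvd v" using prime_power_decompose[OF p] assms by metis
  have pi: "prime (int p)" using p by simp
  have uv: "\<not> int p dvd u * v" using a b pi by (simp add: prime_dvd_mult_iff)
  have mn: "m * n = int p ^ (k + l) * (u * v)" using a b by (simp add: power_add)
  have iffs: "locnorm p m \<longleftrightarrow> (if p = 2 then u mod 4 = 1 else even k)"
    "locnorm p n \<longleftrightarrow> (if p = 2 then v mod 4 = 1 else even l)"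
    "locnorm p (m * n) \<longleftrightarrow> (if p = 2 then u * v mod 4 = 1 else even (k + l))"
    by (simp_all only: mn) (simp_all only: a(1) b(1) locnorm_iff[OF p a(2)] locnorm_iff[OF p b(2)] locnorm_iff[OF p uv])
  show ?thesis
  proof (cases "p = 2")
    case True
    have "odd u" "odd v" using a b True by auto
    then have "u mod 4 = 1 \<or> u mod 4 = 3" "v mod 4 = 1 \<or> v mod 4 = 3" by presburger+
    moreover have "u * v mod 4 = (u mod 4) * (v mod 4) mod 4" by (simp add: mod_mult_eq)
    ultimately have "u * v mod 4 = 1 \<longleftrightarrow> (u mod 4 = 1 \<longleftrightarrow> v mod 4 = 1)" by auto
    then show ?thesis using iffs True by simp
  next
    case False
    then show ?thesis using iffs by auto
  qed
qed

lemma locnorm_square: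
  assumes "prime p" "m \<noteq> 0" "n \<noteq> 0"
  shows "locnorm p (m\<^sup>2 * n) \<longleftrightarrow> locnorm p n"
proof -
  have "locnorm p (m * (m * n)) \<longleftrightarrow> locnorm p n"
    using locnorm_mult[of p m "m * n"] locnorm_mult[of p m n] assms by auto
  then show ?thesis by (simp add: power2_eq_square mult.assoc)
qed

text \<open>
  \<open>class_loss\<close> is the number of digits after the leading one that determine the norm class;
  the valuation of a value of an anisotropic form exceeds that of its two terms by at most \<open>iso_loss\<close>.
\<close>

definition class_loss :: "nat \<Rightarrow> nat" where "class_loss p = (if p = 2 then 1 else 0)"
definition iso_loss :: "nat \<Rightarrow> nat" where "iso_loss p = (if p = 2 then 2 else 0)"

text \<open>The leading digit of \<open>n\<close> sits at a position k < j. A change divisible by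
  \<open>int p ^ (j + class_loss p)\<close> leaves it alone, and for p = 2 also the next digit; the
  norm class reads nothing else.\<close>

lemma locnorm_cong:
  assumes p: "prime p" and n: "\<not> int p ^ j dvd n" and d: "int p ^ (j + class_loss p) dvd n' - n"
  shows "locnorm p n' \<longleftrightarrow> locnorm p n" and "n' \<noteq> 0"
proof -
  have n0: "n \<noteq> 0" using n by auto
  obtain k u where a: "n = int p ^ k * u" "\<not> int p dvd u" using prime_power_decompose[OF p n0] by metis
  have kj: "k < j" using n a prime_power_dvd_mult_iff[OF p a(2)] by auto
  then have "int p ^ (k + 1 + class_loss p) dvd n' - n"
    by (intro power_le_dvd[OF d]) simp
  then obtain r where r: "n' - n = int p ^ (k + 1 + class_loss p) * r" by (auto simp: dvd_def)
  define u' where "u' = u + int p ^ (1 + class_loss p) * r"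
  have n': "n' = int p ^ k * u'" using r a unfolding u'_def by (simp add: power_add algebra_simps)
  have u': "\<not> int p dvd u'" using a(2) unfolding u'_def
    by (metis dvd_add_left_iff dvd_mult2 dvd_power_iff_le le_add1 dvd_triv_left power_add power_one_right)
  have "p = 2 \<Longrightarrow> u' mod 4 = u mod 4" unfolding u'_def class_loss_def by (simp add: power2_eq_square)
  then show "locnorm p n' \<longleftrightarrow> locnorm p n"
    using locnorm_iff[OF p a(2), of k] locnorm_iff[OF p u', of k] a n' by simp
  show "n' \<noteq> 0" using n' u' p by (auto simp: prime_gt_0_nat)
qed

text \<open>Supplies p-adically small numbers in either class. At 2 the sign switches the class, at
  odd p one more factor p does.\<close>

lemma locnorm_ex:
  assumes p: "prime p"
  obtains M where "int p ^ i dvd M" "M \<noteq> 0" "locnorm p M = B"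
proof (cases "p = 2")
  case True
  have "locnorm p (2 ^ i * 1)" "\<not> locnorm p (2 ^ i * (-1))"
    using locnorm_iff[OF p, of 1 i] locnorm_iff[OF p, of "-1" i] True by auto
  then show ?thesis using that[of "2 ^ i * 1"] that[of "2 ^ i * (-1)"] True by (cases B) auto
next
  case False
  have p1: "\<not> int p dvd 1" using p by auto
  have "locnorm p (int p ^ i * 1) \<longleftrightarrow> even i" "locnorm p (int p ^ Suc i * 1) \<longleftrightarrow> odd i"
    using locnorm_iff[OF p p1, of i] locnorm_iff[OF p p1, of "Suc i"] False by auto
  moreover have "int p \<noteq> 0" using p by auto
  ultimately show ?thesis using that[of "int p ^ i * 1"] that[of "int p ^ Suc i * 1"] 
    by (cases "even i = B") auto
qed

section \<open>Sums of two squares are norms\<close>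

text \<open>Otherwise z / y is a square root of -1 modulo p, and Euler's criterion with (p - 1) / 2
  odd gives 1 = -1 modulo p.\<close>

lemma prime_3_mod_4_dvd_sum_squares:
  assumes p: "prime p" "[p = 3] (mod 4)" and d: "int p dvd y\<^sup>2 + z\<^sup>2"
  shows "int p dvd y"
proof (rule ccontr)
  assume y: "\<not> int p dvd y"
  have pi: "prime (int p)" using p by simp
  obtain i where i: "[y * i = 1] (mod int p)"
    using y pi by (metis cong_solve_coprime_int coprime_commute prime_imp_coprime)
  have "[(z * i)\<^sup>2 = (y\<^sup>2 + z\<^sup>2) * i\<^sup>2 - (y * i)\<^sup>2] (mod int p)"
    by (simp add: algebra_simps power2_eq_square)
  also have "[(y\<^sup>2 + z\<^sup>2) * i\<^sup>2 - (y * i)\<^sup>2 = 0 - 1\<^sup>2] (mod int p)"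
    by (intro cong_diff cong_pow i) (use d in \<open>simp add: cong_0_iff\<close>)
  finally have "QuadRes (int p) (-1)" unfolding QuadRes_def by auto
  have "p mod 4 = 3" using p(2) by (simp add: cong_def)
  then have p2: "p > 2" "odd ((p - 1) div 2)" using p(1) by presburger+
  have "\<not> [-1 = 0] (mod int p)" using pi p2 by (simp add: cong_0_iff)
  then have "Legendre (-1) (int p) = 1" using \<open>QuadRes (int p) (-1)\<close> by (simp add: Legendre_def)
  then have "[1 = (-1) ^ ((p - 1) div 2)] (mod int p)"
    using euler_criterion[OF p(1) p2(1), of "-1"] by simp
  then have "[1 = -1] (mod int p)" using p2(2) by simp
  then have "int p dvd 2" by (simp add: cong_iff_dvd_diff)
  then have "int p \<le> 2" by (rule zdvd_imp_le) simp
  then show False using p2 by simp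
qed

text \<open>Primitive pairs are the end point of the descent below. At 2, squares modulo 8 show that
  the sum is 2 (4m + 1) or 4m + 1; for p congruent to 3 modulo 4 it is a unit.\<close>

lemma sum_squares_not_dvd:
  assumes p: "prime p" "p = 2 \<or> [p = 3] (mod 4)" and yz: "\<not> (int p dvd y \<and> int p dvd z)"
  shows "\<not> int p ^ 2 dvd y\<^sup>2 + z\<^sup>2" and "locnorm p (y\<^sup>2 + z\<^sup>2)"
proof -
  have "\<not> int p ^ 2 dvd y\<^sup>2 + z\<^sup>2 \<and> locnorm p (y\<^sup>2 + z\<^sup>2)"
  proof (cases "p = 2")
    case True
    have sq: "(odd x \<longrightarrow> x\<^sup>2 mod 8 = 1) \<and> (even x \<longrightarrow> x\<^sup>2 mod 4 = 0)" for x :: int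
    proof -
      have "x mod 8 \<in> {0,1,2,3,4,5,6,7}" by auto
      then have "(odd (x mod 8) \<longrightarrow> (x mod 8)\<^sup>2 mod 8 = 1) \<and> (even (x mod 8) \<longrightarrow> (x mod 8)\<^sup>2 mod 8 mod 4 = 0)" by auto
      moreover have "(x mod 8)\<^sup>2 mod 8 = x\<^sup>2 mod 8" by (simp add: power_mod)
      moreover have "x\<^sup>2 mod 8 mod 4 = x\<^sup>2 mod 4" by (simp add: mod_mod_cancel)
      moreover have "even (x mod 8) = even x" by presburger
      ultimately show ?thesis by metis
    qed
    show ?thesis
    proof (cases "odd y \<and> odd z")
      case both: True
      then have "y\<^sup>2 mod 8 = 1" "z\<^sup>2 mod 8 = 1" using sq by auto
      then have "y\<^sup>2 = 8 * (y\<^sup>2 div 8) + 1" "z\<^sup>2 = 8 * (z\<^sup>2 div 8) + 1" by (metis mult_div_mod_eq)+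
      then obtain m where m: "y\<^sup>2 + z\<^sup>2 = 2 ^ 1 * (4 * m + 1)"
        by (intro that[of "y\<^sup>2 div 8 + z\<^sup>2 div 8"]) (simp add: algebra_simps)
      have "locnorm 2 (int 2 ^ 1 * (4 * m + 1))" using locnorm_iff[of 2 "4 * m + 1" 1] True by simp
      moreover have "\<not> 4 dvd (2 ^ 1 * (4 * m + 1))" by (simp, presburger)
      ultimately show ?thesis using m True by simp
    next
      case False
      then have "(y\<^sup>2 + z\<^sup>2) mod 4 = 1" using sq[of y] sq[of z] yz True
        by (cases "odd y") (auto, presburger+)
      then obtain m where m: "y\<^sup>2 + z\<^sup>2 = 4 * m + 1"
        by (intro that[of "(y\<^sup>2 + z\<^sup>2) div 4"]) presburger
      have "locnorm 2 (int 2 ^ 0 * (4 * m + 1))" using locnorm_iff[of 2 "4 * m + 1" 0] True by simp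
      moreover have "\<not> 4 dvd (4 * m + 1)" by presburger
      ultimately show ?thesis using m True by simp
    qed
  next
    case False
    then have p3: "[p = 3] (mod 4)" using p by auto
    have nd: "\<not> int p dvd y\<^sup>2 + z\<^sup>2"
      using prime_3_mod_4_dvd_sum_squares[OF p(1) p3, of y z] prime_3_mod_4_dvd_sum_squares[OF p(1) p3, of z y] yz
      by (auto simp: add.commute)
    then have "locnorm p (int p ^ 0 * (y\<^sup>2 + z\<^sup>2))" using locnorm_iff[OF p(1) nd, of 0] False by simp
    moreover have "\<not> int p ^ 2 dvd y\<^sup>2 + z\<^sup>2" using nd by (meson dvd_power dvd_trans zero_less_numeral)
    ultimately show ?thesis by simp
  qed
  then show "\<not> int p ^ 2 dvd y\<^sup>2 + z\<^sup>2" "locnorm p (y\<^sup>2 + z\<^sup>2)" by auto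
qed

text \<open>A common factor p of \<open>y\<close> and \<open>z\<close> changes the value by the
  square of p, so descent on the size of the pair ends at a primitive one.\<close>

lemma locnorm_sum_squares:
  assumes p: "prime p" "p = 2 \<or> [p = 3] (mod 4)" and "y\<^sup>2 + z\<^sup>2 \<noteq> 0"
  shows "locnorm p (y\<^sup>2 + z\<^sup>2)"
  using assms(3)
proof (induction "nat (\<bar>y\<bar> + \<bar>z\<bar>)" arbitrary: y z rule: less_induct)
  case less
  show ?case
  proof (cases "int p dvd y \<and> int p dvd z")
    case True
    then obtain y' z' where yz: "y = int p * y'" "z = int p * z'" by (auto simp: dvd_def)
    have p2: "int p \<ge> 2" using p(1) prime_ge_2_nat by auto
    have eq: "y\<^sup>2 + z\<^sup>2 = (int p)\<^sup>2 * (y'\<^sup>2 + z'\<^sup>2)" using yz by (simp add: power_mult_distrib algebra_simps)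
    then have nz: "y'\<^sup>2 + z'\<^sup>2 \<noteq> 0" using less.prems by auto
    then have pos: "\<bar>y'\<bar> + \<bar>z'\<bar> > 0" by (auto simp: sum_power2_eq_zero_iff)
    have "\<bar>y\<bar> + \<bar>z\<bar> = int p * (\<bar>y'\<bar> + \<bar>z'\<bar>)" using yz by (simp add: abs_mult algebra_simps)
    also have "\<dots> \<ge> 2 * (\<bar>y'\<bar> + \<bar>z'\<bar>)" using p2 pos by (intro mult_right_mono) auto
    finally have "nat (\<bar>y'\<bar> + \<bar>z'\<bar>) < nat (\<bar>y\<bar> + \<bar>z\<bar>)" using pos by (simp add: zless_nat_conj)
    then have "locnorm p (y'\<^sup>2 + z'\<^sup>2)" using less.hyps nz by blast
    then show ?thesis using eq locnorm_square[OF p(1), of "int p"] nz p2 by auto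
  next
    case False
    then show ?thesis using sum_squares_not_dvd(2)[OF p] by blast
  qed
qed

section \<open>Square roots modulo prime powers\<close>

lemma ex_linear_cong:
  assumes "prime p" "\<not> int p dvd c"
  obtains y where "int p dvd r + c * y"
proof -
  have "coprime c (int p)" using assms by (metis coprime_commute prime_imp_coprime prime_nat_int_transfer)
  then obtain i where "[c * i = 1] (mod int p)" using cong_solve_coprime_int by blast
  then have "[r + c * (i * (-r)) = r + 1 * (- r)] (mod int p)"
    by (simp only: mult.assoc[symmetric]) (intro cong_add cong_mult cong_refl)
  then have "int p dvd r + c * (i * (-r))" by (simp add: cong_0_iff)
  then show ?thesis using that by blast
qed

lemma not_dvd_of_cong_1:
  assumes "prime p" "int p ^ (1 + k) dvd x - 1"
  shows "\<not> int p dvd x"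
proof
  assume "int p dvd x"
  moreover have "int p dvd x - 1" using power_le_dvd[OF assms(2), of 1] by simp
  ultimately have "int p dvd x - (x - 1)" by (rule dvd_diff)
  then show False using assms(1) by simp
qed

text \<open>Hensel lifting of square roots; at 2 the starting congruence is modulo 8.\<close>

lemma ex_square_cong:
  assumes p: "prime p" and U: "\<not> int p dvd U" and UV: "int p ^ (1 + iso_loss p) dvd U - V"
  shows "\<exists>x. int p ^ (1 + class_loss p) dvd x - 1 \<and> int p ^ n dvd U * x\<^sup>2 - V"
proof -
  have pi: "prime (int p)" using p by simp
  have "\<exists>x. int p ^ (1 + class_loss p) dvd x - 1 \<and> int p ^ (1 + iso_loss p + n) dvd U * x\<^sup>2 - V" for n
  proof (induction n)
    case 0
    show ?case using UV by (intro exI[of _ 1]) simp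
  next
    case (Suc n)
    then obtain x r where x1: "int p ^ (1 + class_loss p) dvd x - 1" and x: "U * x\<^sup>2 - V = int p ^ (1 + iso_loss p + n) * r"
      by (auto simp: dvd_def)
    have xp: "\<not> int p dvd x" using not_dvd_of_cong_1[OF p x1] .
    have Ux: "\<not> int p dvd U * x" using U xp pi by (simp add: prime_dvd_mult_iff)
    show ?case
    proof (cases "p = 2")
      case True
      show ?thesis
      proof (cases "even r")
        case r: True
        then have "int p ^ (1 + iso_loss p + Suc n) dvd U * x\<^sup>2 - V" using x True by (auto elim!: evenE)
        then show ?thesis using x1 by blast
      next
        case False
        have odd: "odd (U * x)" using Ux True by simp
        \<comment> \<open>The increment is half the current modulus 2^(3 + n), because the cross
          term of the square brings another factor 2. That term adds the odd number
          \<open>U * x\<close> to \<open>r\<close> and so repairs its parity.\<close>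
        let ?x = "x + 2 ^ (2 + n)"
        have "U * ?x\<^sup>2 - V = (U * x\<^sup>2 - V) + 2 ^ (3 + n) * (U * x) + U * (2 ^ (2 + n))\<^sup>2"
          by (simp add: power2_eq_square algebra_simps power_add)
        also have "(2 ^ (2 + n))\<^sup>2 = (2 ^ (3 + n) * (2 * 2 ^ n) :: int)"
          by (simp add: power2_eq_square power_add)
        also have "(U * x\<^sup>2 - V) = 2 ^ (3 + n) * r" using x True by (simp add: iso_loss_def power_add)
        finally have eq: "U * ?x\<^sup>2 - V = 2 ^ (3 + n) * (r + U * x + 2 * (U * 2 ^ n))" by (simp add: algebra_simps)
        have "even (r + U * x + 2 * (U * 2 ^ n))" using odd False by simp
        then have "2 ^ (3 + n) * 2 dvd U * ?x\<^sup>2 - V" unfolding eq by (intro mult_dvd_mono) auto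
        moreover have "int p ^ (1 + class_loss p) dvd ?x - 1"
          using dvd_add[OF x1, of "2 ^ (2 + n)"] True by (simp add: class_loss_def power_add algebra_simps)
        moreover have "int p ^ (1 + iso_loss p + Suc n) = 2 ^ (3 + n) * 2"
          using True by (simp add: iso_loss_def power_add)
        ultimately have "int p ^ (1 + iso_loss p + Suc n) dvd U * ?x\<^sup>2 - V" "int p ^ (1 + class_loss p) dvd ?x - 1"
          using True by metis+
        then show ?thesis by blast
      qed
    next
      case False
      let ?q = "int p ^ (1 + n)"
      have "\<not> int p dvd 2"
      proof
        assume "int p dvd 2"
        then have "int p \<le> 2" by (rule zdvd_imp_le) simp
        then show False using False prime_ge_2_nat[OF p] by simp
      qed
      then have "\<not> int p dvd 2 * (U * x)" using Ux pi by (metis prime_dvd_mult_iff)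
      then obtain y where y: "int p dvd r + 2 * (U * x) * y" using ex_linear_cong[OF p] by blast
      have "U * (x + ?q * y)\<^sup>2 - V = (U * x\<^sup>2 - V) + ?q * (2 * (U * x) * y) + ?q * ?q * (U * y\<^sup>2)"
        by (simp add: power2_eq_square algebra_simps)
      also have "(U * x\<^sup>2 - V) = ?q * r" using x False by (simp add: iso_loss_def)
      finally have "U * (x + ?q * y)\<^sup>2 - V = ?q * ((r + 2 * (U * x) * y) + ?q * (U * y\<^sup>2))"
        by (simp add: algebra_simps)
      moreover have "int p dvd (r + 2 * (U * x) * y) + ?q * (U * y\<^sup>2)"
        by (intro dvd_add[OF y] dvd_mult2 dvd_power) auto
      ultimately have "int p ^ (1 + iso_loss p + Suc n) dvd U * (x + ?q * y)\<^sup>2 - V"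
        using False by (auto simp: iso_loss_def dvd_def mult.assoc mult.left_commute)
      moreover have "int p ^ (1 + class_loss p) dvd (x - 1) + ?q * y"
        using x1 False by (intro dvd_add) (simp_all add: class_loss_def)
      then have "int p ^ (1 + class_loss p) dvd x + ?q * y - 1" by (simp add: algebra_simps)
      ultimately show ?thesis by blast
    qed
  qed
  from this[of n] show ?thesis by (meson dvd_trans le_add2 le_imp_power_dvd)
qed

text \<open>
  By Hensel's lemma the following is equivalent to \<open>- a b\<close> being a nonzero \<open>p\<close>-adic square.
\<close>

definition iso_form :: "nat \<Rightarrow> int \<Rightarrow> int \<Rightarrow> bool" where
  "iso_form p a b \<longleftrightarrow>
     (\<exists>j t s. \<not> int p ^ j dvd a * t\<^sup>2 \<and> int p ^ (j + iso_loss p) dvd a * t\<^sup>2 + b * s\<^sup>2)"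

definition intsol :: "nat \<Rightarrow> int \<Rightarrow> int \<Rightarrow> int \<Rightarrow> int \<Rightarrow> bool" where
  "intsol p a b c d \<longleftrightarrow> (\<exists>t s. locnorm p ((a * t\<^sup>2 + b * s\<^sup>2) * (c * t\<^sup>2 + d * s\<^sup>2)))"

section \<open>Isotropic forms force solubility\<close>

text \<open>Since the sum vanishes to higher order than its first term, both terms have the same
  valuation and their unit parts are opposite modulo p, or modulo 8 at 2. This is the starting
  congruence of \<open>ex_square_cong\<close>.\<close>

lemma iso_form_witness:
  assumes p: "prime p" and iso: "iso_form p a b"
  obtains m t s U W where "a * t\<^sup>2 = int p ^ m * U" "b * s\<^sup>2 = int p ^ m * W"
    "\<not> int p dvd U" "\<not> int p dvd W" "int p ^ (1 + iso_loss p) dvd U + W"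
proof -
  obtain j t s where jts: "\<not> int p ^ j dvd a * t\<^sup>2" "int p ^ (j + iso_loss p) dvd a * t\<^sup>2 + b * s\<^sup>2"
    using iso unfolding iso_form_def by blast
  have "a * t\<^sup>2 \<noteq> 0" using jts(1) by (metis dvd_0_right)
  then obtain m U where U: "a * t\<^sup>2 = int p ^ m * U" "\<not> int p dvd U" using prime_power_decompose[OF p] by metis
  have m: "m < j" using jts(1) U prime_power_dvd_mult_iff[OF p U(2)] by auto
  then have "int p ^ (m + 1 + iso_loss p) dvd a * t\<^sup>2 + b * s\<^sup>2"
    by (intro power_le_dvd[OF jts(2)]) simp
  then obtain r where r: "a * t\<^sup>2 + b * s\<^sup>2 = int p ^ (m + 1 + iso_loss p) * r" by (auto simp: dvd_def)
  define W where "W = int p ^ (1 + iso_loss p) * r - U"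
  have W: "b * s\<^sup>2 = int p ^ m * W" using r U unfolding W_def by (simp add: algebra_simps power_add)
  have "\<not> int p dvd W" using U(2) unfolding W_def
    by (metis dvd_diff_right_iff dvd_mult2 dvd_power le_add1 zero_less_one_class.zero_le_one dvd_triv_left power_add power_one_right)
  moreover have "int p ^ (1 + iso_loss p) dvd U + W" unfolding W_def by simp
  ultimately show ?thesis using that U W by blast
qed

text \<open>
  Near a root of \<open>a t\<^sup>2 + b s\<^sup>2\<close> the other form has constant norm class, whereas the first one
  takes all small values in the direction of \<open>t\<^sup>2\<close>, so its norm class can be prescribed.
\<close>

lemma intsol_of_iso:
  assumes p: "prime p" and iso: "iso_form p a b" and nd: "a * d - b * c \<noteq> 0"
  shows "intsol p a b c d"
proof -
  obtain m t s U W where U: "a * t\<^sup>2 = int p ^ m * U" "\<not> int p dvd U" 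
    and W: "b * s\<^sup>2 = int p ^ m * W" "\<not> int p dvd W" and UW: "int p ^ (1 + iso_loss p) dvd U + W"
    using iso_form_witness[OF p iso] by metis
  have p0: "int p \<noteq> 0" using p by auto
  have ts: "t \<noteq> 0" "s \<noteq> 0" and UW0: "U \<noteq> 0" "W \<noteq> 0"
    using U W p0 by (auto simp: zero_power2)
  define C D where "C = c * t\<^sup>2" and "D = d * s\<^sup>2"
  \<comment> \<open>At a root of the first form, U x^2 = -W, and U times the second form, U (C x^2 +
    D), becomes \<open>E\<close>. It is nonzero because the two forms have no common root, which is
    \<open>nd\<close>.\<close>
  define E where "E = D * U - C * W"
  have "int p ^ m * E = (a * t\<^sup>2) * D - (b * s\<^sup>2) * C" using U W by (simp add: E_def algebra_simps)
  also have "\<dots> = t\<^sup>2 * s\<^sup>2 * (a * d - b * c)" by (simp add: C_def D_def algebra_simps)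
  finally have E0: "E \<noteq> 0" using ts nd by auto
  obtain j where j: "\<not> int p ^ j dvd E"
    using prime_power_decompose[OF p E0] prime_power_dvd_mult_iff[OF p] by (metis Suc_n_not_le_n)
  \<comment> \<open>Divisibility of \<open>M\<close> by this power does two things:
    \<open>M - W\<close> still satisfies the starting congruence for a square root, and moving off
    the root by \<open>M\<close> does not change the class of \<open>E\<close>.\<close>
  define i where "i = j + class_loss p + 1 + iso_loss p"
  \<comment> \<open>The class of \<open>M\<close> is chosen such that
    \<open>(int p ^ m * U) * (M * E)\<close> is a norm. The actual values \<open>Y\<close> and
    \<open>G\<close> will be so close to \<open>M\<close> and \<open>E\<close> that they inherit
    these classes.\<close>
  obtain M where M: "int p ^ i dvd M" "M \<noteq> 0" "locnorm p M = locnorm p (int p ^ m * U * E)"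
    using locnorm_ex[OF p] by blast
  obtain l where l: "\<not> int p ^ l dvd M"
    using prime_power_decompose[OF p M(2)] prime_power_dvd_mult_iff[OF p] by (metis Suc_n_not_le_n)
  \<comment> \<open>\<open>l + class_loss p\<close> digits preserve the class of \<open>M\<close>;
    the further \<open>i\<close> digits make the error negligible for \<open>E\<close> as
    well.\<close>
  define n where "n = l + class_loss p + i"
  have "int p ^ (1 + iso_loss p) dvd M"
    by (rule power_le_dvd[OF M(1)]) (simp add: i_def)
  then have "int p ^ (1 + iso_loss p) dvd U - (M - W)"
    using dvd_diff[OF UW] by (simp add: algebra_simps)
  then obtain x where x: "int p ^ n dvd U * x\<^sup>2 - (M - W)" using ex_square_cong[OF p U(2)] by blast
  define Y where "Y = U * x\<^sup>2 + W"
  have YM: "int p ^ n dvd Y - M" using x by (simp add: Y_def algebra_simps)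
  have 1: "locnorm p Y = locnorm p M" "Y \<noteq> 0"
    using locnorm_cong[OF p l power_le_dvd[OF YM]] by (simp_all add: n_def)
  define G where "G = U * (C * x\<^sup>2 + D)"
  have "G - E = C * (Y - M) + C * M" by (simp add: G_def E_def Y_def algebra_simps)
  moreover have "int p ^ (j + class_loss p) dvd M"
    by (rule power_le_dvd[OF M(1)]) (simp add: i_def)
  moreover have "int p ^ (j + class_loss p) dvd Y - M"
    by (rule power_le_dvd[OF YM]) (simp add: n_def i_def)
  ultimately have "int p ^ (j + class_loss p) dvd G - E" by simp
  note 2 = locnorm_cong[OF p j this]
  have eq: "U\<^sup>2 * ((a * (t * x)\<^sup>2 + b * s\<^sup>2) * (c * (t * x)\<^sup>2 + d * s\<^sup>2)) = (int p ^ m * U) * (Y * G)"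
  proof -
    have "a * (t * x)\<^sup>2 + b * s\<^sup>2 = (a * t\<^sup>2) * x\<^sup>2 + b * s\<^sup>2" by (simp add: power_mult_distrib)
    also have "\<dots> = int p ^ m * Y" unfolding U(1) W(1) Y_def by (simp add: algebra_simps)
    finally have "a * (t * x)\<^sup>2 + b * s\<^sup>2 = int p ^ m * Y" .
    then show ?thesis by (simp add: G_def C_def D_def power_mult_distrib power2_eq_square algebra_simps)
  qed
  have pm0: "int p ^ m * U \<noteq> 0" using p0 UW0 by simp
  have nz: "(a * (t * x)\<^sup>2 + b * s\<^sup>2) * (c * (t * x)\<^sup>2 + d * s\<^sup>2) \<noteq> 0"
  proof
    assume "(a * (t * x)\<^sup>2 + b * s\<^sup>2) * (c * (t * x)\<^sup>2 + d * s\<^sup>2) = 0"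
    then have "(int p ^ m * U) * (Y * G) = 0" by (simp only: eq[symmetric] mult_zero_right)
    then show False using pm0 1 2 by simp
  qed
  have "locnorm p ((int p ^ m * U) * (Y * G))"
    using locnorm_mult[OF p pm0, of "Y * G"] locnorm_mult[OF p 1(2) 2(2)] 1 2 M(3)
      locnorm_mult[OF p pm0 E0] by auto
  then have "locnorm p ((a * (t * x)\<^sup>2 + b * s\<^sup>2) * (c * (t * x)\<^sup>2 + d * s\<^sup>2))"
    using locnorm_square[OF p UW0(1) nz] eq by simp
  then show ?thesis unfolding intsol_def by blast
qed

lemma intsol_commute: "intsol p a b c d \<longleftrightarrow> intsol p c d a b"
  unfolding intsol_def by (simp add: mult.commute)

section \<open>Stability of solubility under congruences\<close>

text \<open>Relative precision: the hypotheses give v(e) >= v(a) + 1 + r, so \<open>e * T\<close> is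
  at least r + 1 digits smaller than \<open>a * T\<close>, whatever \<open>T\<close> is. Thus a
  congruence between coefficients controls the forms even at non-primitive arguments.\<close>

lemma dvd_transfer:
  assumes p: "prime p" and a: "\<not> int p ^ j dvd a" and d: "int p ^ (j + r) dvd e" and T: "int p ^ i dvd a * T"
  shows "int p ^ (i + 1 + r) dvd e * T"
proof -
  have a0: "a \<noteq> 0" using a by auto
  obtain k u where ku: "a = int p ^ k * u" "\<not> int p dvd u" using prime_power_decompose[OF p a0] by metis
  have "k < j" using a ku prime_power_dvd_mult_iff[OF p ku(2)] by auto
  then have e: "int p ^ (k + (1 + r)) dvd e" by (intro power_le_dvd[OF d]) simp
  have "coprime (int p ^ i) u" using ku(2) p
    by (metis coprime_power_left_iff prime_imp_coprime prime_nat_int_transfer)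
  then have "int p ^ i dvd int p ^ k * T" using T ku
    by (metis coprime_dvd_mult_right_iff mult.assoc mult.commute)
  then have "int p ^ i * int p ^ (1 + r) dvd (int p ^ k * T) * int p ^ (1 + r)" by (intro mult_dvd_mono) auto
  then have "int p ^ (i + 1 + r) dvd int p ^ (k + (1 + r)) * T"
    by (simp add: power_add mult_ac)
  also have "\<dots> dvd e * T" using e by (intro mult_dvd_mono) auto
  finally show ?thesis .
qed

lemma not_dvd_cong:
  assumes "\<not> int p ^ j dvd a" "int p ^ (j + r) dvd a' - a"
  shows "\<not> int p ^ j dvd a'"
proof
  assume "int p ^ j dvd a'"
  moreover have "int p ^ j dvd a' - a" by (rule power_le_dvd[OF assms(2)]) simp
  ultimately have "int p ^ j dvd a' - (a' - a)" by (rule dvd_diff)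
  then show False using assms(1) by simp
qed

lemma iso_form_dvd:
  assumes "\<not> iso_form p a b" "int p ^ (j + iso_loss p) dvd a * t\<^sup>2 + b * s\<^sup>2"
  shows "int p ^ j dvd a * t\<^sup>2" "int p ^ j dvd b * s\<^sup>2"
proof -
  show 1: "int p ^ j dvd a * t\<^sup>2" using assms unfolding iso_form_def by blast
  show "int p ^ j dvd b * s\<^sup>2" using 1 assms(2)
    by (metis dvd_add_right_iff power_le_dvd le_add1)
qed

text \<open>Both terms of the witness have valuation m, so by \<open>dvd_transfer\<close> they
  change only by multiples of \<open>int p ^ (m + 1 + iso_loss p)\<close>, exactly the precision of
  the witness. The same \<open>t\<close> and \<open>s\<close> therefore serve for the new
  form.\<close>

lemma iso_form_cong:
  assumes p: "prime p" and iso: "iso_form p a b"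
    and a: "\<not> int p ^ j dvd a" "int p ^ (j + iso_loss p) dvd a' - a"
    and b: "\<not> int p ^ j dvd b" "int p ^ (j + iso_loss p) dvd b' - b"
  shows "iso_form p a' b'"
proof -
  obtain m t s U W where U: "a * t\<^sup>2 = int p ^ m * U" "\<not> int p dvd U" 
    and W: "b * s\<^sup>2 = int p ^ m * W" "\<not> int p dvd W" and UW: "int p ^ (1 + iso_loss p) dvd U + W"
    using iso_form_witness[OF p iso] by metis
  have 1: "int p ^ (m + 1 + iso_loss p) dvd (a' - a) * t\<^sup>2"
    using dvd_transfer[OF p a, of m "t\<^sup>2"] U(1) by simp
  have 2: "int p ^ (m + 1 + iso_loss p) dvd (b' - b) * s\<^sup>2"
    using dvd_transfer[OF p b, of m "s\<^sup>2"] W(1) by simp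
  have "int p ^ (m + 1 + iso_loss p) dvd a * t\<^sup>2 + b * s\<^sup>2"
    using UW U(1) W(1) by (simp add: power_add mult.assoc flip: distrib_left)
  then have "int p ^ (m + 1 + iso_loss p) dvd (a * t\<^sup>2 + b * s\<^sup>2) + ((a' - a) * t\<^sup>2 + (b' - b) * s\<^sup>2)"
    by (rule dvd_add[OF _ dvd_add[OF 1 2]])
  then have 3: "int p ^ ((m + 1) + iso_loss p) dvd a' * t\<^sup>2 + b' * s\<^sup>2" by (simp add: algebra_simps)
  have "\<not> int p ^ (m + 1) dvd a * t\<^sup>2" using U prime_power_dvd_mult_iff[OF p U(2), of "m + 1" m] by simp
  moreover have "int p ^ (m + 1 + 0) dvd a' * t\<^sup>2 - a * t\<^sup>2"
    using power_le_dvd[OF 1, of "m + 1"] by (simp add: left_diff_distrib)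
  ultimately have "\<not> int p ^ (m + 1) dvd a' * t\<^sup>2"
    by (rule not_dvd_cong)
  then show ?thesis unfolding iso_form_def using 3 by blast
qed

lemma form_locnorm_cong:
  assumes p: "prime p" and iso: "\<not> iso_form p a b"
    and a: "\<not> int p ^ j dvd a" "int p ^ (j + (iso_loss p + class_loss p)) dvd a' - a"
    and b: "\<not> int p ^ j dvd b" "int p ^ (j + (iso_loss p + class_loss p)) dvd b' - b"
    and f: "a * t\<^sup>2 + b * s\<^sup>2 \<noteq> 0"
  shows "locnorm p (a' * t\<^sup>2 + b' * s\<^sup>2) \<longleftrightarrow> locnorm p (a * t\<^sup>2 + b * s\<^sup>2)" "a' * t\<^sup>2 + b' * s\<^sup>2 \<noteq> 0"
proof -
  let ?f = "a * t\<^sup>2 + b * s\<^sup>2" and ?f' = "a' * t\<^sup>2 + b' * s\<^sup>2"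
  obtain m u where mu: "?f = int p ^ m * u" "\<not> int p dvd u" using prime_power_decompose[OF p f] by metis
  \<comment> \<open>Anisotropy bounds the valuation of both terms from below by that of the sum
    minus \<open>iso_loss p\<close>. The subtraction truncates at 0, where divisibility by
    \<open>int p ^ i\<close> is trivial.\<close>
  define i where "i = m - iso_loss p"
  have i: "int p ^ i dvd a * t\<^sup>2" "int p ^ i dvd b * s\<^sup>2"
  proof -
    have "int p ^ i dvd a * t\<^sup>2 \<and> int p ^ i dvd b * s\<^sup>2"
    proof (cases "m \<ge> iso_loss p")
      case True
      then have "int p ^ (i + iso_loss p) dvd ?f" using mu by (simp add: i_def)
      then show ?thesis using iso_form_dvd[OF iso] by blast
    qed (simp add: i_def)
    then show "int p ^ i dvd a * t\<^sup>2" "int p ^ i dvd b * s\<^sup>2" by auto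
  qed
  have "int p ^ (m + 1 + class_loss p) dvd int p ^ (i + 1 + (iso_loss p + class_loss p))"
    unfolding i_def by (intro le_imp_power_dvd) simp
  then have "int p ^ (m + 1 + class_loss p) dvd (a' - a) * t\<^sup>2 + (b' - b) * s\<^sup>2"
    using dvd_transfer[OF p a i(1)] dvd_transfer[OF p b i(2)] by (meson dvd_add dvd_trans)
  then have d: "int p ^ (m + 1 + class_loss p) dvd ?f' - ?f" by (simp add: algebra_simps)
  have "\<not> int p ^ (m + 1) dvd ?f" using mu prime_power_dvd_mult_iff[OF p mu(2), of "m + 1" m] by simp
  then show "locnorm p ?f' \<longleftrightarrow> locnorm p ?f" "?f' \<noteq> 0" using locnorm_cong[OF p _ d] by auto
qed

text \<open>There are two mechanisms. If one form is isotropic, isotropy survives and yields a new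
  point for the new coefficients. If both are anisotropic, the old \<open>t\<close> and
  \<open>s\<close> still work, since each factor keeps its norm class.\<close>

lemma intsol_cong:
  assumes p: "prime p" and sol: "intsol p a b c d" and nd: "a' * d' - b' * c' \<noteq> 0"
    and a: "\<not> int p ^ j dvd a" "int p ^ (j + (iso_loss p + class_loss p)) dvd a' - a"
    and b: "\<not> int p ^ j dvd b" "int p ^ (j + (iso_loss p + class_loss p)) dvd b' - b"
    and c: "\<not> int p ^ j dvd c" "int p ^ (j + (iso_loss p + class_loss p)) dvd c' - c"
    and d: "\<not> int p ^ j dvd d" "int p ^ (j + (iso_loss p + class_loss p)) dvd d' - d"
  shows "intsol p a' b' c' d'"
proof -
  have w: "int p ^ (j + iso_loss p) dvd y" if "int p ^ (j + (iso_loss p + class_loss p)) dvd y" for y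
    by (rule power_le_dvd[OF that]) simp
  consider "iso_form p a b" | "iso_form p c d" | "\<not> iso_form p a b" "\<not> iso_form p c d" by blast
  then show ?thesis
  proof cases
    case 1
    then have "iso_form p a' b'" using iso_form_cong[OF p] a b w by blast
    then show ?thesis using intsol_of_iso[OF p _ nd] by blast
  next
    case 2
    then have "iso_form p c' d'" using iso_form_cong[OF p] c d w by blast
    moreover have "c' * b' - d' * a' \<noteq> 0" using nd by (simp add: algebra_simps)
    ultimately show ?thesis using intsol_of_iso[OF p] intsol_commute by blast
  next
    case 3
    obtain t s where ts: "locnorm p ((a * t\<^sup>2 + b * s\<^sup>2) * (c * t\<^sup>2 + d * s\<^sup>2))"
      using sol unfolding intsol_def by blast
    then have nz: "a * t\<^sup>2 + b * s\<^sup>2 \<noteq> 0" "c * t\<^sup>2 + d * s\<^sup>2 \<noteq> 0" using locnorm_nonzero by force+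
    note f = form_locnorm_cong[OF p 3(1) a b nz(1)] and g = form_locnorm_cong[OF p 3(2) c d nz(2)]
    have "locnorm p ((a' * t\<^sup>2 + b' * s\<^sup>2) * (c' * t\<^sup>2 + d' * s\<^sup>2))"
      using locnorm_mult[OF p nz] locnorm_mult[OF p f(2) g(2)] f(1) g(1) ts by simp
    then show ?thesis unfolding intsol_def by blast
  qed
qed
subsection \<open>Solubility over the completions\<close>

lemma padic_abs_of_int_le:
  assumes p: "prime p" and "int p ^ n dvd m"
  shows "padic_abs p (of_int m) \<le> (1 / real p) ^ n"
proof (cases "m = 0")
  case False
  have "\<not> is_unit (int p)" using p by auto
  then have le: "n \<le> multiplicity (int p) m" using assms(2) False by (intro multiplicity_geI) auto
  have "padic_abs p (of_int m) = real p powi (- int (multiplicity (int p) m))"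
    using padic_abs_quotient[OF p False, of 1 "of_int m"] by simp
  also have "\<dots> \<le> real p powi (- int n)"
    using le prime_ge_1_nat[OF p] by (intro power_int_increasing) auto
  also have "\<dots> = (1 / real p) ^ n" by (simp add: power_int_minus power_one_over inverse_eq_divide)
  finally show ?thesis .
qed simp

lemma padic_abs_of_int_le_1: "prime p \<Longrightarrow> padic_abs p (of_int m) \<le> 1"
  using padic_abs_of_int_le[of p 0 m] by simp

lemma dvd_of_padic_abs_less:
  assumes p: "prime p" and lt: "padic_abs p (of_int m) < (1 / real p) ^ n"
  shows "int p ^ n dvd m"
proof (cases "m = 0")
  case False
  obtain k u where ku: "m = int p ^ k * u" "\<not> int p dvd u" using prime_power_decompose[OF p False] by metis
  have "multiplicity (int p) m = k"
    using ku(2) by (intro multiplicity_eqI) (simp_all add: ku(1) prime_power_dvd_mult_iff[OF p ku(2)] del: power_Suc)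
  then have "padic_abs p (of_int m) = real p powi (- int k)"
    using padic_abs_quotient[OF p False, of 1 "of_int m"] by simp
  then have "(1 / real p) ^ k < (1 / real p) ^ n" using lt by (simp add: power_int_minus power_one_over inverse_eq_divide)
  moreover have "1 / real p \<le> 1" using prime_ge_1_nat[OF p] by simp
  ultimately have "n \<le> k" by (metis not_le power_decreasing divide_nonneg_nonneg leD le_cases of_nat_0_le_iff zero_le_one)
  then show ?thesis using ku by (simp add: le_imp_power_dvd)
qed simp

lemma inverse_prime_powers_tendsto_0:
  assumes "prime p" shows "(\<lambda>n. (1 / real p) ^ n) \<longlonglongrightarrow> 0"
  using prime_gt_1_nat[OF assms] by (intro LIMSEQ_power_zero) simp

lemma padic_null_of_int:
  assumes p: "prime p" and "\<And>n. int p ^ n dvd m n"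
  shows "padic_null p (\<lambda>n. of_int (m n))"
  unfolding padic_null_def
  by (rule tendsto_sandwich[OF _ _ tendsto_const inverse_prime_powers_tendsto_0[OF p]])
     (auto simp: padic_abs_of_int_le[OF p assms(2)])

lemma padic_Cauchy_of_int:
  assumes p: "prime p" and x: "\<And>m n. m \<le> n \<Longrightarrow> int p ^ m dvd x n - x m"
  shows "padic_Cauchy p (\<lambda>n. of_int (x n))"
  unfolding padic_Cauchy_def
proof (intro allI impI)
  fix e :: real assume "e > 0"
  then obtain N where N: "\<And>n. n \<ge> N \<Longrightarrow> (1 / real p) ^ n < e"
    using order_tendstoD(2)[OF inverse_prime_powers_tendsto_0[OF p]] by (auto simp: eventually_sequentially)
  have "padic_abs p (of_int (x m) - of_int (x n)) < e" if "m \<ge> N" "n \<ge> N" for m n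
  proof -
    have "int p ^ min m n dvd x m - x n"
      using x[of m n] x[of n m] dvd_minus_iff[of "int p ^ m" "x n - x m"] by (cases "m \<le> n") (auto simp: min_def)
    then have "padic_abs p (of_int (x m - x n)) \<le> (1 / real p) ^ min m n" by (rule padic_abs_of_int_le[OF p])
    also have "\<dots> < e" using N that by (simp add: min_def)
    finally show ?thesis by simp
  qed
  then show "\<exists>N. \<forall>m\<ge>N. \<forall>n\<ge>N. padic_abs p (of_int (x m) - of_int (x n)) < e" by blast
qed

text \<open>The approximate roots are chosen independently, yet they cohere: being 1 modulo
  \<open>int p ^ (1 + class_loss p)\<close> fixes the sign of the root. So \<open>x n + x m\<close>
  has valuation at most \<open>class_loss p\<close>, and the extra \<open>class_loss p\<close>
  digits demanded of the squares leave m digits for the difference.\<close>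

lemma ex_padic_sqrt:
  assumes p: "prime p" and U: "\<not> int p dvd U" and UV: "int p ^ (1 + iso_loss p) dvd U - V"
  obtains x where "padic_Cauchy p (\<lambda>n. of_int (x n))" "padic_null p (\<lambda>n. of_int (U * (x n)\<^sup>2 - V))"
    "\<And>n. \<not> int p dvd x n"
proof -
  have "\<forall>n. \<exists>x. int p ^ (1 + class_loss p) dvd x - 1 \<and> int p ^ (n + class_loss p) dvd U * x\<^sup>2 - V"
    using ex_square_cong[OF p U UV] by blast
  then obtain x where x1: "\<And>n. int p ^ (1 + class_loss p) dvd x n - 1"
    and x2: "\<And>n. int p ^ (n + class_loss p) dvd U * (x n)\<^sup>2 - V" by metis
  have "int p ^ m dvd x n - x m" if "m \<le> n" for m n
  proof -
    have s: "\<not> int p ^ Suc (class_loss p) dvd x n + x m"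
    proof
      assume L: "int p ^ Suc (class_loss p) dvd x n + x m"
      have "int p ^ Suc (class_loss p) dvd (x n - 1) + (x m - 1)" using dvd_add[OF x1[of n] x1[of m]] by simp
      then have "int p ^ Suc (class_loss p) dvd (x n + x m) - ((x n - 1) + (x m - 1))" using L by (rule dvd_diff[rotated])
      then have "int p ^ Suc (class_loss p) dvd 2" by simp
      then have "int p ^ Suc (class_loss p) \<le> 2" by (rule zdvd_imp_le) simp
      moreover have "p \<ge> 2" using prime_ge_2_nat[OF p] .
      ultimately have "p = 2 \<and> class_loss p = 0" 
        by (cases "p = 2") (auto simp: class_loss_def)
      then show False by (auto simp: class_loss_def)
    qed
    have "int p ^ (m + class_loss p) dvd U * (x n)\<^sup>2 - V" by (rule power_le_dvd[OF x2[of n]]) (use that in simp)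
    then have "int p ^ (m + class_loss p) dvd (U * (x n)\<^sup>2 - V) - (U * (x m)\<^sup>2 - V)" by (rule dvd_diff[OF _ x2])
    also have "(U * (x n)\<^sup>2 - V) - (U * (x m)\<^sup>2 - V) = U * ((x n + x m) * (x n - x m))"
      by (simp add: algebra_simps power2_eq_square)
    finally have "int p ^ (0 + (m + class_loss p)) dvd U * ((x n + x m) * (x n - x m))" by simp
    then have "int p ^ (class_loss p + m) dvd (x n + x m) * (x n - x m)"
      using prime_power_dvd_split[OF p, of 0] U by (auto simp: add.commute)
    then show ?thesis using prime_power_dvd_split[OF p] s by blast
  qed
  then have 1: "padic_Cauchy p (\<lambda>n. of_int (x n))" by (rule padic_Cauchy_of_int[OF p])
  have 2: "padic_null p (\<lambda>n. of_int (U * (x n)\<^sup>2 - V))"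
    by (rule padic_null_of_int[OF p]) (rule power_le_dvd[OF x2], simp)
  have "\<not> int p dvd x n" for n using not_dvd_of_cong_1[OF p x1] .
  then show ?thesis using that 1 2 by blast
qed

text \<open>From here on only sequences of rationals matter. A quotient set is empty exactly when
  the set is, so the scalings drop out, and the projection \<open>q\<close> is a ring homomorphism
  that kills precisely the null sequences.\<close>

lemma soluble_padic_iff:
  assumes p: "prime p"
  shows "soluble_padic p a b c d \<longleftrightarrow>
    (\<exists>t s y z w. padic_Cauchy p t \<and> padic_Cauchy p s \<and> padic_Cauchy p y \<and> padic_Cauchy p z \<and> padic_Cauchy p w \<and>
      \<not> (padic_null p t \<and> padic_null p s) \<and> \<not> (padic_null p y \<and> padic_null p z \<and> padic_null p w) \<and>
      padic_null p (\<lambda>n. (y n * y n + z n * z n) -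
        (of_int a * (t n * t n) + of_int b * (s n * s n)) * (of_int c * (t n * t n) + of_int d * (s n * s n)) * (w n * w n)))"
    (is "_ \<longleftrightarrow> (\<exists>t s y z w. ?P t s y z w)")
proof -
  define R where "R = padic_Cauchy_ring p"
  define I where "I = {x. padic_null p x}"
  define K where "K = padic_field p"
  define q where "q = (\<lambda>x. I +>\<^bsub>R\<^esub> x)"
  interpret R: cring R unfolding R_def by (rule padic_Cauchy_cring[OF p])
  interpret I: ideal I R unfolding R_def I_def by (rule padic_null_ideal[OF p])
  have K: "K = R Quot I" by (simp add: K_def R_def I_def padic_field_def)
  interpret H: ring_hom_ring R K q unfolding K q_def by (rule I.rcos_ring_hom_ring)
  have car: "carrier R = {x. padic_Cauchy p x}" by (simp add: R_def padic_Cauchy_ring_def)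
  have carK: "carrier K = q ` {x. padic_Cauchy p x}"
    unfolding K q_def car[symmetric] by (auto simp: FactRing_def A_RCOSETS_def')
  have mult: "q x \<otimes>\<^bsub>K\<^esub> q y = q (\<lambda>n. x n * y n)" if "padic_Cauchy p x" "padic_Cauchy p y" for x y
    using H.hom_mult[of x y] that by (simp add: R_def padic_Cauchy_ring_def)
  have add: "q x \<oplus>\<^bsub>K\<^esub> q y = q (\<lambda>n. x n + y n)" if "padic_Cauchy p x" "padic_Cauchy p y" for x y
    using H.hom_add[of x y] that by (simp add: R_def padic_Cauchy_ring_def)
  have minus: "\<ominus>\<^bsub>R\<^esub> x = (\<lambda>n. - x n)" if "padic_Cauchy p x" for x
    using that padic_Cauchy_minus[OF p that]
    by (intro R.minus_equality) (auto simp: R_def padic_Cauchy_ring_def)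
  have null: "q x = \<zero>\<^bsub>K\<^esub> \<longleftrightarrow> padic_null p x" if "padic_Cauchy p x" for x
  proof -
    have "\<zero>\<^bsub>K\<^esub> = I" by (simp add: K FactRing_def)
    moreover have "I +>\<^bsub>R\<^esub> x = I \<longleftrightarrow> x \<in> I"
      using I.rcos_const_imp_mem[of x] R.a_rcos_zero[OF I.ideal_axioms, of x] that by (auto simp: car)
    ultimately show ?thesis by (simp add: q_def I_def)
  qed
  have eq: "q x = q y \<longleftrightarrow> padic_null p (\<lambda>n. x n - y n)" if "padic_Cauchy p x" "padic_Cauchy p y" for x y
  proof -
    have "x \<ominus>\<^bsub>R\<^esub> y = (\<lambda>n. x n - y n)"
      unfolding a_minus_def minus[OF that(2)] by (simp add: R_def padic_Cauchy_ring_def)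
    then show ?thesis using R.quotient_eq_iff_same_a_r_cos[OF I.ideal_axioms, of x y] that
      by (simp add: car q_def I_def)
  qed
  have nat_mult: "[(n::nat)] \<cdot>\<^bsub>R\<^esub> x = (\<lambda>i. of_nat n * x i)" if "padic_Cauchy p x" for n x
  proof (induction n)
    case 0 then show ?case by (simp add: R.add.nat_pow_0) (simp add: R_def padic_Cauchy_ring_def)
  next
    case (Suc n)
    then show ?case by (simp add: R.add.nat_pow_Suc) (simp add: R_def padic_Cauchy_ring_def algebra_simps)
  qed
  have cmul: "padic_Cauchy p (\<lambda>i. of_int k * x i)" if "padic_Cauchy p x" for k x
    by (rule padic_Cauchy_mult[OF p padic_Cauchy_const that])
  have int_mult: "[(k::int)] \<cdot>\<^bsub>R\<^esub> x = (\<lambda>i. of_int k * x i)" if x: "padic_Cauchy p x" for k x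
  proof (cases "k \<ge> 0")
    case True
    then show ?thesis using nat_mult[OF x, of "nat k"] by (simp add: add_pow_int_ge)
  next
    case False
    have "[k] \<cdot>\<^bsub>R\<^esub> x = \<ominus>\<^bsub>R\<^esub> (\<lambda>i. of_int (- k) * x i)"
      using nat_mult[OF x, of "nat (- k)"] False by (simp add: add_pow_int_lt)
    also have "\<dots> = (\<lambda>i. of_int k * x i)" using minus[OF cmul[OF x, of "- k"]] by simp
    finally show ?thesis .
  qed
  have imul: "[(k::int)] \<cdot>\<^bsub>K\<^esub> q x = q (\<lambda>i. of_int k * x i)" if x: "padic_Cauchy p x" for k x
    using group_hom.hom_int_pow[OF H.a_group_hom, of x k] x int_mult[OF x, of k] unfolding add_pow_def car by (simp add: car)
  have eqK: "(q y \<otimes>\<^bsub>K\<^esub> q y) \<oplus>\<^bsub>K\<^esub> (q z \<otimes>\<^bsub>K\<^esub> q z) =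
          (([a] \<cdot>\<^bsub>K\<^esub> (q t \<otimes>\<^bsub>K\<^esub> q t)) \<oplus>\<^bsub>K\<^esub> ([b] \<cdot>\<^bsub>K\<^esub> (q s \<otimes>\<^bsub>K\<^esub> q s))) \<otimes>\<^bsub>K\<^esub>
          (([c] \<cdot>\<^bsub>K\<^esub> (q t \<otimes>\<^bsub>K\<^esub> q t)) \<oplus>\<^bsub>K\<^esub> ([d] \<cdot>\<^bsub>K\<^esub> (q s \<otimes>\<^bsub>K\<^esub> q s))) \<otimes>\<^bsub>K\<^esub> (q w \<otimes>\<^bsub>K\<^esub> q w)
      \<longleftrightarrow> padic_null p (\<lambda>n. (y n * y n + z n * z n) -
        (of_int a * (t n * t n) + of_int b * (s n * s n)) * (of_int c * (t n * t n) + of_int d * (s n * s n)) * (w n * w n))"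
    if C: "padic_Cauchy p t" "padic_Cauchy p s" "padic_Cauchy p y" "padic_Cauchy p z" "padic_Cauchy p w" for t s y z w
    using C by (simp add: mult add imul eq cmul padic_Cauchy_mult[OF p] padic_Cauchy_add[OF p])
  show ?thesis
  proof
    assume "soluble_padic p a b c d"
    then have "chatelet_coords K a b c d \<noteq> {}"
      unfolding soluble_padic_def chatelet_points_def K_def by simp
    then obtain t' s' y' z' w' where *: "(t', s', y', z', w') \<in> chatelet_coords K a b c d" by auto
    then have "t' \<in> carrier K" "s' \<in> carrier K" "y' \<in> carrier K" "z' \<in> carrier K" "w' \<in> carrier K"
      unfolding chatelet_coords_def by auto
    then obtain t s y z w where C: "padic_Cauchy p t" "padic_Cauchy p s" "padic_Cauchy p y" "padic_Cauchy p z" "padic_Cauchy p w"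
      and q: "t' = q t" "s' = q s" "y' = q y" "z' = q z" "w' = q w" unfolding carK by blast
    have "?P t s y z w" using * eqK[OF C] C unfolding chatelet_coords_def q by (simp add: null)
    then show "\<exists>t s y z w. ?P t s y z w" by blast
  next
    assume "\<exists>t s y z w. ?P t s y z w"
    then obtain t s y z w where P: "?P t s y z w" by blast
    then have C: "padic_Cauchy p t" "padic_Cauchy p s" "padic_Cauchy p y" "padic_Cauchy p z" "padic_Cauchy p w" by auto
    have "(q t, q s, q y, q z, q w) \<in> chatelet_coords K a b c d"
      using P eqK[OF C] C unfolding chatelet_coords_def by (simp add: null carK)
    then show "soluble_padic p a b c d"
      unfolding soluble_padic_def chatelet_points_def K_def by auto
  qed
qed

text \<open>All points constructed below have integer coordinates except for one p-adic square root,
  here \<open>y\<close>.\<close>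

lemma soluble_padicI:
  fixes y :: "nat \<Rightarrow> int" and z :: int
  assumes p: "prime p" and "t \<noteq> 0 \<or> s \<noteq> 0" and "padic_Cauchy p (\<lambda>n. of_int (y n))"
    and "w \<noteq> 0 \<or> z \<noteq> 0"
    and "padic_null p (\<lambda>n. of_int ((y n)\<^sup>2 + z\<^sup>2 - (a * t\<^sup>2 + b * s\<^sup>2) * (c * t\<^sup>2 + d * s\<^sup>2) * w\<^sup>2))"
  shows "soluble_padic p a b c d"
proof -
  have null: "padic_null p (\<lambda>n. of_int k) \<longleftrightarrow> k = 0" for k
  proof
    assume "padic_null p (\<lambda>n. of_int k)"
    then have "padic_abs p (of_int k) = 0" by (simp add: padic_null_def LIMSEQ_const_iff)
    then show "k = 0" using padic_abs_pos[OF p, of "of_int k"] by (metis less_irrefl of_int_eq_0_iff)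
  qed (simp add: padic_null_def)
  show ?thesis unfolding soluble_padic_iff[OF p]
    by (rule exI[of _ "\<lambda>n. of_int t"], rule exI[of _ "\<lambda>n. of_int s"], rule exI[of _ "\<lambda>n. of_int (y n)"],
        rule exI[of _ "\<lambda>n. of_int z"], rule exI[of _ "\<lambda>n. of_int w"])
       (use assms in \<open>auto simp: null padic_Cauchy_const power2_eq_square mult.assoc\<close>)
qed

section \<open>From norm classes to p-adic points\<close>

lemma Legendre_neg1:
  assumes p: "prime p" "p > 2"
  shows "QuadRes (int p) (-1) \<longleftrightarrow> [p = 1] (mod 4)"
proof -
  have pi: "prime (int p)" using p by simp
  have "\<not> [-1 = 0] (mod int p)" using pi p by (simp add: cong_0_iff)
  then have L: "Legendre (-1) (int p) = (if QuadRes (int p) (-1) then 1 else -1)" by (simp add: Legendre_def)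
  have e: "[Legendre (-1) (int p) = (-1) ^ ((p - 1) div 2)] (mod int p)"
    using euler_criterion[OF p, of "-1"] by simp
  have ne: "\<not> [1 = -1] (mod int p)" "\<not> [-1 = 1] (mod int p)"
  proof -
    have "\<not> int p dvd 2" using p(2) zdvd_imp_le[of "int p" 2] by auto
    then show "\<not> [1 = -1] (mod int p)" "\<not> [-1 = 1] (mod int p)" by (auto simp: cong_iff_dvd_diff)
  qed
  have "odd p" using p prime_odd_nat by auto
  then have "p mod 4 = 1 \<and> even ((p - 1) div 2) \<or> p mod 4 = 3 \<and> odd ((p - 1) div 2)" by presburger
  then show ?thesis using e L ne by (auto simp: cong_def split: if_splits)
qed

lemma soluble_padic_1_mod_4:
  assumes p: "prime p" and p1: "[p = 1] (mod 4)"
  shows "soluble_padic p a b c d"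
proof -
  have p2: "p > 2" using p p1 prime_ge_2_nat[OF p] by (cases "p = 2") (auto simp: cong_def)
  have pi: "prime (int p)" using p by simp
  obtain i where i: "[i\<^sup>2 = -1] (mod int p)" using Legendre_neg1[OF p p2] p1 unfolding QuadRes_def by blast
  have ni: "\<not> int p dvd i\<^sup>2"
  proof
    assume "int p dvd i\<^sup>2"
    moreover have "int p dvd i\<^sup>2 - (-1)" using i by (simp add: cong_iff_dvd_diff)
    ultimately have "int p dvd i\<^sup>2 - (i\<^sup>2 - (-1))" by (rule dvd_diff)
    then show False using pi by simp
  qed
  have "int p ^ (1 + iso_loss p) dvd i\<^sup>2 - (-1)" using i p2 by (simp add: iso_loss_def cong_iff_dvd_diff)
  then obtain x where x: "padic_Cauchy p (\<lambda>n. of_int (x n))" "padic_null p (\<lambda>n. of_int (i\<^sup>2 * (x n)\<^sup>2 - (-1)))"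
    using ex_padic_sqrt[OF p ni] by metis
  have "padic_Cauchy p (\<lambda>n. of_int (i * x n))"
    using padic_Cauchy_mult[OF p padic_Cauchy_const x(1), of "of_int i"] by simp
  moreover have "padic_null p (\<lambda>n. of_int ((i * x n)\<^sup>2 + 1\<^sup>2 - (a * 1\<^sup>2 + b * 0\<^sup>2) * (c * 1\<^sup>2 + d * 0\<^sup>2) * 0\<^sup>2))"
    using x(2) by (simp add: power_mult_distrib)
  ultimately show ?thesis by (intro soluble_padicI[OF p, of 1 0 "\<lambda>n. i * x n" 0 1]) auto
qed

text \<open>A residue is its own witness with z = 0. For a non-residue u let k be the least
  non-residue: k - 1 is a square, so k = x^2 + 1. As -1 is a non-residue, both -u and -k are
  squares, hence u is k times a square. The unit \<open>r\<close> is the summand whose root can be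
  lifted.\<close>

lemma ex_sum_two_squares_mod:
  assumes p: "prime p" "[p = 3] (mod 4)" and u: "\<not> int p dvd u"
  obtains z r where "\<not> int p dvd r" "int p dvd u - z\<^sup>2 - r\<^sup>2"
proof -
  have pi: "prime (int p)" using p by simp
  have p2: "p > 2" using p prime_ge_2_nat[OF p(1)] by (cases "p = 2") (auto simp: cong_def)
  have nq: "\<not> QuadRes (int p) (-1)" using Legendre_neg1[OF p(1) p2] p(2) by (auto simp: cong_def)
  have neg: "QuadRes (int p) (- v)" if v: "\<not> int p dvd v" "\<not> QuadRes (int p) v" for v
  proof -
    have v0: "\<not> [v = 0] (mod int p)" "\<not> [- v = 0] (mod int p)" "\<not> [-1 = 0] (mod int p)"
      using v(1) pi by (auto simp: cong_0_iff)
    have "[v ^ ((p - 1) div 2) = -1] (mod int p)"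
      using euler_criterion[OF p(1) p2, of v] v v0 by (simp add: Legendre_def cong_sym)
    moreover have "[(-1) ^ ((p - 1) div 2) = -1] (mod int p)"
      using euler_criterion[OF p(1) p2, of "-1"] nq v0 by (simp add: Legendre_def cong_sym)
    ultimately have "[(-1) ^ ((p - 1) div 2) * v ^ ((p - 1) div 2) = -1 * -1] (mod int p)" by (rule cong_mult[rotated])
    then have "[(- v) ^ ((p - 1) div 2) = 1] (mod int p)" by (simp flip: power_mult_distrib)
    then have L: "[Legendre (- v) (int p) = 1] (mod int p)"
      using euler_criterion[OF p(1) p2, of "- v"] cong_trans by blast
    have "\<not> int p dvd 2" using p2 zdvd_imp_le[of "int p" 2] by auto
    then have "\<not> [-1 = 1] (mod int p)" by (auto simp: cong_iff_dvd_diff)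
    then show ?thesis using L v0 by (auto simp: Legendre_def split: if_splits)
  qed
  show ?thesis
  proof (cases "QuadRes (int p) u")
    case True
    then obtain r where r: "[r\<^sup>2 = u] (mod int p)" unfolding QuadRes_def by blast
    then have d: "int p dvd u - r\<^sup>2" by (metis cong_iff_dvd_diff cong_sym)
    have "\<not> int p dvd r"
    proof
      assume "int p dvd r"
      then have "int p dvd r\<^sup>2" by (simp add: power2_eq_square)
      with d have "int p dvd (u - r\<^sup>2) + r\<^sup>2" by (rule dvd_add)
      then show False using u by simp
    qed
    then show ?thesis using that[of r 0] d by simp
  next
    case False
    define Q where "Q = (\<lambda>k::nat. \<not> QuadRes (int p) (int k))"
    define k where "k = (LEAST k. Q k)"
    have "Q (p - 1)" unfolding Q_def QuadRes_def
    proof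
      assume "\<exists>y. [y\<^sup>2 = int (p - 1)] (mod int p)"
      moreover have "[int (p - 1) = -1] (mod int p)" using p2 by (simp add: cong_iff_dvd_diff of_nat_diff)
      ultimately show False using nq unfolding QuadRes_def using cong_trans by blast
    qed
    then have k: "Q k" "k \<le> p - 1" unfolding k_def by (auto intro: LeastI Least_le)
    have "k \<noteq> 0" using k(1) unfolding Q_def QuadRes_def by (metis cong_refl of_nat_0 zero_power2)
    then have "\<not> Q (k - 1)" unfolding k_def using not_less_Least by (metis diff_less less_one neq0_conv)
    then obtain x where x: "[x\<^sup>2 = int (k - 1)] (mod int p)" unfolding Q_def QuadRes_def by blast
    then have "[x\<^sup>2 + 1 = int (k - 1) + 1] (mod int p)" by (rule cong_add) simp
    then have xk: "[x\<^sup>2 + 1 = int k] (mod int p)" using \<open>k \<noteq> 0\<close> by (simp add: of_nat_diff)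
    have kp: "\<not> int p dvd int k" using k(2) \<open>k \<noteq> 0\<close> p2 by (auto dest!: dvd_imp_le simp: int_dvd_int_iff)
    obtain g where g: "[g\<^sup>2 = - int k] (mod int p)" using neg[OF kp] k(1) unfolding Q_def QuadRes_def by blast
    obtain h where h: "[h\<^sup>2 = - u] (mod int p)" using neg[OF u False] unfolding QuadRes_def by blast
    have "\<not> int p dvd g"
    proof
      assume "int p dvd g"
      then have "[g\<^sup>2 = 0] (mod int p)" by (simp add: cong_0_iff power2_eq_square)
      then have "[- int k = 0] (mod int p)" using g cong_trans cong_sym by blast
      then show False using kp by (simp add: cong_0_iff)
    qed
    then obtain i where i: "[g * i = 1] (mod int p)"
      using pi by (metis cong_solve_coprime_int coprime_commute prime_imp_coprime)
    define w where "w = h * i"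
    have "[u = - (h\<^sup>2) * 1\<^sup>2] (mod int p)" using cong_minus_minus_iff[of "h\<^sup>2" "- u" "int p"] h by (simp add: cong_sym)
    also have "[- (h\<^sup>2) * 1\<^sup>2 = - (h\<^sup>2) * (g * i)\<^sup>2] (mod int p)" by (intro cong_mult cong_refl cong_pow cong_sym[OF i])
    also have "- (h\<^sup>2) * (g * i)\<^sup>2 = - (g\<^sup>2) * w\<^sup>2" by (simp add: w_def power_mult_distrib)
    also have "[- (g\<^sup>2) * w\<^sup>2 = - (- int k) * w\<^sup>2] (mod int p)" 
      by (intro cong_mult cong_refl) (use g cong_minus_minus_iff[of "g\<^sup>2" "- int k" "int p"] in simp)
    also have "[- (- int k) * w\<^sup>2 = (x\<^sup>2 + 1) * w\<^sup>2] (mod int p)" using xk by (intro cong_mult cong_refl) (simp add: cong_sym)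
    finally have "[u = (x\<^sup>2 + 1) * w\<^sup>2] (mod int p)" .
    then have d: "int p dvd u - (x * w)\<^sup>2 - w\<^sup>2" by (simp add: cong_iff_dvd_diff algebra_simps power_mult_distrib)
    have "\<not> int p dvd w"
    proof
      assume "int p dvd w"
      then have "int p dvd (x * w)\<^sup>2 + w\<^sup>2" by (simp add: power2_eq_square)
      with d have "int p dvd (u - (x * w)\<^sup>2 - w\<^sup>2) + ((x * w)\<^sup>2 + w\<^sup>2)" by (rule dvd_add)
      then show False using u by simp
    qed
    then show ?thesis using that d by blast
  qed
qed

text \<open>A norm \<open>N\<close> is split as an even power of p times V + z^2, where z is an
  integer and V is congruent to a unit square. The root of V comes from
  \<open>ex_padic_sqrt\<close>, and the point has w = 1.\<close>

lemma soluble_padic_of_intsol: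
  assumes p: "prime p" "p = 2 \<or> [p = 3] (mod 4)" and sol: "intsol p a b c d"
  shows "soluble_padic p a b c d"
proof -
  obtain t s where ts: "locnorm p ((a * t\<^sup>2 + b * s\<^sup>2) * (c * t\<^sup>2 + d * s\<^sup>2))" using sol unfolding intsol_def by blast
  define N where "N = (a * t\<^sup>2 + b * s\<^sup>2) * (c * t\<^sup>2 + d * s\<^sup>2)"
  have N: "locnorm p N" using ts unfolding N_def .
  note N = N locnorm_nonzero[OF N]
  have ts0: "t \<noteq> 0 \<or> s \<noteq> 0" using N(2) unfolding N_def by auto
  obtain k u where ku: "N = int p ^ k * u" "\<not> int p dvd u" using prime_power_decompose[OF p(1) N(2)] by metis
  have cl: "if p = 2 then u mod 4 = 1 else even k" using locnorm_iff[OF p(1) ku(2)] N(1) ku(1) by blast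
  have "\<exists>z i V r. N = (int p ^ i)\<^sup>2 * (V + z\<^sup>2) \<and> \<not> int p dvd r \<and> int p ^ (1 + iso_loss p) dvd r\<^sup>2 - V"
  proof (cases "p = 2")
    case True
    \<comment> \<open>Modulo 8 the splittings are 1 = 1 + 0, 5 = 1 + 4 and, for odd
      \<open>k\<close>, 2u = 1 + 1. In each case V is 1 modulo 8 and hence a 2-adic square.\<close>
    have u: "u mod 8 = 1 \<or> u mod 8 = 5" using cl True by simp presburger
    show ?thesis
    proof (cases "even k")
      case ev: True
      then obtain i where i: "k = 2 * i" by auto
      have k: "N = (int p ^ i)\<^sup>2 * u" using ku(1) i by (simp add: power_mult mult.commute flip: power_mult)
      show ?thesis
      proof (cases "u mod 8 = 1")
        case True
        then have "8 dvd 1 - u" by presburger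
        then show ?thesis using k \<open>p = 2\<close> by (intro exI[of _ 0] exI[of _ i] exI[of _ u] exI[of _ 1]) (simp add: iso_loss_def)
      next
        case False
        then have "u mod 8 = 5" using u by simp
        then have "8 dvd 1 - (u - 4)" by presburger
        then show ?thesis using k \<open>p = 2\<close> by (intro exI[of _ 2] exI[of _ i] exI[of _ "u - 4"] exI[of _ 1]) (simp add: iso_loss_def)
      qed
    next
      case False
      then obtain i where i: "k = 2 * i + 1" by (auto elim: oddE)
      have k: "N = (int p ^ i)\<^sup>2 * (2 * u)" using ku(1) i True by (simp add: power_mult mult.commute flip: power_mult)
      have "8 dvd 1 - (2 * u - 1)" using u by presburger
      then show ?thesis using k \<open>p = 2\<close> by (intro exI[of _ 1] exI[of _ i] exI[of _ "2 * u - 1"] exI[of _ 1]) (simp add: iso_loss_def)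
    qed
  next
    case False
    then have p3: "[p = 3] (mod 4)" using p by simp
    obtain i where i: "k = 2 * i" using cl False by auto
    have k: "N = (int p ^ i)\<^sup>2 * u" using ku(1) i by (simp add: power_mult mult.commute flip: power_mult)
    obtain z r where zr: "\<not> int p dvd r" "int p dvd u - z\<^sup>2 - r\<^sup>2" using ex_sum_two_squares_mod[OF p(1) p3 ku(2)] by blast
    have "int p dvd r\<^sup>2 - (u - z\<^sup>2)" using zr(2) by (simp add: dvd_diff_commute)
    then show ?thesis using k zr(1) False
      by (intro exI[of _ z] exI[of _ i] exI[of _ "u - z\<^sup>2"] exI[of _ r]) (simp add: iso_loss_def)
  qed
  then obtain z i V r where V: "N = (int p ^ i)\<^sup>2 * (V + z\<^sup>2)" "\<not> int p dvd r" "int p ^ (1 + iso_loss p) dvd r\<^sup>2 - V" by blast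
  have r2: "\<not> int p dvd r\<^sup>2" using V(2) p(1) by (metis prime_dvd_power prime_nat_int_transfer)
  obtain x where x: "padic_Cauchy p (\<lambda>n. of_int (x n))" "padic_null p (\<lambda>n. of_int (r\<^sup>2 * (x n)\<^sup>2 - V))"
    using ex_padic_sqrt[OF p(1) r2 V(3)] by metis
  define y where "y n = int p ^ i * r * x n" for n
  have y: "padic_Cauchy p (\<lambda>n. of_int (y n))"
    using padic_Cauchy_mult[OF p(1) padic_Cauchy_const x(1), of "of_int (int p ^ i * r)"] by (simp add: y_def)
  have eq: "(y n)\<^sup>2 + (int p ^ i * z)\<^sup>2 - N * 1\<^sup>2 = (int p ^ i)\<^sup>2 * (r\<^sup>2 * (x n)\<^sup>2 - V)" for n
    unfolding V(1) y_def by (simp add: power_mult_distrib algebra_simps)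
  have "padic_null p (\<lambda>n. of_int ((int p ^ i)\<^sup>2 * (r\<^sup>2 * (x n)\<^sup>2 - V)))"
  proof -
    have "(\<lambda>n. padic_abs p (of_int ((int p ^ i)\<^sup>2)) * padic_abs p (of_int (r\<^sup>2 * (x n)\<^sup>2 - V))) \<longlonglongrightarrow> 0"
      using x(2) unfolding padic_null_def by (rule tendsto_mult_right_zero)
    then show ?thesis unfolding padic_null_def of_int_mult padic_abs_mult[OF p(1)] .
  qed
  then have "padic_null p (\<lambda>n. of_int ((y n)\<^sup>2 + (int p ^ i * z)\<^sup>2 - N * 1\<^sup>2))" unfolding eq .
  then show ?thesis using soluble_padicI[OF p(1) ts0 y, of 1 "int p ^ i * z"] unfolding N_def by simp
qed

section \<open>From p-adic points back to norm classes\<close>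

lemma ex_primitive_multiple:
  fixes x1 x2 x3 :: rat
  assumes p: "prime p" and nz: "\<not> (x1 = 0 \<and> x2 = 0 \<and> x3 = 0)"
  obtains r m1 m2 m3 where "r \<noteq> 0" "of_int m1 = r * x1" "of_int m2 = r * x2" "of_int m3 = r * x3"
    "\<not> (int p dvd m1 \<and> int p dvd m2 \<and> int p dvd m3)"
proof -
  have frac: "\<exists>n d. d \<noteq> 0 \<and> x * of_int d = of_int n" for x :: rat
  proof -
    obtain n d where "quotient_of x = (n, d)" by (cases "quotient_of x") auto
    then show ?thesis using quotient_of_div[of x n d] quotient_of_denom_pos[of x n d]
      by (intro exI[of _ n] exI[of _ d]) auto
  qed
  obtain n1 d1 n2 d2 n3 d3 where n: "d1 \<noteq> 0" "d2 \<noteq> 0" "d3 \<noteq> 0"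
    "x1 * of_int d1 = of_int n1" "x2 * of_int d2 = of_int n2" "x3 * of_int d3 = of_int n3" using frac by metis
  define k1 k2 k3 where "k1 = n1 * d2 * d3" and "k2 = n2 * d1 * d3" and "k3 = n3 * d1 * d2"
  define D where "D = d1 * d2 * d3"
  have D: "D \<noteq> 0" using n by (simp add: D_def)
  have k: "of_int k1 = x1 * of_int D" "of_int k2 = x2 * of_int D" "of_int k3 = x3 * of_int D"
    by (simp_all add: k1_def k2_def k3_def D_def n(4-6)[symmetric])
  define g where "g = gcd k1 (gcd k2 k3)"
  have "k1 \<noteq> 0 \<or> k2 \<noteq> 0 \<or> k3 \<noteq> 0" using k nz D by (metis mult_eq_0_iff of_int_eq_0_iff)
  then have g: "g \<noteq> 0" by (auto simp: g_def)
  have gd: "g dvd k1" "g dvd k2" "g dvd k3" unfolding g_def by (auto intro: dvd_trans)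
  define r where "r = of_int D / (of_int g :: rat)"
  have "\<not> (int p dvd k1 div g \<and> int p dvd k2 div g \<and> int p dvd k3 div g)"
  proof
    assume L: "int p dvd k1 div g \<and> int p dvd k2 div g \<and> int p dvd k3 div g"
    have "int p * g dvd k1" "int p * g dvd k2" "int p * g dvd k3" using L gd g by (auto simp: dvd_div_iff_mult)
    then have "int p * g dvd 1 * g" by (simp add: g_def)
    then have "int p dvd 1" using dvd_times_right_cancel_iff[OF g, of "int p" 1] by blast
    then show False using p by simp
  qed
  moreover have "of_int (k1 div g) = r * x1" "of_int (k2 div g) = r * x2" "of_int (k3 div g) = r * x3"
    using gd k g by (simp_all add: r_def of_int_div)
  moreover have "r \<noteq> 0" using D g by (simp add: r_def)
  ultimately show ?thesis using that by blast
qed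

lemma padic_Cauchy_not_null_bound:
  assumes p: "prime p" and x: "padic_Cauchy p x" and nn: "\<not> padic_null p x"
  obtains h where "h > 0" "eventually (\<lambda>n. padic_abs p (x n) > h) sequentially"
proof -
  obtain L where L: "(\<lambda>n. padic_abs p (x n)) \<longlonglongrightarrow> L"
    using padic_Cauchy_Cauchy[OF p x] Cauchy_convergent_iff convergent_def by blast
  have "L \<ge> 0" using LIMSEQ_le_const[OF L, of 0] by simp
  moreover have "L \<noteq> 0" using nn L unfolding padic_null_def by auto
  ultimately have "L / 2 > 0" "L / 2 < L" by auto
  then show ?thesis using that order_tendstoD(1)[OF L] by blast
qed

text \<open>One late term of the Cauchy sequences is enough. Neither coordinate vector tends to 0,
  so the factors that make them primitive integer vectors are bounded p-adically, and the equation,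
  which holds up to a small error, still does so after scaling.\<close>

lemma soluble_padic_imp_primitive_cong:
  assumes p: "prime p" and sol: "soluble_padic p a b c d"
  shows "\<exists>t s y z w. \<not> (int p dvd t \<and> int p dvd s) \<and> \<not> (int p dvd y \<and> int p dvd z \<and> int p dvd w) \<and>
    int p ^ N dvd y\<^sup>2 + z\<^sup>2 - (a * t\<^sup>2 + b * s\<^sup>2) * (c * t\<^sup>2 + d * s\<^sup>2) * w\<^sup>2"
proof -
  let ?E = "\<lambda>t s y z w. (y * y + z * z) -
        (of_int a * (t * t) + of_int b * (s * s)) * (of_int c * (t * t) + of_int d * (s * s)) * (w * w) :: rat"
  let ?v = "padic_abs p"
  obtain t s y z w where C: "padic_Cauchy p t" "padic_Cauchy p s" "padic_Cauchy p y" "padic_Cauchy p z" "padic_Cauchy p w"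
    and ts: "\<not> (padic_null p t \<and> padic_null p s)" and yzw: "\<not> (padic_null p y \<and> padic_null p z \<and> padic_null p w)"
    and null: "padic_null p (\<lambda>n. ?E (t n) (s n) (y n) (z n) (w n))"
    using sol unfolding soluble_padic_iff[OF p] by blast
  obtain h where h: "h > 0" "eventually (\<lambda>n. ?v (t n) > h \<or> ?v (s n) > h) sequentially"
  proof (cases "padic_null p t")
    case True
    then obtain h where h: "h > 0" "eventually (\<lambda>n. ?v (s n) > h) sequentially"
      using padic_Cauchy_not_null_bound[OF p C(2)] ts by metis
    show ?thesis by (rule that[OF h(1)]) (use h(2) in \<open>auto elim: eventually_mono\<close>)
  next
    case False
    then obtain h where h: "h > 0" "eventually (\<lambda>n. ?v (t n) > h) sequentially"
      using padic_Cauchy_not_null_bound[OF p C(1)] by metis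
    show ?thesis by (rule that[OF h(1)]) (use h(2) in \<open>auto elim: eventually_mono\<close>)
  qed
  obtain g where g: "g > 0" "eventually (\<lambda>n. ?v (y n) > g \<or> ?v (z n) > g \<or> ?v (w n) > g) sequentially"
  proof -
    consider "\<not> padic_null p y" | "\<not> padic_null p z" | "\<not> padic_null p w" using yzw by blast
    then show ?thesis
    proof cases
      case 1
      obtain g where g: "g > 0" "eventually (\<lambda>n. ?v (y n) > g) sequentially"
        using padic_Cauchy_not_null_bound[OF p C(3) 1] by metis
      show ?thesis by (rule that[OF g(1)]) (use g(2) in \<open>auto elim: eventually_mono\<close>)
    next
      case 2
      obtain g where g: "g > 0" "eventually (\<lambda>n. ?v (z n) > g) sequentially"
        using padic_Cauchy_not_null_bound[OF p C(4) 2] by metis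
      show ?thesis by (rule that[OF g(1)]) (use g(2) in \<open>auto elim: eventually_mono\<close>)
    next
      case 3
      obtain g where g: "g > 0" "eventually (\<lambda>n. ?v (w n) > g) sequentially"
        using padic_Cauchy_not_null_bound[OF p C(5) 3] by metis
      show ?thesis by (rule that[OF g(1)]) (use g(2) in \<open>auto elim: eventually_mono\<close>)
    qed
  qed
  \<comment> \<open>Scaling (t, s) by l divides w by l^2, and |l| <= 1 / h. So w shrinks at worst by
    the factor h^2, while y and z stay as they are.\<close>
  define g' where "g' = g * min 1 (h * h)"
  have g': "g' > 0" using g h by (simp add: g'_def)
  define e where "e = (1 / real p) ^ N * (g' * g')"
  have e: "e > 0" using g' prime_gt_0_nat[OF p] by (simp add: e_def)
  have "eventually (\<lambda>n. ?v (?E (t n) (s n) (y n) (z n) (w n)) < e) sequentially"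
    using order_tendstoD(2)[OF null[unfolded padic_null_def] e] .
  then have "eventually (\<lambda>n. (?v (t n) > h \<or> ?v (s n) > h) \<and> (?v (y n) > g \<or> ?v (z n) > g \<or> ?v (w n) > g) \<and>
      ?v (?E (t n) (s n) (y n) (z n) (w n)) < e) sequentially"
    using h(2) g(2) by eventually_elim auto
  then obtain n where n: "?v (t n) > h \<or> ?v (s n) > h" "?v (y n) > g \<or> ?v (z n) > g \<or> ?v (w n) > g"
    "?v (?E (t n) (s n) (y n) (z n) (w n)) < e" using eventually_happens' sequentially_bot by blast
  have "\<not> (t n = 0 \<and> s n = 0 \<and> s n = 0)" using n(1) h(1) by auto
  \<comment> \<open>\<open>s n\<close> is used twice, so that the statement about triples applies to
    a pair.\<close>
  then obtain l T S S' where l: "l \<noteq> 0" "of_int T = l * t n" "of_int S = l * s n" "of_int S' = l * s n"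
    "\<not> (int p dvd T \<and> int p dvd S \<and> int p dvd S')" using ex_primitive_multiple[OF p] by metis
  have SS: "S' = S" using l(3,4) by (metis of_int_eq_iff)
  have "?v l * h \<le> 1"
  proof -
    have "?v l * ?v (t n) \<le> 1" "?v l * ?v (s n) \<le> 1"
      using padic_abs_of_int_le_1[OF p, of T] padic_abs_of_int_le_1[OF p, of S] l(2,3) by (auto simp: padic_abs_mult[OF p])
    moreover have "?v l * h \<le> ?v l * ?v (t n) \<or> ?v l * h \<le> ?v l * ?v (s n)"
      using n(1) by (auto intro: mult_left_mono)
    ultimately show ?thesis by linarith
  qed
  then have l1: "(?v l * ?v l) * (h * h) \<le> 1"
    using mult_mono[of "?v l * h" 1 "?v l * h" 1] h(1) by (simp add: mult_ac)
  have lpos: "?v l > 0" using padic_abs_pos[OF p l(1)] .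
  define w' where "w' = w n / (l * l)"
  have w': "?v (w n) = ?v w' * (?v l * ?v l)" using l(1) by (simp add: w'_def flip: padic_abs_mult[OF p])
  have big: "?v (y n) \<ge> g' \<or> ?v (z n) \<ge> g' \<or> ?v w' \<ge> g'"
  proof -
    have g1: "g' \<le> g" using g(1) h(1) by (simp add: g'_def min_def mult_left_le)
    have "?v w' \<ge> g'" if "?v (w n) > g"
    proof -
      have "g' \<le> g * (h * h)" using g(1) by (simp add: g'_def)
      also have "\<dots> \<le> ?v (w n) * (h * h)" using that h(1) by (intro mult_right_mono) auto
      also have "\<dots> = ?v w' * ((?v l * ?v l) * (h * h))" by (simp add: w')
      also have "\<dots> \<le> ?v w' * 1" by (rule mult_left_mono[OF l1]) simp
      finally show ?thesis by simp
    qed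
    then show ?thesis using n(2) g1 by force
  qed
  then have "\<not> (y n = 0 \<and> z n = 0 \<and> w' = 0)" using g' by auto
  then obtain m Y Z W where m: "m \<noteq> 0" "of_int Y = m * y n" "of_int Z = m * z n" "of_int W = m * w'"
    "\<not> (int p dvd Y \<and> int p dvd Z \<and> int p dvd W)" by (rule ex_primitive_multiple[OF p])
  have mg: "?v m * g' \<le> 1"
  proof -
    have "?v m * ?v (y n) \<le> 1" "?v m * ?v (z n) \<le> 1" "?v m * ?v w' \<le> 1"
      using padic_abs_of_int_le_1[OF p, of Y] padic_abs_of_int_le_1[OF p, of Z] padic_abs_of_int_le_1[OF p, of W] m(2-4)
      by (auto simp: padic_abs_mult[OF p])
    moreover have "?v m * g' \<le> ?v m * ?v (y n) \<or> ?v m * g' \<le> ?v m * ?v (z n) \<or> ?v m * g' \<le> ?v m * ?v w'"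
      using big by (auto intro: mult_left_mono)
    ultimately show ?thesis by linarith
  qed
  let ?F = "Y\<^sup>2 + Z\<^sup>2 - (a * T\<^sup>2 + b * S\<^sup>2) * (c * T\<^sup>2 + d * S\<^sup>2) * W\<^sup>2"
  have "of_int ?F = ?E (of_int T) (of_int S) (of_int Y) (of_int Z) (of_int W)"
    by (simp add: power2_eq_square)
  also have "\<dots> = (m * m) * ?E (t n) (s n) (y n) (z n) (w n)"
  proof -
    have "w n = w' * (l * l)" using l(1) by (simp add: w'_def)
    then show ?thesis unfolding l(2,3) m(2-4) by (simp add: algebra_simps)
  qed
  finally have F: "?v (of_int ?F) = (?v m * ?v m) * ?v (?E (t n) (s n) (y n) (z n) (w n))"
    by (simp only: padic_abs_mult[OF p])
  also have "\<dots> < (?v m * ?v m) * e" using n(3) padic_abs_pos[OF p m(1)] by (intro mult_strict_left_mono) auto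
  also have "\<dots> = (1 / real p) ^ N * ((?v m * g') * (?v m * g'))" by (simp add: e_def mult_ac)
  also have "\<dots> \<le> (1 / real p) ^ N * (1 * 1)"
    using mg g' by (intro mult_left_mono mult_mono) auto
  finally have "int p ^ N dvd ?F" using dvd_of_padic_abs_less[OF p] by simp
  then show ?thesis using l(5) m(5) SS by blast
qed

text \<open>Without an integral norm value both forms are anisotropic, so their product
  \<open>F\<close> has bounded valuation on all primitive (t, s). A sufficiently precise solution
  then puts F w^2 in the class of y^2 + z^2, which is a norm, and so F is one.\<close>

lemma intsol_of_soluble_padic:
  assumes p: "prime p" "p = 2 \<or> [p = 3] (mod 4)" and nd: "nondegenerate a b c d" and sol: "soluble_padic p a b c d"
  shows "intsol p a b c d"
proof (rule ccontr)
  assume ns: "\<not> intsol p a b c d"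
  have nd': "a \<noteq> 0" "b \<noteq> 0" "c \<noteq> 0" "d \<noteq> 0" "a * d - b * c \<noteq> 0" using nd by (auto simp: nondegenerate_def)
  have "c * b - d * a \<noteq> 0" using nd' by (simp add: algebra_simps)
  then have iso: "\<not> iso_form p a b" "\<not> iso_form p c d"
    using intsol_of_iso[OF p(1)] ns nd'(5) intsol_commute by blast+
  have pi: "prime (int p)" using p by simp
  have "a * b * c * d \<noteq> 0" using nd' by simp
  then obtain J where J: "\<not> int p ^ J dvd a * b * c * d"
    using prime_power_decompose[OF p(1)] prime_power_dvd_mult_iff[OF p(1)] by (metis Suc_n_not_le_n)
  have J': "\<not> int p ^ J dvd a" "\<not> int p ^ J dvd b" "\<not> int p ^ J dvd c" "\<not> int p ^ J dvd d"
    using J by (meson dvd_mult dvd_mult2)+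
  define L where "L = J + iso_loss p"
  have form: "\<not> int p ^ L dvd a' * t\<^sup>2 + b' * s\<^sup>2"
    if "\<not> iso_form p a' b'" "\<not> int p ^ J dvd a'" "\<not> int p ^ J dvd b'" "\<not> (int p dvd t \<and> int p dvd s)" for a' b' t s
  proof
    assume "int p ^ L dvd a' * t\<^sup>2 + b' * s\<^sup>2"
    then have D: "int p ^ (J + 0) dvd t\<^sup>2 * a'" "int p ^ (J + 0) dvd s\<^sup>2 * b'"
      using iso_form_dvd[OF that(1), of J t s] by (simp_all add: L_def mult.commute)
    have "coprime (int p ^ J) (x\<^sup>2)" if "\<not> int p dvd x" for x
      using that pi by (metis coprime_power_left_iff coprime_power_right_iff prime_imp_coprime)
    then show False using D that(2-4) by (metis add.right_neutral coprime_dvd_mult_right_iff)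
  qed
  \<comment> \<open>\<open>L + L\<close> bounds the valuation of F w^2 when w is a unit. The summand
    3 ensures the \<open>2 + class_loss p\<close> digits needed when p divides w, where y^2 + z^2 is
    primitive and not divisible by p^2.\<close>
  obtain t s y z w where ts: "\<not> (int p dvd t \<and> int p dvd s)" and yzw: "\<not> (int p dvd y \<and> int p dvd z \<and> int p dvd w)"
    and dv: "int p ^ (L + L + class_loss p + 3) dvd y\<^sup>2 + z\<^sup>2 - (a * t\<^sup>2 + b * s\<^sup>2) * (c * t\<^sup>2 + d * s\<^sup>2) * w\<^sup>2"
    using soluble_padic_imp_primitive_cong[OF p(1) sol] by blast
  define F where "F = (a * t\<^sup>2 + b * s\<^sup>2) * (c * t\<^sup>2 + d * s\<^sup>2)"
  have F: "\<not> int p ^ (L + L) dvd F"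
  proof
    assume "int p ^ (L + L) dvd F"
    then have "int p ^ Suc L dvd a * t\<^sup>2 + b * s\<^sup>2 \<or> int p ^ L dvd c * t\<^sup>2 + d * s\<^sup>2"
      unfolding F_def by (rule prime_power_dvd_split[OF p(1)])
    then show False using form[OF iso(1) J'(1,2) ts] form[OF iso(2) J'(3,4) ts] power_le_dvd[of "int p" "Suc L" _ L] by auto
  qed
  have F0: "F \<noteq> 0" using F by auto
  have sq: "locnorm p (F * w\<^sup>2) \<Longrightarrow> False"
  proof -
    assume 1: "locnorm p (F * w\<^sup>2)"
    then have "w \<noteq> 0" using locnorm_nonzero by force
    then have "locnorm p F" using locnorm_square[OF p(1), of w F] 1 F0 by (simp add: mult.commute)
    then show False using ns unfolding intsol_def F_def by blast
  qed
  show False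
  proof (cases "int p dvd w")
    case True
    then have "\<not> (int p dvd y \<and> int p dvd z)" using yzw by blast
    note S = sum_squares_not_dvd[OF p this]
    have "int p ^ (2 + class_loss p) dvd y\<^sup>2 + z\<^sup>2 - F * w\<^sup>2" unfolding F_def
      by (rule power_le_dvd[OF dv]) simp
    then have "int p ^ (2 + class_loss p) dvd F * w\<^sup>2 - (y\<^sup>2 + z\<^sup>2)" by (simp add: dvd_diff_commute)
    then show False using locnorm_cong(1)[OF p(1) S(1)] S(2) sq by blast
  next
    case False
    then have "coprime (int p ^ (L + L)) (w\<^sup>2)"
      using pi by (metis coprime_power_left_iff coprime_power_right_iff prime_imp_coprime)
    then have Fw: "\<not> int p ^ (L + L) dvd F * w\<^sup>2" using F by (metis coprime_dvd_mult_left_iff)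
    have "int p ^ (L + L + class_loss p) dvd y\<^sup>2 + z\<^sup>2 - F * w\<^sup>2" unfolding F_def
      by (rule power_le_dvd[OF dv]) simp
    note N = locnorm_cong[OF p(1) Fw this]
    have "locnorm p (y\<^sup>2 + z\<^sup>2)" using locnorm_sum_squares[OF p N(2)] .
    then show False using N(1) sq by blast
  qed
qed

section \<open>The real place\<close>

text \<open>The only obstruction is a pair of definite forms with opposite signs. If neither [1:0]
  nor [0:1] gives a nonnegative product, then excluding that pair makes the first form indefinite,
  and a real root of it gives the value 0.\<close>

lemma soluble_real_iff:
  assumes nd: "nondegenerate a b c d"
  shows "soluble_real a b c d \<longleftrightarrow>
    \<not> (a > 0 \<and> b > 0 \<and> c < 0 \<and> d < 0) \<and> \<not> (a < 0 \<and> b < 0 \<and> c > 0 \<and> d > 0)"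
proof -
  let ?K = "ring_of_type_algebra :: real ring"
  interpret K: cring ?K by (rule cring_from_type_algebra)
  have nz: "a \<noteq> 0" "b \<noteq> 0" "c \<noteq> 0" "d \<noteq> 0" using nd by (auto simp: nondegenerate_def)
  have nat_mult: "[(n::nat)] \<cdot>\<^bsub>?K\<^esub> x = of_nat n * x" for n x
  proof (induction n)
    case 0 then show ?case by (simp add: K.add.nat_pow_0) (simp add: ring_of_type_algebra_def)
  next
    case (Suc n)
    then show ?case by (simp add: K.add.nat_pow_Suc) (simp add: ring_of_type_algebra_def algebra_simps)
  qed
  have minus: "\<ominus>\<^bsub>?K\<^esub> x = - x" for x
    by (intro K.minus_equality) (auto simp: ring_of_type_algebra_def)
  have int_mult: "[(k::int)] \<cdot>\<^bsub>?K\<^esub> x = of_int k * x" for k x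
    by (cases "k \<ge> 0") (simp_all add: add_pow_int_ge add_pow_int_lt nat_mult minus)
  have ne: "{(t, s, y, z, w). P t s y z w} \<noteq> {} \<longleftrightarrow> (\<exists>t s y z w. P t s y z w)" for P :: "real \<Rightarrow> real \<Rightarrow> real \<Rightarrow> real \<Rightarrow> real \<Rightarrow> bool"
    by auto
  have "soluble_real a b c d \<longleftrightarrow> chatelet_coords ?K a b c d \<noteq> {}"
    unfolding soluble_real_def chatelet_points_def by simp
  also have "\<dots> \<longleftrightarrow> (\<exists>t s y z w :: real. (t, s) \<noteq> (0, 0) \<and> (y, z, w) \<noteq> (0, 0, 0) \<and>
      y * y + z * z = (of_int a * (t * t) + of_int b * (s * s)) * (of_int c * (t * t) + of_int d * (s * s)) * (w * w))"
    unfolding chatelet_coords_def int_mult ne by (simp add: ring_of_type_algebra_def)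
  finally have iff: "soluble_real a b c d \<longleftrightarrow> \<dots>" .
  show ?thesis
  proof
    assume "soluble_real a b c d"
    then obtain t s y z w :: real where P0: "(t, s) \<noteq> (0, 0)" "(y, z, w) \<noteq> (0, 0, 0)" and P3:
      "y * y + z * z = (of_int a * (t * t) + of_int b * (s * s)) * (of_int c * (t * t) + of_int d * (s * s)) * (w * w)"
      using iff by blast
    have P: "t \<noteq> 0 \<or> s \<noteq> 0" "y \<noteq> 0 \<or> z \<noteq> 0 \<or> w \<noteq> 0" using P0 by auto
    have ts: "t * t \<ge> 0" "s * s \<ge> 0" "t * t > 0 \<or> s * s > 0" using P(1) by (auto simp: zero_less_mult_iff)
    have pos: "of_int k * (t * t) + of_int l * (s * s) > 0" if "k > 0" "l > 0" for k l
      using ts that by (auto intro: add_pos_nonneg add_nonneg_pos)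
    have neg: "of_int k * (t * t) + of_int l * (s * s) < 0" if "k < 0" "l < 0" for k l
      using pos[of "- k" "- l"] that by simp
    have F: "(of_int a * (t * t) + of_int b * (s * s)) * (of_int c * (t * t) + of_int d * (s * s)) < 0 \<Longrightarrow> False"
    proof -
      assume L: "(of_int a * (t * t) + of_int b * (s * s)) * (of_int c * (t * t) + of_int d * (s * s)) < 0"
      have yz: "y * y + z * z \<ge> 0" by simp
      have "w = 0"
      proof (rule ccontr)
        assume "w \<noteq> 0"
        then have "w * w > 0" by (auto simp: zero_less_mult_iff)
        then have "y * y + z * z < 0" using L unfolding P3 by (simp add: mult_less_0_iff)
        then show False using yz by simp
      qed
      then have "y * y + z * z = 0" using P3 by simp
      then show False using P(2) \<open>w = 0\<close> by (simp add: sum_squares_eq_zero_iff)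
    qed
    show "\<not> (a > 0 \<and> b > 0 \<and> c < 0 \<and> d < 0) \<and> \<not> (a < 0 \<and> b < 0 \<and> c > 0 \<and> d > 0)"
      using F pos[of a b] neg[of c d] neg[of a b] pos[of c d] by (auto simp: mult_less_0_iff)
  next
    assume R: "\<not> (a > 0 \<and> b > 0 \<and> c < 0 \<and> d < 0) \<and> \<not> (a < 0 \<and> b < 0 \<and> c > 0 \<and> d > 0)"
    have main: "soluble_real a b c d" if "t \<noteq> 0 \<or> s \<noteq> 0"
      "(of_int a * (t * t) + of_int b * (s * s)) * (of_int c * (t * t) + of_int d * (s * s)) \<ge> 0" for t s :: real
      unfolding iff
      by (rule exI[of _ t], rule exI[of _ s],
          rule exI[of _ "sqrt ((of_int a * (t * t) + of_int b * (s * s)) * (of_int c * (t * t) + of_int d * (s * s)))"],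
          rule exI[of _ 0], rule exI[of _ 1]) (use that in simp)
    consider "a * c \<ge> 0" | "b * d \<ge> 0" | "a * c < 0" "b * d < 0" by linarith
    then show "soluble_real a b c d"
    proof cases
      case 1
      then have "real_of_int a * real_of_int c \<ge> 0" by (metis of_int_0_le_iff of_int_mult)
      then show ?thesis using main[of 1 0] by simp
    next
      case 2
      then have "real_of_int b * real_of_int d \<ge> 0" by (metis of_int_0_le_iff of_int_mult)
      then show ?thesis using main[of 0 1] by simp
    next
      case 3
      then have "a * b < 0" using R nz by (auto simp: mult_less_0_iff)
      define r where "r = - real_of_int b / real_of_int a"
      have "r \<ge> 0" using \<open>a * b < 0\<close> by (auto simp: r_def mult_less_0_iff divide_nonpos_pos divide_nonneg_neg field_simps)
      then have "sqrt r * sqrt r = r" by simp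
      then have "of_int a * (sqrt r * sqrt r) + of_int b * (1 * 1) = (0 :: real)" using nz by (simp add: r_def)
      then show ?thesis using main[of "sqrt r" 1] by simp
    qed
  qed
qed
subsection \<open>Periodic functions of four variables\<close>

definition periodic4 :: "int \<Rightarrow> (int \<Rightarrow> int \<Rightarrow> int \<Rightarrow> int \<Rightarrow> real) \<Rightarrow> bool" where
  "periodic4 q h \<longleftrightarrow> (\<forall>a b c d a' b' c' d'.
     [a = a'] (mod q) \<longrightarrow> [b = b'] (mod q) \<longrightarrow> [c = c'] (mod q) \<longrightarrow> [d = d'] (mod q) \<longrightarrow>
     h a b c d = h a' b' c' d')"

definition sum4 :: "int set \<Rightarrow> int set \<Rightarrow> int set \<Rightarrow> int set \<Rightarrow> (int \<Rightarrow> int \<Rightarrow> int \<Rightarrow> int \<Rightarrow> real) \<Rightarrow> real" where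
  "sum4 A B C D h = (\<Sum>a\<in>A. \<Sum>b\<in>B. \<Sum>c\<in>C. \<Sum>d\<in>D. h a b c d)"

definition mean4 :: "int \<Rightarrow> (int \<Rightarrow> int \<Rightarrow> int \<Rightarrow> int \<Rightarrow> real) \<Rightarrow> real" where
  "mean4 q h = sum4 {0..<q} {0..<q} {0..<q} {0..<q} h / of_int q ^ 4"

lemma sum4_mono:
  assumes "\<And>a b c d. a \<in> A \<Longrightarrow> b \<in> B \<Longrightarrow> c \<in> C \<Longrightarrow> d \<in> D \<Longrightarrow> h a b c d \<le> k a b c d"
  shows "sum4 A B C D h \<le> sum4 A B C D k"
  unfolding sum4_def by (intro sum_mono assms)

lemma sum4_nonneg:
  assumes "\<And>a b c d. a \<in> A \<Longrightarrow> b \<in> B \<Longrightarrow> c \<in> C \<Longrightarrow> d \<in> D \<Longrightarrow> h a b c d \<ge> 0"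
  shows "sum4 A B C D h \<ge> 0"
  unfolding sum4_def by (intro sum_nonneg assms)

lemma sum4_cong:
  assumes "\<And>a b c d. a \<in> A \<Longrightarrow> b \<in> B \<Longrightarrow> c \<in> C \<Longrightarrow> d \<in> D \<Longrightarrow> h a b c d = k a b c d"
  shows "sum4 A B C D h = sum4 A B C D k"
  unfolding sum4_def by (intro sum.cong refl assms)

lemma sum4_add: "sum4 A B C D (\<lambda>a b c d. h a b c d + k a b c d) = sum4 A B C D h + sum4 A B C D k"
  by (simp add: sum4_def sum.distrib)

lemma sum4_diff: "sum4 A B C D (\<lambda>a b c d. h a b c d - k a b c d) = sum4 A B C D h - sum4 A B C D k"
  by (simp add: sum4_def sum_subtractf)

lemma sum4_cmult: "sum4 A B C D (\<lambda>a b c d. r * h a b c d) = r * sum4 A B C D h"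
  by (simp add: sum4_def sum_distrib_left)

lemma sum4_sum: "sum4 A B C D (\<lambda>a b c d. \<Sum>i\<in>I. h i a b c d) = (\<Sum>i\<in>I. sum4 A B C D (h i))"
proof (induction I rule: infinite_finite_induct)
  case (insert x F)
  then show ?case by (simp add: sum4_add)
qed (simp_all add: sum4_def)

lemma sum4_abs: "\<bar>sum4 A B C D h\<bar> \<le> sum4 A B C D (\<lambda>a b c d. \<bar>h a b c d\<bar>)"
proof -
  have "sum4 A B C D h \<le> sum4 A B C D (\<lambda>a b c d. \<bar>h a b c d\<bar>)" by (rule sum4_mono) simp
  moreover have "sum4 A B C D (\<lambda>a b c d. (-1) * h a b c d) \<le> sum4 A B C D (\<lambda>a b c d. \<bar>h a b c d\<bar>)" by (rule sum4_mono) simp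
  then have "- sum4 A B C D h \<le> sum4 A B C D (\<lambda>a b c d. \<bar>h a b c d\<bar>)" unfolding sum4_cmult by simp
  ultimately show ?thesis by linarith
qed

lemma sum4_of_bool_eq_card:
  assumes "finite A" "finite B" "finite C" "finite D"
  shows "sum4 A B C D (\<lambda>a b c d. of_bool (Q a b c d)) =
    real (card {(a, b, c, d). a \<in> A \<and> b \<in> B \<and> c \<in> C \<and> d \<in> D \<and> Q a b c d})"
proof -
  let ?S = "A \<times> B \<times> C \<times> D"
  have fin: "finite ?S" using assms by simp
  have "sum4 A B C D (\<lambda>a b c d. of_bool (Q a b c d)) = (\<Sum>(a, b, c, d)\<in>?S. of_bool (Q a b c d))"
    unfolding sum4_def by (simp add: sum.cartesian_product)
  also have "\<dots> = (\<Sum>x\<in>?S. of_bool ((\<lambda>(a, b, c, d). Q a b c d) x))" by (intro sum.cong) auto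
  also have "\<dots> = real (card (?S \<inter> {x. (\<lambda>(a, b, c, d). Q a b c d) x}))"
    using fin by (simp add: sum.If_cases of_bool_def)
  also have "?S \<inter> {x. (\<lambda>(a, b, c, d). Q a b c d) x} = {(a, b, c, d). a \<in> A \<and> b \<in> B \<and> c \<in> C \<and> d \<in> D \<and> Q a b c d}"
    by auto
  finally show ?thesis .
qed

lemma sum4_prod: "sum4 A B C D (\<lambda>a b c d. f a * (g b * (h c * k d))) = sum f A * (sum g B * (sum h C * sum k D))"
  unfolding sum4_def by (simp only: sum_distrib_left[symmetric] sum_distrib_right[symmetric])

section \<open>Sums of periodic functions over boxes\<close>

lemma sum_periodic_block:
  fixes \<phi> :: "int \<Rightarrow> real"
  assumes q: "q > 0" and per: "\<And>a a'. [a = a'] (mod q) \<Longrightarrow> \<phi> a = \<phi> a'"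
  shows "(\<Sum>a=l..<l + q. \<phi> a) = (\<Sum>a=0..<q. \<phi> a)"
proof (rule sum.reindex_bij_witness[of _ "\<lambda>r. l + (r - l) mod q" "\<lambda>a. a mod q"])
  fix a assume a: "a \<in> {l..<l + q}"
  have "(a mod q - l) mod q = (a - l) mod q" by (simp add: mod_diff_left_eq)
  also have "\<dots> = a - l" using a by simp
  finally show "l + (a mod q - l) mod q = a" by simp
  show "a mod q \<in> {0..<q}" using q by simp
  show "\<phi> (a mod q) = \<phi> a" by (rule per) (simp add: cong_def)
next
  fix r assume r: "r \<in> {0..<q}"
  have "(l + (r - l) mod q) mod q = r mod q" by (simp add: mod_add_right_eq)
  then show "(l + (r - l) mod q) mod q = r" using r by simp
  show "l + (r - l) mod q \<in> {l..<l + q}" using q by simp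
qed

lemma sum_periodic_blocks:
  fixes \<phi> :: "int \<Rightarrow> real"
  assumes q: "q > 0" and per: "\<And>a a'. [a = a'] (mod q) \<Longrightarrow> \<phi> a = \<phi> a'"
  shows "(\<Sum>a=l..<l + q * int m. \<phi> a) = real m * (\<Sum>a=0..<q. \<phi> a)"
proof (induction m)
  case (Suc m)
  have e: "l + q * int (Suc m) = (l + q * int m) + q" by (simp add: algebra_simps)
  have "(\<Sum>a=l..<l + q * int (Suc m). \<phi> a) = (\<Sum>a\<in>{l..<l + q * int m} \<union> {l + q * int m..<(l + q * int m) + q}. \<phi> a)"
    unfolding e by (intro sum.cong refl ivl_disj_un_two(3)[symmetric]) (use q in auto)
  also have "\<dots> = (\<Sum>a=l..<l + q * int m. \<phi> a) + (\<Sum>a=l + q * int m..<(l + q * int m) + q. \<phi> a)"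
    by (rule sum.union_disjoint) auto
  also have "(\<Sum>a=l + q * int m..<(l + q * int m) + q. \<phi> a) = (\<Sum>a=0..<q. \<phi> a)"
    by (rule sum_periodic_block[OF q]) (rule per)
  also have "(\<Sum>a=l..<l + q * int m. \<phi> a) + (\<Sum>a=0..<q. \<phi> a) = real (Suc m) * (\<Sum>a=0..<q. \<phi> a)"
    unfolding Suc.IH by (simp add: algebra_simps)
  finally show ?case .
qed simp

lemma sum_periodic_bounds:
  fixes \<phi> :: "int \<Rightarrow> real"
  assumes q: "q > 0" and per: "\<And>a a'. [a = a'] (mod q) \<Longrightarrow> \<phi> a = \<phi> a'" and nn: "\<And>a. \<phi> a \<ge> 0"
  shows "(\<Sum>a=l..<l + int N. \<phi> a) \<le> (real N / of_int q + 1) * (\<Sum>a=0..<q. \<phi> a)"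
    and "(real N / of_int q - 1) * (\<Sum>a=0..<q. \<phi> a) \<le> (\<Sum>a=l..<l + int N. \<phi> a)"
proof -
  define m where "m = nat (int N div q)"
  have m: "int m = int N div q" using q by (simp add: m_def pos_imp_zdiv_nonneg_iff)
  have "q * int m + int N mod q = int N" unfolding m by simp
  moreover have "0 \<le> int N mod q" "int N mod q < q" using q by auto
  ultimately have le: "q * int m \<le> int N" "int N \<le> q * int m + q" by linarith+
  then have "q * int m \<le> int N" "int N \<le> q * int (Suc m)" by (auto simp: algebra_simps)
  then have "of_int q * real m \<le> real N" "real N \<le> of_int q * real (Suc m)"
    by (metis of_int_le_iff of_int_mult of_int_of_nat_eq)+
  then have rm: "real m \<le> real N / of_int q" "real (Suc m) \<le> real N / of_int q + 1" "real N / of_int q \<le> real m + 1"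
    using q by (auto simp: field_simps)
  have T: "(\<Sum>a=0..<q. \<phi> a) \<ge> 0" by (intro sum_nonneg nn)
  have "(\<Sum>a=l..<l + int N. \<phi> a) \<le> (\<Sum>a=l..<l + q * int (Suc m). \<phi> a)"
    using le nn by (intro sum_mono2) (auto simp: algebra_simps)
  also have "\<dots> = real (Suc m) * (\<Sum>a=0..<q. \<phi> a)" by (rule sum_periodic_blocks[OF q]) (rule per)
  also have "\<dots> \<le> (real N / of_int q + 1) * (\<Sum>a=0..<q. \<phi> a)" using rm(2) T by (intro mult_right_mono) auto
  finally show "(\<Sum>a=l..<l + int N. \<phi> a) \<le> (real N / of_int q + 1) * (\<Sum>a=0..<q. \<phi> a)" .
  have "(real N / of_int q - 1) * (\<Sum>a=0..<q. \<phi> a) \<le> real m * (\<Sum>a=0..<q. \<phi> a)"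
    using rm T by (intro mult_right_mono) auto
  also have "\<dots> = (\<Sum>a=l..<l + q * int m. \<phi> a)" using sum_periodic_blocks[where \<phi> = \<phi>, OF q per] by simp
  also have "\<dots> \<le> (\<Sum>a=l..<l + int N. \<phi> a)"
    using le nn by (intro sum_mono2) auto
  finally show "(real N / of_int q - 1) * (\<Sum>a=0..<q. \<phi> a) \<le> (\<Sum>a=l..<l + int N. \<phi> a)" .
qed

lemma periodic4D:
  "periodic4 q h \<Longrightarrow> [a = a'] (mod q) \<Longrightarrow> [b = b'] (mod q) \<Longrightarrow> [c = c'] (mod q) \<Longrightarrow> [d = d'] (mod q) \<Longrightarrow>
     h a b c d = h a' b' c' d'"
  unfolding periodic4_def by blast

lemma periodic4_dvd: "periodic4 q h \<Longrightarrow> q dvd r \<Longrightarrow> periodic4 r h"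
  unfolding periodic4_def by (meson cong_dvd_modulus)

lemma periodic4_mult: "periodic4 q h \<Longrightarrow> periodic4 q k \<Longrightarrow> periodic4 q (\<lambda>a b c d. h a b c d * k a b c d)"
  unfolding periodic4_def by (intro allI impI arg_cong2[of _ _ _ _ "(*)"]) blast+

text \<open>The partial sums of a periodic function are again periodic, so the four summations can be
  carried out one at a time.\<close>

definition sum_last :: "int \<Rightarrow> (int \<Rightarrow> int \<Rightarrow> int \<Rightarrow> int \<Rightarrow> real) \<Rightarrow> int \<Rightarrow> int \<Rightarrow> int \<Rightarrow> real" where
  "sum_last q h a b c = (\<Sum>d=0..<q. h a b c d)"

definition sum_last2 :: "int \<Rightarrow> (int \<Rightarrow> int \<Rightarrow> int \<Rightarrow> int \<Rightarrow> real) \<Rightarrow> int \<Rightarrow> int \<Rightarrow> real" where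
  "sum_last2 q h a b = (\<Sum>c=0..<q. sum_last q h a b c)"

definition sum_last3 :: "int \<Rightarrow> (int \<Rightarrow> int \<Rightarrow> int \<Rightarrow> int \<Rightarrow> real) \<Rightarrow> int \<Rightarrow> real" where
  "sum_last3 q h a = (\<Sum>b=0..<q. sum_last2 q h a b)"

lemma sum4_sum_last: "sum4 {0..<q} {0..<q} {0..<q} {0..<q} h = (\<Sum>a=0..<q. sum_last3 q h a)"
  by (simp add: sum4_def sum_last_def sum_last2_def sum_last3_def)

lemma sum_last_cong:
  assumes "periodic4 q h" "[a = a'] (mod q)" "[b = b'] (mod q)" "[c = c'] (mod q)"
  shows "sum_last q h a b c = sum_last q h a' b' c'"
  unfolding sum_last_def using periodic4D[OF assms] by (intro sum.cong) auto

lemma sum_last2_cong: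
  assumes "periodic4 q h" "[a = a'] (mod q)" "[b = b'] (mod q)"
  shows "sum_last2 q h a b = sum_last2 q h a' b'"
  unfolding sum_last2_def using sum_last_cong[OF assms] by (intro sum.cong) auto

lemma sum_last3_cong:
  assumes "periodic4 q h" "[a = a'] (mod q)"
  shows "sum_last3 q h a = sum_last3 q h a'"
  unfolding sum_last3_def using sum_last2_cong[OF assms] by (intro sum.cong) auto

lemma sum4_periodic_bounds:
  assumes q: "q > 0" and per: "periodic4 q h" and nn: "\<And>a b c d. h a b c d \<ge> 0" and N: "of_int q \<le> real N"
  defines "T \<equiv> sum4 {0..<q} {0..<q} {0..<q} {0..<q} h"
  shows "sum4 {l1..<l1 + int N} {l2..<l2 + int N} {l3..<l3 + int N} {l4..<l4 + int N} h \<le> (real N / of_int q + 1) ^ 4 * T"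
    and "(real N / of_int q - 1) ^ 4 * T \<le> sum4 {l1..<l1 + int N} {l2..<l2 + int N} {l3..<l3 + int N} {l4..<l4 + int N} h"
proof -
  let ?Q = "{0..<q}"
  let ?I = "\<lambda>l. {l..<l + int N}"
  let ?u = "real N / of_int q + 1" and ?v = "real N / of_int q - 1"
  have uv: "?u \<ge> 0" "?v \<ge> 0" using q N by (auto simp: field_simps)
  have T: "T = (\<Sum>a\<in>?Q. sum_last3 q h a)" by (simp add: T_def sum4_sum_last)
  have n: "sum_last q h a b c \<ge> 0" "sum_last2 q h a b \<ge> 0" "sum_last3 q h a \<ge> 0" for a b c
    unfolding sum_last3_def sum_last2_def sum_last_def by (intro sum_nonneg nn)+
  have b4: "(\<Sum>d\<in>?I l. h a b c d) \<le> ?u * sum_last q h a b c" "?v * sum_last q h a b c \<le> (\<Sum>d\<in>?I l. h a b c d)" for a b c l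
    unfolding sum_last_def using sum_periodic_bounds[where \<phi> = "h a b c", OF q periodic4D[OF per cong_refl cong_refl cong_refl] nn] by blast+
  have b3: "(\<Sum>c\<in>?I l. sum_last q h a b c) \<le> ?u * sum_last2 q h a b" "?v * sum_last2 q h a b \<le> (\<Sum>c\<in>?I l. sum_last q h a b c)" for a b l
    unfolding sum_last2_def using sum_periodic_bounds[where \<phi> = "sum_last q h a b", OF q sum_last_cong[OF per cong_refl cong_refl] n(1)] by blast+
  have b2: "(\<Sum>b\<in>?I l. sum_last2 q h a b) \<le> ?u * sum_last3 q h a" "?v * sum_last3 q h a \<le> (\<Sum>b\<in>?I l. sum_last2 q h a b)" for a l
    unfolding sum_last3_def using sum_periodic_bounds[where \<phi> = "sum_last2 q h a", OF q sum_last2_cong[OF per cong_refl] n(2)] by blast+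
  have b1: "(\<Sum>a\<in>?I l. sum_last3 q h a) \<le> ?u * T" "?v * T \<le> (\<Sum>a\<in>?I l. sum_last3 q h a)" for l
    unfolding T using sum_periodic_bounds[where \<phi> = "sum_last3 q h", OF q sum_last3_cong[OF per] n(3)] by blast+
  have "sum4 (?I l1) (?I l2) (?I l3) (?I l4) h \<le> (\<Sum>a\<in>?I l1. \<Sum>b\<in>?I l2. \<Sum>c\<in>?I l3. ?u * sum_last q h a b c)"
    unfolding sum4_def by (intro sum_mono b4)
  also have "\<dots> = ?u * (\<Sum>a\<in>?I l1. \<Sum>b\<in>?I l2. \<Sum>c\<in>?I l3. sum_last q h a b c)" by (simp only: sum_distrib_left)
  also have "\<dots> \<le> ?u * (\<Sum>a\<in>?I l1. \<Sum>b\<in>?I l2. ?u * sum_last2 q h a b)" using uv by (intro mult_left_mono sum_mono b3)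
  also have "\<dots> = ?u * (?u * (\<Sum>a\<in>?I l1. \<Sum>b\<in>?I l2. sum_last2 q h a b))" by (simp only: sum_distrib_left)
  also have "\<dots> \<le> ?u * (?u * (\<Sum>a\<in>?I l1. ?u * sum_last3 q h a))" using uv by (intro mult_left_mono sum_mono b2)
  also have "\<dots> = ?u * (?u * (?u * (\<Sum>a\<in>?I l1. sum_last3 q h a)))" by (simp only: sum_distrib_left)
  also have "\<dots> \<le> ?u * (?u * (?u * (?u * T)))" using uv by (intro mult_left_mono b1)
  also have "\<dots> = ?u ^ 4 * T" by (simp only: power4_eq_xxxx mult.assoc)
  finally show "sum4 (?I l1) (?I l2) (?I l3) (?I l4) h \<le> ?u ^ 4 * T" .
  have "?v ^ 4 * T = ?v * (?v * (?v * (?v * T)))" by (simp only: power4_eq_xxxx mult.assoc)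
  also have "\<dots> \<le> ?v * (?v * (?v * (\<Sum>a\<in>?I l1. sum_last3 q h a)))" using uv by (intro mult_left_mono b1)
  also have "\<dots> = ?v * (?v * (\<Sum>a\<in>?I l1. ?v * sum_last3 q h a))" by (simp only: sum_distrib_left)
  also have "\<dots> \<le> ?v * (?v * (\<Sum>a\<in>?I l1. \<Sum>b\<in>?I l2. sum_last2 q h a b))" using uv by (intro mult_left_mono sum_mono b2)
  also have "\<dots> = ?v * (\<Sum>a\<in>?I l1. \<Sum>b\<in>?I l2. ?v * sum_last2 q h a b)" by (simp only: sum_distrib_left)
  also have "\<dots> \<le> ?v * (\<Sum>a\<in>?I l1. \<Sum>b\<in>?I l2. \<Sum>c\<in>?I l3. sum_last q h a b c)" using uv by (intro mult_left_mono sum_mono b3)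
  also have "\<dots> = (\<Sum>a\<in>?I l1. \<Sum>b\<in>?I l2. \<Sum>c\<in>?I l3. ?v * sum_last q h a b c)" by (simp only: sum_distrib_left)
  also have "\<dots> \<le> sum4 (?I l1) (?I l2) (?I l3) (?I l4) h" unfolding sum4_def by (intro sum_mono b4)
  finally show "?v ^ 4 * T \<le> sum4 (?I l1) (?I l2) (?I l3) (?I l4) h" .
qed

lemma mean4_nonneg: "(\<And>a b c d. h a b c d \<ge> 0) \<Longrightarrow> q > 0 \<Longrightarrow> mean4 q h \<ge> 0"
  unfolding mean4_def by (intro divide_nonneg_nonneg sum4_nonneg) auto

text \<open>With x = N / q >= 1 the box lies between (x - 1)^4 and (x + 1)^4 full periods. The
  constants come from 4 + 6 + 4 + 1 = 15 and from (x + 1)^4 <= (2x)^4. The error is proportional to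
  the mean, so that summing it over many moduli only needs the sum of their densities.\<close>

lemma sum4_periodic_mean:
  assumes q: "q > 0" and per: "periodic4 q h" and nn: "\<And>a b c d. h a b c d \<ge> 0" and N: "of_int q \<le> real N"
  shows "\<bar>sum4 {l1..<l1 + int N} {l2..<l2 + int N} {l3..<l3 + int N} {l4..<l4 + int N} h - real N ^ 4 * mean4 q h\<bar>
      \<le> 15 * real N ^ 3 * of_int q * mean4 q h"
    and "sum4 {l1..<l1 + int N} {l2..<l2 + int N} {l3..<l3 + int N} {l4..<l4 + int N} h \<le> 16 * real N ^ 4 * mean4 q h"
proof -
  let ?S = "sum4 {l1..<l1 + int N} {l2..<l2 + int N} {l3..<l3 + int N} {l4..<l4 + int N} h"
  define x where "x = real N / of_int q"
  define M where "M = mean4 q h"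
  have M: "M \<ge> 0" unfolding M_def by (intro mean4_nonneg nn q)
  have q0: "of_int q > (0::real)" using q by simp
  have Nx: "real N = x * of_int q" using q0 by (simp add: x_def)
  have x: "x \<ge> 1" using N q0 by (simp add: x_def)
  have T: "sum4 {0..<q} {0..<q} {0..<q} {0..<q} h = of_int q ^ 4 * M" using q0 by (simp add: M_def mean4_def)
  have up: "?S \<le> (x + 1) ^ 4 * (of_int q ^ 4 * M)" and lo: "(x - 1) ^ 4 * (of_int q ^ 4 * M) \<le> ?S"
    using sum4_periodic_bounds[OF assms] unfolding T x_def by blast+
  have x2: "x \<le> x ^ 2" "x ^ 2 \<le> x ^ 3" "1 \<le> x ^ 3" using x by (auto simp: power_increasing_iff self_le_power intro: power_increasing one_le_power)
  have e1: "(x + 1) ^ 4 = x ^ 4 + (4 * x ^ 3 + 6 * x ^ 2 + 4 * x + 1)" by (simp add: power4_eq_xxxx power3_eq_cube power2_eq_square algebra_simps)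
  have e2: "(x - 1) ^ 4 = x ^ 4 - (4 * x ^ 3 - 6 * x ^ 2 + 4 * x - 1)" by (simp add: power4_eq_xxxx power3_eq_cube power2_eq_square algebra_simps)
  have i1: "(x + 1) ^ 4 \<le> x ^ 4 + 15 * x ^ 3" using x2 x unfolding e1 by linarith
  have i2: "x ^ 4 - 15 * x ^ 3 \<le> (x - 1) ^ 4" using x2 x unfolding e2 by linarith
  have i3: "(x + 1) ^ 4 \<le> 16 * x ^ 4"
  proof -
    have "(x + 1) ^ 4 \<le> (2 * x) ^ 4" using x by (intro power_mono) auto
    then show ?thesis by (simp add: power_mult_distrib)
  qed
  have qM: "of_int q ^ 4 * M \<ge> 0" using M q0 by simp
  have w: "x ^ 4 * (of_int q ^ 4 * M) = real N ^ 4 * M" by (simp add: Nx power_mult_distrib)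
  have w3: "x ^ 3 * (of_int q ^ 4 * M) = real N ^ 3 * (of_int q * M)"
    by (simp add: Nx power_mult_distrib power4_eq_xxxx power3_eq_cube)
  have "?S \<le> (x ^ 4 + 15 * x ^ 3) * (of_int q ^ 4 * M)" using up mult_right_mono[OF i1 qM] by (rule order_trans)
  also have "\<dots> = real N ^ 4 * M + 15 * real N ^ 3 * of_int q * M" by (simp only: distrib_right mult.assoc w w3)
  finally have S1: "?S \<le> real N ^ 4 * M + 15 * real N ^ 3 * of_int q * M" .
  have "(x ^ 4 - 15 * x ^ 3) * (of_int q ^ 4 * M) \<le> ?S" using mult_right_mono[OF i2 qM] lo by (rule order_trans)
  also have "(x ^ 4 - 15 * x ^ 3) * (of_int q ^ 4 * M) = real N ^ 4 * M - 15 * real N ^ 3 * of_int q * M"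
    by (simp only: left_diff_distrib mult.assoc w w3)
  finally show "\<bar>?S - real N ^ 4 * mean4 q h\<bar> \<le> 15 * real N ^ 3 * of_int q * mean4 q h"
    using S1 unfolding M_def[symmetric] abs_diff_le_iff by blast
  have "?S \<le> (16 * x ^ 4) * (of_int q ^ 4 * M)" using up mult_right_mono[OF i3 qM] by linarith
  then show "?S \<le> 16 * real N ^ 4 * mean4 q h" unfolding M_def[symmetric] by (simp add: Nx power_mult_distrib)
qed

section \<open>Means for multiples and for coprime moduli\<close>

lemma mean4_multiple:
  assumes q: "q > 0" and r: "r > 0" and per: "periodic4 q h"
  shows "mean4 (q * r) h = mean4 q h"
proof -
  let ?Q = "{0..<q}" and ?R = "{0..<q * r}"
  have bl: "(\<Sum>a\<in>?R. \<phi> a) = of_int r * (\<Sum>a\<in>?Q. \<phi> a)" if "\<And>a a'. [a = a'] (mod q) \<Longrightarrow> \<phi> a = \<phi> a'" for \<phi> :: "int \<Rightarrow> real"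
    using sum_periodic_blocks[where \<phi> = \<phi> and l = 0 and m = "nat r", OF q that] r by simp
  have 4: "(\<Sum>d\<in>?R. h a b c d) = of_int r * sum_last q h a b c" for a b c
    unfolding sum_last_def by (rule bl) (rule periodic4D[OF per cong_refl cong_refl cong_refl])
  have 3: "(\<Sum>c\<in>?R. sum_last q h a b c) = of_int r * sum_last2 q h a b" for a b
    unfolding sum_last2_def by (rule bl) (rule sum_last_cong[OF per cong_refl cong_refl])
  have 2: "(\<Sum>b\<in>?R. sum_last2 q h a b) = of_int r * sum_last3 q h a" for a
    unfolding sum_last3_def by (rule bl) (rule sum_last2_cong[OF per cong_refl])
  have 1: "(\<Sum>a\<in>?R. sum_last3 q h a) = of_int r * sum4 ?Q ?Q ?Q ?Q h"
    unfolding sum4_sum_last by (rule bl) (rule sum_last3_cong[OF per])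
  have "sum4 ?R ?R ?R ?R h = of_int r ^ 4 * sum4 ?Q ?Q ?Q ?Q h"
    unfolding sum4_def[of ?R] 4 sum_distrib_left[symmetric] 3 2 1 by (simp add: power4_eq_xxxx)
  then show ?thesis using q r by (simp add: mean4_def power_mult_distrib)
qed

lemma sum_crt:
  fixes \<phi> \<psi> :: "int \<Rightarrow> real"
  assumes q: "q > 0" "r > 0" and co: "coprime q r"
    and \<phi>: "\<And>a a'. [a = a'] (mod q) \<Longrightarrow> \<phi> a = \<phi> a'" and \<psi>: "\<And>a a'. [a = a'] (mod r) \<Longrightarrow> \<psi> a = \<psi> a'"
  shows "(\<Sum>a=0..<q * r. \<phi> a * \<psi> a) = (\<Sum>a=0..<q. \<phi> a) * (\<Sum>a=0..<r. \<psi> a)"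
proof -
  let ?f = "\<lambda>a. (a mod q, a mod r)"
  let ?A = "{0..<q * r}" and ?B = "{0..<q} \<times> {0..<r}"
  have inj: "inj_on ?f ?A"
  proof (rule inj_onI)
    fix a b assume ab: "a \<in> ?A" "b \<in> ?A" "?f a = ?f b"
    then have "[a = b] (mod q)" "[a = b] (mod r)" by (auto simp: cong_def)
    then have "[a = b] (mod q * r)" using co by (rule coprime_cong_mult)
    then show "a = b" using ab by (auto simp: cong_def)
  qed
  have "?f ` ?A = ?B"
  proof (rule card_subset_eq)
    show "card (?f ` ?A) = card ?B" using inj q by (simp add: card_image card_cartesian_product nat_mult_distrib)
    show "?f ` ?A \<subseteq> ?B" using q by auto
  qed simp
  then have bij: "bij_betw ?f ?A ?B" using inj by (simp add: bij_betw_def)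
  have "(\<Sum>a\<in>?A. \<phi> a * \<psi> a) = (\<Sum>a\<in>?A. (\<lambda>(u, v). \<phi> u * \<psi> v) (?f a))"
  proof (intro sum.cong refl)
    fix a
    have "\<phi> (a mod q) = \<phi> a" "\<psi> (a mod r) = \<psi> a" by (auto intro!: \<phi> \<psi> simp: cong_def)
    then show "\<phi> a * \<psi> a = (\<lambda>(u, v). \<phi> u * \<psi> v) (?f a)" by simp
  qed
  also have "\<dots> = (\<Sum>(u, v)\<in>?B. \<phi> u * \<psi> v)" by (rule sum.reindex_bij_betw[OF bij])
  also have "\<dots> = (\<Sum>a=0..<q. \<phi> a) * (\<Sum>a=0..<r. \<psi> a)" by (simp add: sum_product sum.cartesian_product)
  finally show ?thesis .
qed

lemma mean4_crt:
  assumes q: "q > 0" "r > 0" and co: "coprime q r" and h: "periodic4 q h" and k: "periodic4 r k"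
  shows "mean4 (q * r) (\<lambda>a b c d. h a b c d * k a b c d) = mean4 q h * mean4 r k"
proof -
  let ?Q = "{0..<q}" and ?R = "{0..<r}" and ?A = "{0..<q * r}"
  have 4: "(\<Sum>d\<in>?A. h a b c d * k a b c d) = sum_last q h a b c * sum_last r k a b c" for a b c
    unfolding sum_last_def by (rule sum_crt[OF q co]) (rule periodic4D[OF h cong_refl cong_refl cong_refl] periodic4D[OF k cong_refl cong_refl cong_refl], assumption)+
  have 3: "(\<Sum>c\<in>?A. sum_last q h a b c * sum_last r k a b c) = sum_last2 q h a b * sum_last2 r k a b" for a b
    unfolding sum_last2_def by (rule sum_crt[OF q co]) (rule sum_last_cong[OF h cong_refl cong_refl] sum_last_cong[OF k cong_refl cong_refl], assumption)+
  have 2: "(\<Sum>b\<in>?A. sum_last2 q h a b * sum_last2 r k a b) = sum_last3 q h a * sum_last3 r k a" for a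
    unfolding sum_last3_def by (rule sum_crt[OF q co]) (rule sum_last2_cong[OF h cong_refl] sum_last2_cong[OF k cong_refl], assumption)+
  have 1: "(\<Sum>a\<in>?A. sum_last3 q h a * sum_last3 r k a) = sum4 ?Q ?Q ?Q ?Q h * sum4 ?R ?R ?R ?R k"
    unfolding sum4_sum_last
    by (rule sum_crt[OF q co]) (rule sum_last3_cong[OF h] sum_last3_cong[OF k], assumption)+
  have "sum4 ?A ?A ?A ?A (\<lambda>a b c d. h a b c d * k a b c d) = sum4 ?Q ?Q ?Q ?Q h * sum4 ?R ?R ?R ?R k"
    unfolding sum4_def[of ?A] 4 3 2 1 ..
  then show ?thesis by (simp add: mean4_def power_mult_distrib)
qed

section \<open>Divisibility conditions in periods and in orthants\<close>

definition dvd4 :: "int \<Rightarrow> int \<Rightarrow> int \<Rightarrow> int \<Rightarrow> int \<Rightarrow> int \<Rightarrow> int \<Rightarrow> int \<Rightarrow> real" where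
  "dvd4 e1 e2 e3 e4 a b c d = of_bool (e1 dvd a) * (of_bool (e2 dvd b) * (of_bool (e3 dvd c) * of_bool (e4 dvd d)))"

lemma dvd4_nonneg: "dvd4 e1 e2 e3 e4 a b c d \<ge> 0"
  by (simp add: dvd4_def)

lemma sum_of_bool_dvd_residues:
  fixes e q :: int
  assumes "e > 0" "q > 0" "e dvd q"
  shows "(\<Sum>a=0..<q. of_bool (e dvd a)) = (of_int q / of_int e :: real)"
proof -
  obtain m where m: "q = e * m" using assms by auto
  then have m0: "m > 0" using assms by (simp add: zero_less_mult_iff)
  have "(\<Sum>a=0..<0 + e * int (nat m). of_bool (e dvd a)) = real (nat m) * (\<Sum>a=0..<e. of_bool (e dvd a))"
    by (rule sum_periodic_blocks[OF assms(1)]) (simp add: cong_dvd_iff)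
  moreover have "(\<Sum>a=0..<e. of_bool (e dvd a)) = (\<Sum>a\<in>{0::int}. 1 :: real)"
    by (rule sum.mono_neutral_cong_right) (use assms zdvd_not_zless in force)+
  ultimately show ?thesis using m m0 assms by simp
qed

lemma mean4_dvd4:
  assumes "e1 > 0" "e2 > 0" "e3 > 0" "e4 > 0" "q > 0" "e1 dvd q" "e2 dvd q" "e3 dvd q" "e4 dvd q"
  shows "mean4 q (dvd4 e1 e2 e3 e4) = 1 / of_int (e1 * e2 * e3 * e4)"
proof -
  have "sum4 {0..<q} {0..<q} {0..<q} {0..<q} (dvd4 e1 e2 e3 e4) =
     (of_int q / of_int e1) * ((of_int q / of_int e2) * ((of_int q / of_int e3) * (of_int q / of_int e4)))"
    unfolding dvd4_def sum4_prod using assms by (simp only: sum_of_bool_dvd_residues)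
  then show ?thesis using assms by (simp add: mean4_def power4_eq_xxxx)
qed

definition side :: "nat \<Rightarrow> bool \<Rightarrow> int set" where
  "side N \<sigma> = (if \<sigma> then {1..int N} else {- int N..-1})"

lemma side_eq: "side N \<sigma> = {(if \<sigma> then 1 else - int N)..<(if \<sigma> then 1 else - int N) + int N}"
  by (auto simp: side_def)

lemma finite_side [simp]: "finite (side N \<sigma>)"
  by (simp add: side_def)

lemma card_side [simp]: "card (side N \<sigma>) = N"
  by (simp add: side_def)

lemma sideD: "a \<in> side N \<sigma> \<Longrightarrow> a \<noteq> 0 \<and> \<bar>a\<bar> \<le> int N"
  by (auto simp: side_def split: if_splits)

text \<open>\<open>side\<close> omits 0, so there is no rounding term: for e > N the sum is 0. This
  makes the bound usable for prime powers larger than the box, where periodicity would be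
  useless.\<close>

lemma sum_of_bool_dvd_side:
  assumes "e > 0"
  shows "(\<Sum>a\<in>side N \<sigma>. of_bool (e dvd a)) \<le> (real N / of_int e :: real)"
proof -
  let ?S = "{a \<in> side N \<sigma>. e dvd a}"
  have "(\<Sum>a\<in>side N \<sigma>. of_bool (e dvd a)) = real (card ?S)"
    by (simp add: of_bool_def sum.If_cases Int_def)
  also have "card ?S \<le> card {1..int N div e}"
  proof (rule card_inj_on_le)
    show "inj_on (\<lambda>a. \<bar>a\<bar> div e) ?S"
    proof (rule inj_onI)
      fix a b assume ab: "a \<in> ?S" "b \<in> ?S" "\<bar>a\<bar> div e = \<bar>b\<bar> div e"
      then have "e dvd \<bar>a\<bar>" "e dvd \<bar>b\<bar>" by auto
      then have "\<bar>a\<bar> = \<bar>b\<bar>" using ab(3) by (metis dvd_div_mult_self)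
      then show "a = b" using ab by (auto simp: side_def split: if_splits)
    qed
    show "(\<lambda>a. \<bar>a\<bar> div e) ` ?S \<subseteq> {1..int N div e}"
    proof
      fix y assume "y \<in> (\<lambda>a. \<bar>a\<bar> div e) ` ?S"
      then obtain a where a: "a \<in> ?S" "y = \<bar>a\<bar> div e" by blast
      have "a \<noteq> 0" "\<bar>a\<bar> \<le> int N" "e dvd \<bar>a\<bar>" using a sideD by auto
      then have "e \<le> \<bar>a\<bar>" by (intro zdvd_imp_le) auto
      then have "1 \<le> \<bar>a\<bar> div e" using assms by (simp add: pos_imp_zdiv_pos_iff int_one_le_iff_zero_less)
      moreover have "\<bar>a\<bar> div e \<le> int N div e" using \<open>\<bar>a\<bar> \<le> int N\<close> assms by (rule zdiv_mono1)
      ultimately show "y \<in> {1..int N div e}" using a(2) by simp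
    qed
  qed simp
  also have "card {1..int N div e} = nat (int N div e)" by simp
  also have "real (nat (int N div e)) \<le> real N / of_int e"
  proof -
    have "real (nat (int N div e)) = of_int (int N div e)" using assms by (simp add: pos_imp_zdiv_nonneg_iff)
    also have "\<dots> \<le> of_int (int N) / of_int e" by (rule real_of_int_div4)
    finally show ?thesis by simp
  qed
  finally show ?thesis by simp
qed

lemma sum4_dvd4_side:
  assumes "e1 > 0" "e2 > 0" "e3 > 0" "e4 > 0"
  shows "sum4 (side N s1) (side N s2) (side N s3) (side N s4) (dvd4 e1 e2 e3 e4) \<le> real N ^ 4 / of_int (e1 * e2 * e3 * e4)"
proof -
  have "sum4 (side N s1) (side N s2) (side N s3) (side N s4) (dvd4 e1 e2 e3 e4) \<le>
     (real N / of_int e1) * ((real N / of_int e2) * ((real N / of_int e3) * (real N / of_int e4)))"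
    unfolding dvd4_def sum4_prod using assms
    by (intro mult_mono sum_of_bool_dvd_side mult_nonneg_nonneg sum_nonneg) auto
  then show ?thesis by (simp add: power4_eq_xxxx)
qed
subsection \<open>Bad residue classes and the local densities\<close>

text \<open>The part at \<open>p\<close> of the gcd conditions in \<open>S_tot\<close>. A prime
  congruent to 3 modulo 4 may divide an element of \<open>set_B\<close> once, any other prime not at
  all, whence the exponent in \<open>r\<close>.\<close>

definition gcd_ok :: "nat \<Rightarrow> int \<Rightarrow> int \<Rightarrow> int \<Rightarrow> int \<Rightarrow> bool" where
  "gcd_ok p a b c d \<longleftrightarrow>
     (let r = int p ^ (if [p = 3] (mod 4) then 2 else 1) in
      \<not> (int p dvd a \<and> int p dvd b \<and> int p dvd c \<and> int p dvd d) \<and>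
      \<not> (int p ^ 2 dvd a \<and> int p ^ 2 dvd c) \<and> \<not> (int p ^ 2 dvd b \<and> int p ^ 2 dvd d) \<and>
      \<not> (r dvd a \<and> r dvd b) \<and> \<not> (r dvd c \<and> r dvd d))"

definition good :: "nat \<Rightarrow> int \<Rightarrow> int \<Rightarrow> int \<Rightarrow> int \<Rightarrow> bool" where
  "good p a b c d \<longleftrightarrow> nondegenerate a b c d \<and> gcd_ok p a b c d \<and> soluble_padic p a b c d"

text \<open>
  Working with the classes that contain no good member at all makes the level of a bad point
  canonical and matches the way \<open>local_count\<close> treats residue classes.
\<close>

definition all_bad :: "nat \<Rightarrow> nat \<Rightarrow> int \<Rightarrow> int \<Rightarrow> int \<Rightarrow> int \<Rightarrow> bool" where
  "all_bad p k a b c d \<longleftrightarrow>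
     (\<forall>a' b' c' d'. [a' = a] (mod int p ^ k) \<longrightarrow> [b' = b] (mod int p ^ k) \<longrightarrow>
        [c' = c] (mod int p ^ k) \<longrightarrow> [d' = d] (mod int p ^ k) \<longrightarrow> \<not> good p a' b' c' d')"

lemma cong_power_dvd_iff:
  fixes x y :: int
  assumes "[x = y] (mod int p ^ k)" "i \<le> k"
  shows "int p ^ i dvd x \<longleftrightarrow> int p ^ i dvd y"
  using cong_dvd_iff[OF cong_dvd_modulus[OF assms(1) le_imp_power_dvd[OF assms(2)]]] .

lemma gcd_ok_cong:
  assumes "k \<ge> 2" "[a = a'] (mod int p ^ k)" "[b = b'] (mod int p ^ k)"
    "[c = c'] (mod int p ^ k)" "[d = d'] (mod int p ^ k)"
  shows "gcd_ok p a b c d \<longleftrightarrow> gcd_ok p a' b' c' d'"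
proof -
  have 1: "int p dvd x \<longleftrightarrow> int p dvd y" if "[x = y] (mod int p ^ k)" for x y
    using cong_power_dvd_iff[OF that, of 1] assms(1) by simp
  have 2: "int p ^ i dvd x \<longleftrightarrow> int p ^ i dvd y" if "[x = y] (mod int p ^ k)" "i \<le> 2" for x y i
    using cong_power_dvd_iff[OF that(1), of i] assms(1) that(2) by simp
  have e: "(if [p = 3] (mod 4) then 2 else 1 :: nat) \<le> 2" by simp
  show ?thesis unfolding gcd_ok_def Let_def
    using 1[OF assms(2)] 1[OF assms(3)] 1[OF assms(4)] 1[OF assms(5)]
      2[OF assms(2) order_refl] 2[OF assms(3) order_refl] 2[OF assms(4) order_refl] 2[OF assms(5) order_refl]
      2[OF assms(2) e] 2[OF assms(3) e] 2[OF assms(4) e] 2[OF assms(5) e] by simp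
qed

text \<open>One of [1:0], [0:1], [1:1] makes both forms units. If p divides both ac and bd, then
  each form has exactly one unit coefficient and [1:1] works. A unit is a norm here.\<close>

lemma soluble_padic_of_unit:
  assumes p: "prime p" "[p = 3] (mod 4)" and ab: "\<not> (int p dvd a \<and> int p dvd b)" and cd: "\<not> (int p dvd c \<and> int p dvd d)"
  shows "soluble_padic p a b c d"
proof -
  have pi: "prime (int p)" using p by simp
  have p2: "p \<noteq> 2" using p by (auto simp: cong_def)
  have *: "soluble_padic p a b c d" if "\<not> int p dvd (a * t\<^sup>2 + b * s\<^sup>2) * (c * t\<^sup>2 + d * s\<^sup>2)" for t s
  proof -
    have "locnorm p (int p ^ 0 * ((a * t\<^sup>2 + b * s\<^sup>2) * (c * t\<^sup>2 + d * s\<^sup>2)))"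
      using locnorm_iff[OF p(1) that, of 0] p2 by simp
    then have "intsol p a b c d" unfolding intsol_def by auto
    then show ?thesis using soluble_padic_of_intsol[OF p(1)] p(2) by blast
  qed
  show ?thesis
  proof (cases "int p dvd a * c \<and> int p dvd b * d")
    case True
    then have "\<not> int p dvd (a + b) * (c + d)"
      using ab cd pi by (auto simp: prime_dvd_mult_iff dvd_add_left_iff dvd_add_right_iff)
    then show ?thesis using *[of 1 1] by simp
  next
    case False
    then show ?thesis using *[of 1 0] *[of 0 1] by auto
  qed
qed

lemma bad_dvd:
  assumes p: "prime p" "p \<noteq> 2" and nd: "nondegenerate a b c d" and bad: "\<not> good p a b c d"
  shows "int p dvd a \<and> int p dvd b \<or> int p dvd c \<and> int p dvd d \<or>
    int p ^ 2 dvd a \<and> int p ^ 2 dvd c \<or> int p ^ 2 dvd b \<and> int p ^ 2 dvd d"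
proof (cases "gcd_ok p a b c d")
  case True
  then have ns: "\<not> soluble_padic p a b c d" using nd bad by (simp add: good_def)
  have "odd p" using p prime_odd_nat prime_gt_1_nat[OF p(1)] by (metis One_nat_def Suc_1 Suc_lessI)
  then have "[p = 1] (mod 4) \<or> [p = 3] (mod 4)" unfolding cong_def by simp presburger
  then have "[p = 3] (mod 4)" using ns soluble_padic_1_mod_4[OF p(1)] by blast
  then show ?thesis using ns soluble_padic_of_unit[OF p(1)] by blast
next
  case False
  have "int p dvd x" if "int p ^ (if [p = 3] (mod 4) then 2 else 1) dvd x" for x
    using power_le_dvd[OF that, of 1] by (simp split: if_splits)
  then show ?thesis using False unfolding gcd_ok_def Let_def by meson
qed

text \<open>A good and a bad member in one class: for k >= 2 the gcd conditions agree on the class,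
  so the difference lies in solubility. By \<open>intsol_cong\<close> this needs a coefficient
  divisible by almost the whole modulus, and at odd p insolubility by itself already costs two
  divisibilities.\<close>

lemma bad_cong:
  assumes p: "prime p" and k: "k \<ge> 2" "k \<ge> iso_loss p + class_loss p" and g: "good p a' b' c' d'"
    and nd: "nondegenerate a b c d" and bad: "\<not> good p a b c d"
    and cong: "[a' = a] (mod int p ^ k)" "[b' = b] (mod int p ^ k)" "[c' = c] (mod int p ^ k)" "[d' = d] (mod int p ^ k)"
  defines "r \<equiv> int p ^ (k - (iso_loss p + class_loss p))"
  shows "r dvd a \<or> r dvd b \<or> r dvd c \<or> r dvd d"
    and "p \<noteq> 2 \<Longrightarrow> int p dvd a \<and> int p dvd b \<or> int p dvd c \<and> int p dvd d"
proof -
  have "gcd_ok p a b c d" using gcd_ok_cong[OF k(1) cong] g by (simp add: good_def)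
  then have ns: "\<not> soluble_padic p a b c d" using nd bad by (simp add: good_def)
  have "p = 2 \<or> odd p" using p prime_odd_nat prime_gt_1_nat[OF p] by (metis One_nat_def Suc_1 Suc_lessI)
  then have "p = 2 \<or> [p = 1] (mod 4) \<or> [p = 3] (mod 4)" unfolding cong_def by simp presburger
  then have p3: "p = 2 \<or> [p = 3] (mod 4)" using ns soluble_padic_1_mod_4[OF p] by blast
  show "p \<noteq> 2 \<Longrightarrow> int p dvd a \<and> int p dvd b \<or> int p dvd c \<and> int p dvd d"
    using p3 ns soluble_padic_of_unit[OF p] by blast
  show "r dvd a \<or> r dvd b \<or> r dvd c \<or> r dvd d"
  proof (rule ccontr)
    assume L: "\<not> ?thesis"
    let ?j = "k - (iso_loss p + class_loss p)"
    have jk: "?j + (iso_loss p + class_loss p) = k" "?j \<le> k" using k by auto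
    have nd': "nondegenerate a' b' c' d'" and sol: "soluble_padic p a' b' c' d'" using g by (auto simp: good_def)
    have "intsol p a' b' c' d'" by (rule intsol_of_soluble_padic[OF p p3 nd' sol])
    moreover have "\<not> int p ^ ?j dvd a'" "\<not> int p ^ ?j dvd b'" "\<not> int p ^ ?j dvd c'" "\<not> int p ^ ?j dvd d'"
      using L cong_power_dvd_iff[OF cong(1) jk(2)] cong_power_dvd_iff[OF cong(2) jk(2)]
        cong_power_dvd_iff[OF cong(3) jk(2)] cong_power_dvd_iff[OF cong(4) jk(2)] unfolding r_def by auto
    moreover have "int p ^ (?j + (iso_loss p + class_loss p)) dvd a - a'" "int p ^ (?j + (iso_loss p + class_loss p)) dvd b - b'"
      "int p ^ (?j + (iso_loss p + class_loss p)) dvd c - c'" "int p ^ (?j + (iso_loss p + class_loss p)) dvd d - d'"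
      unfolding jk(1) using cong by (auto simp: cong_iff_dvd_diff dvd_diff_commute)
    moreover have "a * d - b * c \<noteq> 0" using nd by (simp add: nondegenerate_def)
    ultimately have "intsol p a b c d" using intsol_cong[OF p] by blast
    then show False using ns soluble_padic_of_intsol[OF p p3] by blast
  qed
qed

text \<open>Degenerate quadruples are never \<open>good\<close>, for a reason unrelated to p. A
  nondegenerate member of the class makes its badness informative. Positive entries and d' > b' c'
  force a positive determinant.\<close>

lemma ex_nondegenerate_cong:
  assumes q: "q > (0::int)"
  obtains a' b' c' d' where "nondegenerate a' b' c' d'" "[a' = a] (mod q)" "[b' = b] (mod q)"
    "[c' = c] (mod q)" "[d' = d] (mod q)"
proof -
  have pos: "x + q * (\<bar>x\<bar> + 1 + y) > y" if "y \<ge> 0" for x y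
  proof -
    have "1 * (\<bar>x\<bar> + 1 + y) \<le> q * (\<bar>x\<bar> + 1 + y)" using q that by (intro mult_right_mono) auto
    moreover have "y < x + 1 * (\<bar>x\<bar> + 1 + y)" by simp
    ultimately show ?thesis by (meson add_left_mono less_le_trans)
  qed
  define a' b' c' where "a' = a + q * (\<bar>a\<bar> + 1 + 0)" and "b' = b + q * (\<bar>b\<bar> + 1 + 0)" and "c' = c + q * (\<bar>c\<bar> + 1 + 0)"
  have abc: "a' > 0" "b' > 0" "c' > 0" using pos[of 0] unfolding a'_def b'_def c'_def by auto
  define d' where "d' = d + q * (\<bar>d\<bar> + 1 + b' * c')"
  have d': "d' > b' * c'" using pos[of "b' * c'" d] abc unfolding d'_def by simp
  have "b' * c' > 0" using abc by simp
  then have "d' > 0" using d' by linarith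
  then have "1 * d' \<le> a' * d'" using abc by (intro mult_right_mono) auto
  then have "a' * d' - b' * c' \<noteq> 0" using d' by linarith
  then have "nondegenerate a' b' c' d'" using abc \<open>d' > 0\<close> by (simp add: nondegenerate_def)
  then show ?thesis by (rule that) (simp_all add: a'_def b'_def c'_def d'_def cong_iff_dvd_diff)
qed

lemma all_bad_cong:
  assumes "[a = a'] (mod int p ^ k)" "[b = b'] (mod int p ^ k)" "[c = c'] (mod int p ^ k)" "[d = d'] (mod int p ^ k)"
  shows "all_bad p k a b c d \<longleftrightarrow> all_bad p k a' b' c' d'"
  unfolding all_bad_def using assms by (meson cong_sym cong_trans)

lemma all_bad_mono:
  assumes "all_bad p k a b c d" "k \<le> l"
  shows "all_bad p l a b c d"
  using assms(1) cong_dvd_modulus[OF _ le_imp_power_dvd[OF assms(2), of "int p"]] unfolding all_bad_def by meson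

lemma not_all_bad_of_good: "good p a b c d \<Longrightarrow> \<not> all_bad p k a b c d"
  unfolding all_bad_def using cong_refl by blast

text \<open>A point that is good at every prime, so the class modulo p^0 = 1 is never entirely bad.
  This is the zero at which the telescoping over levels starts.\<close>

lemma good_1121: "prime p \<Longrightarrow> good p 1 1 1 2"
proof -
  assume p: "prime p"
  have nd: "\<not> int p dvd 1" using p by auto
  then have "\<not> int p ^ n dvd 1" if "n > 0" for n using that dvd_power[of n "int p"] dvd_trans by blast
  then have "gcd_ok p 1 1 1 2" using nd unfolding gcd_ok_def Let_def by simp
  moreover have "soluble_padic p 1 1 1 2"
  proof -
    have "padic_null p (\<lambda>n. of_int ((1::int)\<^sup>2 + 0\<^sup>2 - (1 * 1\<^sup>2 + 1 * 0\<^sup>2) * (1 * 1\<^sup>2 + 2 * 0\<^sup>2) * 1\<^sup>2))"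
      by (simp add: padic_null_def)
    then show ?thesis by (intro soluble_padicI[OF p, of 1 0 "\<lambda>n. 1" 1 0]) (auto simp: padic_Cauchy_const)
  qed
  ultimately show ?thesis by (simp add: good_def nondegenerate_def)
qed

lemma not_all_bad_0: "prime p \<Longrightarrow> \<not> all_bad p 0 a b c d"
  unfolding all_bad_def by (simp add: cong_def) (blast intro: good_1121)

text \<open>Already for k = 1 two divisibilities can be read off. The squares in
  \<open>bad_dvd\<close> are weakened to p, since a class modulo p shows no more.\<close>

lemma all_bad_dvd:
  assumes p: "prime p" "p \<noteq> 2" and k: "k \<ge> 1" and ab: "all_bad p k a b c d"
  shows "int p dvd a \<and> int p dvd b \<or> int p dvd c \<and> int p dvd d \<or> int p dvd a \<and> int p dvd c \<or> int p dvd b \<and> int p dvd d"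
proof -
  have "int p ^ k > 0" using p by (simp add: prime_gt_0_nat)
  then obtain a' b' c' d' where nd: "nondegenerate a' b' c' d'" and cong: "[a' = a] (mod int p ^ k)"
    "[b' = b] (mod int p ^ k)" "[c' = c] (mod int p ^ k)" "[d' = d] (mod int p ^ k)"
    using ex_nondegenerate_cong by metis
  have "\<not> good p a' b' c' d'" using ab cong unfolding all_bad_def by blast
  note D = bad_dvd[OF p nd this]
  have 2: "int p ^ 2 dvd x \<Longrightarrow> int p dvd x" for x using power_le_dvd[of "int p" 2 x 1] by simp
  have 1: "int p dvd x \<longleftrightarrow> int p dvd y" if "[x = y] (mod int p ^ k)" for x y
    using cong_power_dvd_iff[OF that, of 1] k by simp
  show ?thesis using D 2 1[OF cong(1)] 1[OF cong(2)] 1[OF cong(3)] 1[OF cong(4)] by blast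
qed

text \<open>A nondegenerate member modulo \<open>int p ^ Suc k\<close> is bad, but shares its class
  modulo \<open>int p ^ k\<close> with a good point, so \<open>bad_cong\<close> applies. Its
  divisibilities involve powers up to k only and descend to the class.\<close>

lemma all_bad_step_dvd:
  assumes p: "prime p" and k: "k \<ge> 2" "k \<ge> iso_loss p + class_loss p"
    and ab: "all_bad p (Suc k) a b c d" and nab: "\<not> all_bad p k a b c d"
  defines "r \<equiv> int p ^ (k - (iso_loss p + class_loss p))"
  shows "r dvd a \<or> r dvd b \<or> r dvd c \<or> r dvd d"
    and "p \<noteq> 2 \<Longrightarrow> int p dvd a \<and> int p dvd b \<or> int p dvd c \<and> int p dvd d"
proof -
  have "int p ^ Suc k > 0" using p by (simp add: prime_gt_0_nat)
  then obtain a' b' c' d' where nd: "nondegenerate a' b' c' d'" and cong: "[a' = a] (mod int p ^ Suc k)"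
    "[b' = b] (mod int p ^ Suc k)" "[c' = c] (mod int p ^ Suc k)" "[d' = d] (mod int p ^ Suc k)"
    using ex_nondegenerate_cong by metis
  have bad: "\<not> good p a' b' c' d'" using ab cong unfolding all_bad_def by blast
  have cong': "[a' = a] (mod int p ^ k)" "[b' = b] (mod int p ^ k)" "[c' = c] (mod int p ^ k)" "[d' = d] (mod int p ^ k)"
    using cong by (auto intro: cong_dvd_modulus[OF _ le_imp_power_dvd] simp del: power_Suc)
  obtain a1 b1 c1 d1 where g: "good p a1 b1 c1 d1" and cg: "[a1 = a] (mod int p ^ k)"
    "[b1 = b] (mod int p ^ k)" "[c1 = c] (mod int p ^ k)" "[d1 = d] (mod int p ^ k)"
    using nab unfolding all_bad_def by blast
  have cg': "[a1 = a'] (mod int p ^ k)" "[b1 = b'] (mod int p ^ k)" "[c1 = c'] (mod int p ^ k)" "[d1 = d'] (mod int p ^ k)"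
    using cg cong' cong_sym cong_trans by blast+
  note B = bad_cong[OF p k g nd bad cg']
  have D: "int p ^ i dvd x \<longleftrightarrow> int p ^ i dvd y" if "[x = y] (mod int p ^ k)" "i \<le> k" for x y i
    using cong_power_dvd_iff[OF that] .
  have "k - (iso_loss p + class_loss p) \<le> k" by simp
  then show "r dvd a \<or> r dvd b \<or> r dvd c \<or> r dvd d"
    using B(1) D[OF cong'(1)] D[OF cong'(2)] D[OF cong'(3)] D[OF cong'(4)] unfolding r_def by blast
  have 1: "int p dvd x \<longleftrightarrow> int p dvd y" if "[x = y] (mod int p ^ k)" for x y
    using cong_power_dvd_iff[OF that, of 1] k by simp
  assume "p \<noteq> 2"
  then show "int p dvd a \<and> int p dvd b \<or> int p dvd c \<and> int p dvd d"
    using B(2) 1[OF cong'(1)] 1[OF cong'(2)] 1[OF cong'(3)] 1[OF cong'(4)] by blast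
qed

section \<open>Densities of the levels of badness\<close>

definition bad_ind :: "nat \<Rightarrow> nat \<Rightarrow> int \<Rightarrow> int \<Rightarrow> int \<Rightarrow> int \<Rightarrow> real" where
  "bad_ind p k a b c d = of_bool (all_bad p k a b c d)"

definition new_ind :: "nat \<Rightarrow> nat \<Rightarrow> int \<Rightarrow> int \<Rightarrow> int \<Rightarrow> int \<Rightarrow> real" where
  "new_ind p k a b c d = bad_ind p k a b c d - bad_ind p (k - 1) a b c d"

definition new_density :: "nat \<Rightarrow> nat \<Rightarrow> real" where
  "new_density p k = mean4 (int p ^ k) (new_ind p k)"

lemma new_ind_of_bool: "new_ind p k a b c d = of_bool (all_bad p k a b c d \<and> \<not> all_bad p (k - 1) a b c d)"
  unfolding new_ind_def bad_ind_def using all_bad_mono[of p "k - 1" a b c d k] by auto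

lemma new_ind_nonneg: "new_ind p k a b c d \<ge> 0"
  by (simp add: new_ind_of_bool)

lemma periodic_bad_ind: "periodic4 (int p ^ k) (bad_ind p k)"
  unfolding periodic4_def bad_ind_def
  by (intro allI impI arg_cong[of _ _ of_bool]) (rule all_bad_cong, assumption+)

lemma periodic4_diff: "periodic4 q h \<Longrightarrow> periodic4 q k \<Longrightarrow> periodic4 q (\<lambda>a b c d. h a b c d - k a b c d)"
  unfolding periodic4_def by (intro allI impI arg_cong2[of _ _ _ _ "(-)"]) blast+

lemma periodic_new_ind: "periodic4 (int p ^ k) (new_ind p k)"
proof -
  have "int p ^ (k - 1) dvd int p ^ k" by (intro le_imp_power_dvd) simp
  then have "periodic4 (int p ^ k) (bad_ind p (k - 1))" using periodic_bad_ind periodic4_dvd by blast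
  then show ?thesis unfolding new_ind_def[abs_def] by (rule periodic4_diff[OF periodic_bad_ind])
qed

lemma sum_new_ind: "prime p \<Longrightarrow> (\<Sum>k=1..K. new_ind p k a b c d) = bad_ind p K a b c d"
proof (induction K)
  case 0
  then show ?case using not_all_bad_0 by (simp add: bad_ind_def)
next
  case (Suc K)
  then show ?case by (simp add: new_ind_def)
qed

lemma new_density_nonneg: "prime p \<Longrightarrow> new_density p k \<ge> 0"
  unfolding new_density_def by (intro mean4_nonneg new_ind_nonneg) (simp add: prime_gt_0_nat)

lemma mean_bad_ind:
  assumes p: "prime p"
  shows "mean4 (int p ^ K) (bad_ind p K) = (\<Sum>k=1..K. new_density p k)"
proof -
  have p0: "int p > 0" using p by (simp add: prime_gt_0_nat)
  have "mean4 (int p ^ K) (bad_ind p K) = mean4 (int p ^ K) (\<lambda>a b c d. \<Sum>k=1..K. new_ind p k a b c d)"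
    by (simp only: sum_new_ind[OF p])
  also have "\<dots> = (\<Sum>k=1..K. mean4 (int p ^ K) (new_ind p k))" 
    unfolding mean4_def sum4_sum sum_divide_distrib ..
  also have "\<dots> = (\<Sum>k=1..K. new_density p k)"
  proof (intro sum.cong refl)
    fix k assume "k \<in> {1..K}"
    then have "int p ^ K = int p ^ k * int p ^ (K - k)" by (simp flip: power_add)
    then show "mean4 (int p ^ K) (new_ind p k) = new_density p k"
      using mean4_multiple[OF _ _ periodic_new_ind, of p k "int p ^ (K - k)"] p0 by (simp add: new_density_def)
  qed
  finally show ?thesis .
qed

lemma mean4_mono: 
  assumes "q > 0" "\<And>a b c d. h a b c d \<le> k a b c d"
  shows "mean4 q h \<le> mean4 q k"
  unfolding mean4_def using assms by (intro divide_right_mono sum4_mono) auto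

lemma mean4_add: "mean4 q (\<lambda>a b c d. h a b c d + k a b c d) = mean4 q h + mean4 q k"
  by (simp add: mean4_def sum4_add add_divide_distrib)

lemma mean4_bad_ind_le_1:
  assumes "prime p" shows "mean4 (int p ^ K) (bad_ind p K) \<le> 1"
proof -
  have p0: "int p ^ K > 0" using assms by (simp add: prime_gt_0_nat)
  have "mean4 (int p ^ K) (bad_ind p K) \<le> mean4 (int p ^ K) (dvd4 1 1 1 1)"
    by (rule mean4_mono[OF p0]) (simp add: bad_ind_def dvd4_def)
  also have "\<dots> = 1" using mean4_dvd4[of 1 1 1 1 "int p ^ K"] p0 by simp
  finally show ?thesis .
qed

lemma new_density_le_1:
  assumes "prime p" shows "new_density p k \<le> 1"
proof -
  have "int p ^ k > 0" using assms by (simp add: prime_gt_0_nat)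
  then have "new_density p k \<le> mean4 (int p ^ k) (bad_ind p k)"
    unfolding new_density_def by (rule mean4_mono) (simp add: new_ind_of_bool bad_ind_def)
  then show ?thesis using mean4_bad_ind_le_1[OF assms, of k] by simp
qed

lemma new_density_bound:
  assumes p: "prime p" and k: "k \<ge> 1"
  shows "new_density p k \<le> 64 * (1 / real p) ^ max k 2"
proof -
  have p0: "int p > 0" and p1: "real p > 0" using p by (auto simp: prime_gt_0_nat)
  have q0: "int p ^ k > 0" using p0 by simp
  have pk: "int p dvd int p ^ k" "int p ^ i dvd int p ^ k" if "i \<le> k" for i
    using k that by (auto intro: le_imp_power_dvd dvd_power)
  have le: "of_bool P \<le> (x::real)" if "P \<Longrightarrow> x \<ge> 1" "x \<ge> 0" for P x using that by auto
  consider "p = 2" "k \<le> 5" | "p = 2" "k \<ge> 6" | "p \<noteq> 2" "k \<le> 2" | "p \<noteq> 2" "k \<ge> 3" by linarith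
  then show ?thesis
  proof cases
    case 1
    \<comment> \<open>For small levels at 2 the trivial bound 1 is enough, since 64 / 2^5 =
      2.\<close>
    have "(1 / 2 :: real) ^ 5 \<le> (1 / 2) ^ max k 2" using 1 by (intro power_decreasing) auto
    then have "1 \<le> 64 * (1 / real p) ^ max k 2" using 1 by (simp add: power_divide)
    then show ?thesis using new_density_le_1[OF p, of k] by linarith
  next
    case 2
    \<comment> \<open>One digit is lost in passing from level k to k - 1 and three more to
      \<open>iso_loss\<close> and \<open>class_loss\<close> at 2. Four coefficients times 2^(-(k -
      4)) explains the constant 64.\<close>
    define j where "j = k - 4"
    let ?r = "(2::int) ^ j"
    have jk: "int 2 ^ j dvd int 2 ^ k" by (intro le_imp_power_dvd) (simp add: j_def)
    have "new_density p k \<le> mean4 (int p ^ k) (\<lambda>a b c d. dvd4 ?r 1 1 1 a b c d + (dvd4 1 ?r 1 1 a b c d + (dvd4 1 1 ?r 1 a b c d + dvd4 1 1 1 ?r a b c d)))"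
      unfolding new_density_def
    proof (rule mean4_mono[OF q0], unfold new_ind_of_bool, rule le)
      fix a b c d
      assume *: "all_bad p k a b c d \<and> \<not> all_bad p (k - 1) a b c d"
      have "Suc (k - 1) = k" using 2 by simp
      then have "?r dvd a \<or> ?r dvd b \<or> ?r dvd c \<or> ?r dvd d"
        using all_bad_step_dvd(1)[OF p, of "k - 1" a b c d] * 2 by (simp add: j_def iso_loss_def class_loss_def)
      then show "1 \<le> dvd4 ?r 1 1 1 a b c d + (dvd4 1 ?r 1 1 a b c d + (dvd4 1 1 ?r 1 a b c d + dvd4 1 1 1 ?r a b c d))"
        by (auto simp: dvd4_def)
    qed (simp add: dvd4_nonneg)
    also have "\<dots> = 4 / 2 ^ j" unfolding mean4_add using 2 jk by (simp add: mean4_dvd4)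
    also have "\<dots> = 64 * (1 / real p) ^ max k 2"
    proof -
      have "k = j + 4" using 2 by (simp add: j_def)
      then have "(2::real) ^ k = 2 ^ j * 2 ^ 4" by (simp only: power_add)
      then show ?thesis using 2 by (simp add: power_divide max_def)
    qed
    finally show ?thesis .
  next
    case 3
    let ?p = "int p"
    have "new_density p k \<le> mean4 (int p ^ k) (\<lambda>a b c d. dvd4 ?p ?p 1 1 a b c d + (dvd4 1 1 ?p ?p a b c d + (dvd4 ?p 1 ?p 1 a b c d + dvd4 1 ?p 1 ?p a b c d)))"
      unfolding new_density_def
    proof (rule mean4_mono[OF q0], unfold new_ind_of_bool, rule le)
      fix a b c d
      assume "all_bad p k a b c d \<and> \<not> all_bad p (k - 1) a b c d"
      then have "int p dvd a \<and> int p dvd b \<or> int p dvd c \<and> int p dvd d \<or> int p dvd a \<and> int p dvd c \<or> int p dvd b \<and> int p dvd d"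
        using all_bad_dvd[OF p 3(1) k] by blast
      then show "1 \<le> dvd4 ?p ?p 1 1 a b c d + (dvd4 1 1 ?p ?p a b c d + (dvd4 ?p 1 ?p 1 a b c d + dvd4 1 ?p 1 ?p a b c d))"
        by (auto simp: dvd4_def)
    qed (simp add: dvd4_nonneg)
    also have "\<dots> = 4 * (1 / real p) ^ 2" unfolding mean4_add using p0 q0 pk(1)[of 0] by (simp add: mean4_dvd4 power2_eq_square)
    also have "\<dots> \<le> 64 * (1 / real p) ^ max k 2" using 3 by (simp add: max_def)
    finally show ?thesis .
  next
    case 4
    let ?p = "int p" and ?r = "int p ^ (k - 1)"
    have r: "?r > 0" "?r dvd int p ^ k" using p0 by (auto intro: le_imp_power_dvd)
    have pr: "?p dvd ?r" using 4 by (intro dvd_power) auto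
    \<comment> \<open>Eight cases: the pair divisible by p, and the coefficient divisible by p^(k -
      1). If that coefficient belongs to the pair, its partner supplies the remaining factor p; if
      not, one member of the pair does. Each case has density p^(-k).\<close>
    let ?h = "\<lambda>a b c d. dvd4 ?r ?p 1 1 a b c d + (dvd4 ?p ?r 1 1 a b c d + (dvd4 ?p 1 ?r 1 a b c d + (dvd4 ?p 1 1 ?r a b c d + 
      (dvd4 ?r 1 ?p 1 a b c d + (dvd4 1 ?r ?p 1 a b c d + (dvd4 1 1 ?r ?p a b c d + dvd4 1 1 ?p ?r a b c d))))))"
    have "new_density p k \<le> mean4 (int p ^ k) ?h"
      unfolding new_density_def
    proof (rule mean4_mono[OF q0], unfold new_ind_of_bool, rule le)
      fix a b c d
      assume *: "all_bad p k a b c d \<and> \<not> all_bad p (k - 1) a b c d"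
      have "Suc (k - 1) = k" using 4 by simp
      then have "?r dvd a \<or> ?r dvd b \<or> ?r dvd c \<or> ?r dvd d" "?p dvd a \<and> ?p dvd b \<or> ?p dvd c \<and> ?p dvd d"
        using all_bad_step_dvd[OF p, of "k - 1" a b c d] * 4 by (simp_all add: iso_loss_def class_loss_def)
      then show "1 \<le> ?h a b c d" by (auto simp: dvd4_def)
    qed (simp add: dvd4_nonneg)
    also have "\<dots> = 8 / (real p ^ (k - 1) * real p)" unfolding mean4_add using p0 q0 r pk(1)[of 0] by (simp add: mean4_dvd4 mult.commute)
    also have "real p ^ (k - 1) * real p = real p ^ k" using 4 by (metis One_nat_def Suc_pred k less_eq_Suc_le power_Suc2)
    also have "8 / real p ^ k \<le> 64 * (1 / real p) ^ max k 2" using 4 p1 by (simp add: max_def power_divide divide_right_mono)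
    finally show ?thesis .
  qed
qed

section \<open>Comparison with the local counts\<close>

lemma val_le_iff:
  assumes p: "prime p"
  shows "val p a \<le> enat n \<longleftrightarrow> \<not> int p ^ Suc n dvd a"
proof (cases "a = 0")
  case False
  have "\<not> is_unit (int p)" using p by auto
  then have "int p ^ Suc n dvd a \<longleftrightarrow> Suc n \<le> multiplicity (int p) a"
    using False by (intro power_dvd_iff_le_multiplicity) auto
  then show ?thesis using False by (auto simp: val_def)
qed (simp add: val_def)

text \<open>From k = 2 on the gcd conditions depend only on the residue class. Together with
  \<open>residue_soluble\<close> they then say exactly that the class contains a good point.\<close>

lemma local_count_eq:
  assumes p: "prime p" and k: "k \<ge> 2"
  shows "real (local_count p k) / real p ^ (4 * k) = 1 - mean4 (int p ^ k) (bad_ind p k)"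
proof -
  let ?q = "int p ^ k"
  let ?Q = "{0..<?q}"
  have q0: "?q > 0" using p by (simp add: prime_gt_0_nat)
  have v: "min (val p x) (val p y) \<le> enat n \<longleftrightarrow> \<not> (int p ^ Suc n dvd x \<and> int p ^ Suc n dvd y)" for x y n
    using val_le_iff[OF p] by (auto simp: min_le_iff_disj)
  have del: "delta p = enat (if [p = 3] (mod 4) then 1 else 0)" by (simp add: delta_def one_enat_def zero_enat_def)
  have gc: "(\<not> (int p dvd a \<and> int p dvd b \<and> int p dvd c \<and> int p dvd d) \<and>
        min (val p a) (val p c) \<le> 1 \<and> min (val p b) (val p d) \<le> 1 \<and>
        min (val p a) (val p b) \<le> delta p \<and> min (val p c) (val p d) \<le> delta p) \<longleftrightarrow> gcd_ok p a b c d" for a b c d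
    unfolding del one_enat_def v gcd_ok_def Let_def by (simp add: numeral_2_eq_2)
  have rs: "gcd_ok p a b c d \<and> residue_soluble p k a b c d \<longleftrightarrow> \<not> all_bad p k a b c d" for a b c d
  proof
    assume "gcd_ok p a b c d \<and> residue_soluble p k a b c d"
    then obtain a' b' c' d' where *: "[a' = a] (mod int p ^ k)" "[b' = b] (mod int p ^ k)"
      "[c' = c] (mod int p ^ k)" "[d' = d] (mod int p ^ k)"
      and "gcd_ok p a b c d" "nondegenerate a' b' c' d'" "soluble_padic p a' b' c' d'"
      unfolding residue_soluble_def by blast
    then have "good p a' b' c' d'" using gcd_ok_cong[OF k *] by (simp add: good_def)
    then show "\<not> all_bad p k a b c d" using * unfolding all_bad_def by blast
  next
    assume "\<not> all_bad p k a b c d"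
    then obtain a' b' c' d' where *: "[a' = a] (mod int p ^ k)" "[b' = b] (mod int p ^ k)"
      "[c' = c] (mod int p ^ k)" "[d' = d] (mod int p ^ k)" and g: "good p a' b' c' d'"
      unfolding all_bad_def by blast
    then have "gcd_ok p a b c d" using gcd_ok_cong[OF k *] by (simp add: good_def)
    moreover have "residue_soluble p k a b c d" using * g unfolding residue_soluble_def good_def by blast
    ultimately show "gcd_ok p a b c d \<and> residue_soluble p k a b c d" by blast
  qed
  have P: "({a, b, c, d} \<subseteq> {0..<int p ^ k} \<and>
        \<not> (int p dvd a \<and> int p dvd b \<and> int p dvd c \<and> int p dvd d) \<and>
        residue_soluble p k a b c d \<and>
        min (val p a) (val p c) \<le> 1 \<and> min (val p b) (val p d) \<le> 1 \<and>
        min (val p a) (val p b) \<le> delta p \<and> min (val p c) (val p d) \<le> delta p) \<longleftrightarrow>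
     (a \<in> ?Q \<and> b \<in> ?Q \<and> c \<in> ?Q \<and> d \<in> ?Q \<and> \<not> all_bad p k a b c d)" for a b c d
    using gc[of a b c d] rs[of a b c d] unfolding insert_subset by blast
  have "local_count p k = card {(a, b, c, d). a \<in> ?Q \<and> b \<in> ?Q \<and> c \<in> ?Q \<and> d \<in> ?Q \<and> \<not> all_bad p k a b c d}"
    unfolding local_count_def P ..
  then have "real (local_count p k) = sum4 ?Q ?Q ?Q ?Q (\<lambda>a b c d. of_bool (\<not> all_bad p k a b c d))"
    by (subst sum4_of_bool_eq_card) auto
  also have "\<dots> = sum4 ?Q ?Q ?Q ?Q (\<lambda>a b c d. dvd4 1 1 1 1 a b c d - bad_ind p k a b c d)"
    by (rule sum4_cong) (simp add: dvd4_def bad_ind_def)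
  also have "\<dots> / of_int ?q ^ 4 = mean4 ?q (dvd4 1 1 1 1) - mean4 ?q (bad_ind p k)"
    by (simp add: sum4_diff mean4_def diff_divide_distrib)
  also have "mean4 ?q (dvd4 1 1 1 1) = 1" using mean4_dvd4[of 1 1 1 1 ?q] q0 by simp
  finally show ?thesis by (simp add: power_mult[symmetric] mult.commute)
qed

text \<open>\<open>lim\<close> has the intended meaning only for convergent sequences. Convergence
  holds because the density of entirely bad classes increases with the modulus and is at most
  1.\<close>

lemma tau_prime_limit:
  assumes p: "prime p"
  shows "(\<lambda>K. 1 - (\<Sum>k=1..K. new_density p k)) \<longlonglongrightarrow> tau_prime p"
proof -
  let ?A = "\<lambda>K. \<Sum>k=1..K. new_density p k"
  have "incseq ?A" by (intro incseq_SucI) (simp add: new_density_nonneg[OF p])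
  moreover have "?A K \<le> 1" for K using mean4_bad_ind_le_1[OF p, of K] mean_bad_ind[OF p, of K] by simp
  ultimately obtain L where "?A \<longlonglongrightarrow> L" using incseq_convergent by metis
  then have L: "(\<lambda>K. 1 - ?A K) \<longlonglongrightarrow> 1 - L" by (intro tendsto_intros)
  have "(\<lambda>k. real (local_count p k) / real p ^ (4 * k)) \<longlonglongrightarrow> 1 - L"
  proof (rule Lim_transform_eventually[OF L])
    show "eventually (\<lambda>K. 1 - ?A K = real (local_count p K) / real p ^ (4 * K)) sequentially"
      using eventually_ge_at_top[of 2] by eventually_elim (simp add: local_count_eq[OF p] mean_bad_ind[OF p])
  qed
  then have "tau_prime p = 1 - L" unfolding tau_prime_def by (rule limI)
  then show ?thesis using L by simp
qed
subsection \<open>The Euler product and the expansion over moduli\<close>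

text \<open>The exponent is that of the worst level: p^(2/3) p^(-2) = p^(-4/3), summable over p. The
  constant is 96 times 3, where 96 (2/3) = 64 matches \<open>new_density_bound\<close> at k = 2 and
  3 is the sum of the geometric series with ratio 2/3.\<close>

definition prime_weight :: "nat \<Rightarrow> real" where "prime_weight p = 288 * real p powr (- (4 / 3))"

lemma prime_weight_nonneg: "prime_weight p \<ge> 0"
  by (simp add: prime_weight_def)

lemma summable_prime_weight: "summable prime_weight"
  unfolding prime_weight_def by (intro summable_mult) (simp add: summable_real_powr_iff)

definition total_weight :: real where "total_weight = suminf prime_weight"

lemma sum_prime_weight_le: "finite S \<Longrightarrow> sum prime_weight S \<le> total_weight"
  unfolding total_weight_def by (rule sum_le_suminf[OF summable_prime_weight]) (auto simp: prime_weight_nonneg)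

lemma total_weight_nonneg: "total_weight \<ge> 0"
  using sum_prime_weight_le[of "{}"] by simp

text \<open>The Rankin weight of one prime. With an exponent s in place of 1/3, level 2 contributes
  p^(2s - 2), so any s below 1/2 keeps the sum over primes convergent.\<close>

lemma sum_new_density_weighted_le:
  assumes p: "prime p"
  shows "(\<Sum>k=1..K. (real p ^ k) powr (1 / 3) * new_density p k) \<le> prime_weight p"
proof -
  have p1: "real p > 0" "real p \<ge> 2" using prime_ge_2_nat[OF p] by auto
  define x where "x = real p powr (- (2 / 3))"
  have x0: "x \<ge> 0" by (simp add: x_def)
  have x: "x \<le> 2 / 3"
  proof -
    have "x \<le> 2 powr (- (2 / 3))" unfolding x_def using p1 by (intro powr_mono2') auto
    also have "\<dots> \<le> 2 / 3"
    proof (rule ccontr)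
      assume "\<not> ?thesis"
      \<comment> \<open>Cubing removes the fractional exponent: 8/27 < 1/4 is false.\<close>
      then have "(2 / 3) ^ 3 < ((2::real) powr (- (2 / 3))) ^ 3" by (intro power_strict_mono) auto
      also have "((2::real) powr (- (2 / 3))) ^ 3 = 2 powr (- 2)" by (simp add: powr_power)
      also have "\<dots> = 1 / 4" by (simp add: powr_minus powr_numeral)
      finally show False by (simp add: power3_eq_cube)
    qed
    finally show ?thesis .
  qed
  have bound: "(real p ^ k) powr (1 / 3) * new_density p k \<le> 96 * real p powr (- (4 / 3)) * (2 / 3) ^ (k - 1)" if k: "k \<ge> 1" for k
  proof -
    have pk: "(real p ^ k) powr (1 / 3) = real p powr (real k / 3)"
      using p1 by (simp add: powr_realpow[symmetric] powr_powr)
    have mk: "(1 / real p) ^ m = real p powr (- real m)" for m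
      using p1 by (simp add: powr_minus powr_realpow power_one_over inverse_eq_divide)
    have "(real p ^ k) powr (1 / 3) * new_density p k \<le> real p powr (real k / 3) * (64 * (1 / real p) ^ max k 2)"
      unfolding pk by (intro mult_left_mono new_density_bound[OF p k]) simp
    also have "\<dots> = 64 * real p powr (real k / 3 - real (max k 2))"
    proof -
      have "real p powr (real k / 3) * real p powr (- real (max k 2)) = real p powr (real k / 3 - real (max k 2))"
        by (simp flip: powr_add)
      then show ?thesis by (simp only: mk mult.left_commute[of _ 64])
    qed
    also have "\<dots> \<le> 96 * real p powr (- (4 / 3)) * (2 / 3) ^ (k - 1)"
    proof (cases "k = 1")
      case True
      have "real p powr (real k / 3 - real (max k 2)) \<le> real p powr (- (4 / 3))"
        using p1 True by (intro powr_mono) auto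
      moreover have "real p powr (- (4 / 3)) \<ge> 0" by simp
      ultimately have "64 * real p powr (real k / 3 - real (max k 2)) \<le> 96 * real p powr (- (4 / 3))" by linarith
      then show ?thesis using True by simp
    next
      case False
      then have k2: "k \<ge> 2" using k by simp
      define j where "j = k - 2"
      have kj: "k = j + 2" using k2 by (simp add: j_def)
      have "real k / 3 - real (max k 2) = - (4 / 3) + real j * (- (2 / 3))" unfolding kj by (simp add: field_simps)
      moreover have "x ^ j = real p powr (real j * (- (2 / 3)))" unfolding x_def by (rule powr_power) (use p1 in simp)
      ultimately have "real p powr (real k / 3 - real (max k 2)) = real p powr (- (4 / 3)) * x ^ j"
        by (simp only: powr_add)
      also have "\<dots> \<le> real p powr (- (4 / 3)) * (2 / 3) ^ j"
        using x x0 by (intro mult_left_mono power_mono) auto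
      finally have "real p powr (real k / 3 - real (max k 2)) \<le> real p powr (- (4 / 3)) * (2 / 3) ^ j" .
      moreover have "k - 1 = Suc j" using kj by simp
      then have "96 * real p powr (- (4 / 3)) * (2 / 3) ^ (k - 1) = 64 * (real p powr (- (4 / 3)) * (2 / 3) ^ j)" by simp
      ultimately show ?thesis by linarith
    qed
    finally show ?thesis .
  qed
  have geo: "(\<Sum>k=1..K. (2 / 3 :: real) ^ (k - 1)) \<le> 3"
  proof -
    have "(\<Sum>k=1..K. (2 / 3 :: real) ^ (k - 1)) = (\<Sum>k<K. (2 / 3) ^ k)"
      by (rule sum.reindex_bij_witness[of _ Suc "\<lambda>k. k - 1"]) auto
    also have "\<dots> = (1 - (2 / 3) ^ K) / (1 - 2 / 3)" by (simp add: sum_gp_strict)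
    also have "\<dots> \<le> 3" by simp
    finally show ?thesis .
  qed
  have "(\<Sum>k=1..K. (real p ^ k) powr (1 / 3) * new_density p k) \<le> (\<Sum>k=1..K. 96 * real p powr (- (4 / 3)) * (2 / 3) ^ (k - 1))"
    by (intro sum_mono bound) simp
  also have "\<dots> = 96 * real p powr (- (4 / 3)) * (\<Sum>k=1..K. (2 / 3) ^ (k - 1))" by (simp only: sum_distrib_left)
  also have "\<dots> \<le> 96 * real p powr (- (4 / 3)) * 3" by (intro mult_left_mono geo) simp
  finally show ?thesis by (simp add: prime_weight_def)
qed

section \<open>Truncation at prime powers up to R and the Euler product\<close>

definition bad_density :: "nat \<Rightarrow> nat \<Rightarrow> real" where
  "bad_density p K = (\<Sum>k=1..K. new_density p k)"

lemma bad_density_bounds: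
  assumes "prime p" shows "0 \<le> bad_density p K" "bad_density p K \<le> 1"
  using mean4_bad_ind_le_1[OF assms, of K] mean_bad_ind[OF assms, of K]
  by (auto simp: bad_density_def intro: sum_nonneg new_density_nonneg[OF assms])

lemma bad_density_le_weight:
  assumes p: "prime p" shows "bad_density p K \<le> prime_weight p"
proof -
  have "new_density p k \<le> (real p ^ k) powr (1 / 3) * new_density p k" for k
  proof -
    have "real p ^ k \<ge> 1" using prime_ge_1_nat[OF p] by (simp add: one_le_power)
    then have "(real p ^ k) powr (1 / 3) \<ge> 1" by (simp add: ge_one_powr_ge_zero)
    then show ?thesis using new_density_nonneg[OF p, of k] by (simp add: mult_le_cancel_right1)
  qed
  then have "bad_density p K \<le> (\<Sum>k=1..K. (real p ^ k) powr (1 / 3) * new_density p k)"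
    unfolding bad_density_def by (intro sum_mono)
  then show ?thesis using sum_new_density_weighted_le[OF p, of K] by linarith
qed

definition max_exp :: "real \<Rightarrow> nat \<Rightarrow> nat" where
  "max_exp R p = (LEAST k. R < real p ^ Suc k)"

lemma max_exp:
  assumes p: "prime p" and R: "R \<ge> 1"
  shows "real p ^ max_exp R p \<le> R" "R < real p ^ Suc (max_exp R p)"
proof -
  have "real p > 1" using prime_gt_1_nat[OF p] by simp
  then obtain n where "R < real p ^ n" using real_arch_pow by blast
  moreover have "real p ^ n \<le> real p ^ Suc n" using \<open>real p > 1\<close> by (intro power_increasing) auto
  ultimately have ex: "R < real p ^ Suc n" by linarith
  then show "R < real p ^ Suc (max_exp R p)" unfolding max_exp_def by (rule LeastI)
  show "real p ^ max_exp R p \<le> R"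
  proof (cases "max_exp R p")
    case (Suc j)
    then have "\<not> R < real p ^ Suc j" unfolding max_exp_def using not_less_Least by (metis lessI)
    then show ?thesis using Suc by simp
  qed (use R in simp)
qed

lemma max_exp_eq_0: "R < real p \<Longrightarrow> max_exp R p = 0"
  unfolding max_exp_def by (rule Least_eq_0) simp

text \<open>The omitted levels have p^k > R, so their weights (p^k)^(1/3) exceed R^(1/3), and the
  weighted sum bounds them.\<close>

lemma bad_density_truncation:
  assumes p: "prime p" and R: "R \<ge> 1" and K: "K \<ge> max_exp R p"
  shows "\<bar>bad_density p K - bad_density p (max_exp R p)\<bar> \<le> R powr (- (1 / 3)) * prime_weight p"
proof -
  let ?K = "max_exp R p"
  have nn: "new_density p k \<ge> 0" for k by (rule new_density_nonneg[OF p])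
  have "{1..K} = {1..?K} \<union> {?K + 1..K}" using K by auto
  then have "bad_density p K = bad_density p ?K + (\<Sum>k=?K + 1..K. new_density p k)"
    unfolding bad_density_def by (simp only:) (rule sum.union_disjoint, auto)
  then have "\<bar>bad_density p K - bad_density p ?K\<bar> = (\<Sum>k=?K + 1..K. new_density p k)"
    using sum_nonneg[of "{?K + 1..K}" "new_density p"] nn by simp
  also have "\<dots> \<le> (\<Sum>k=?K + 1..K. R powr (- (1 / 3)) * ((real p ^ k) powr (1 / 3) * new_density p k))"
  proof (rule sum_mono)
    fix k assume k: "k \<in> {?K + 1..K}"
    have "real p \<ge> 1" using prime_ge_1_nat[OF p] by simp
    then have "real p ^ Suc ?K \<le> real p ^ k" using k by (intro power_increasing) auto
    then have "R \<le> real p ^ k" using max_exp(2)[OF p R] by linarith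
    then have "R powr (1 / 3) \<le> (real p ^ k) powr (1 / 3)" using R by (intro powr_mono2) auto
    then have "R powr (- (1 / 3)) * R powr (1 / 3) \<le> R powr (- (1 / 3)) * (real p ^ k) powr (1 / 3)"
      by (intro mult_left_mono) auto
    moreover have "R powr (- (1 / 3)) * R powr (1 / 3) = 1" using R by (simp flip: powr_add)
    ultimately have "1 \<le> R powr (- (1 / 3)) * (real p ^ k) powr (1 / 3)" by simp
    then have "1 * new_density p k \<le> (R powr (- (1 / 3)) * (real p ^ k) powr (1 / 3)) * new_density p k"
      by (intro mult_right_mono nn)
    then show "new_density p k \<le> R powr (- (1 / 3)) * ((real p ^ k) powr (1 / 3) * new_density p k)" by (simp add: mult.assoc)
  qed
  also have "\<dots> \<le> (\<Sum>k=1..K. R powr (- (1 / 3)) * ((real p ^ k) powr (1 / 3) * new_density p k))"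
    by (intro sum_mono2) (auto simp: nn)
  also have "\<dots> = R powr (- (1 / 3)) * (\<Sum>k=1..K. (real p ^ k) powr (1 / 3) * new_density p k)" by (simp only: sum_distrib_left)
  also have "\<dots> \<le> R powr (- (1 / 3)) * prime_weight p"
    by (intro mult_left_mono sum_new_density_weighted_le[OF p]) simp
  finally show ?thesis .
qed

definition primes_le :: "real \<Rightarrow> nat set" where "primes_le R = {p. prime p \<and> real p \<le> R}"

lemma primes_leD: "p \<in> primes_le R \<Longrightarrow> prime p" "p \<in> primes_le R \<Longrightarrow> real p \<le> R"
  by (auto simp: primes_le_def)

lemma finite_primes_le: "finite (primes_le R)"
proof (rule finite_subset)
  show "primes_le R \<subseteq> {..nat \<lfloor>R\<rfloor>}" by (auto simp: primes_le_def le_nat_floor)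
qed simp

definition tau_fin :: real where
  "tau_fin = prodinf (\<lambda>n. if prime n then tau_prime n else 1)"

lemma tau_prime_bounds:
  assumes p: "prime p" shows "\<bar>tau_prime p - 1\<bar> \<le> prime_weight p"
proof -
  have L: "(\<lambda>K. 1 - bad_density p K) \<longlonglongrightarrow> tau_prime p" using tau_prime_limit[OF p] by (simp add: bad_density_def)
  have "1 - prime_weight p \<le> tau_prime p"
    by (rule LIMSEQ_le_const[OF L]) (use bad_density_le_weight[OF p] in \<open>auto intro: exI[of _ 0]\<close>)
  moreover have "tau_prime p \<le> 1"
    by (rule LIMSEQ_le_const2[OF L]) (use bad_density_bounds(1)[OF p] in \<open>auto intro: exI[of _ 0]\<close>)
  ultimately show ?thesis using prime_weight_nonneg[of p] by linarith
qed

text \<open>The infinite product is reached by two successive limits, K in the levels and then n in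
  the primes. All factors lie in [0, 1], so products differ by at most the sum of the differences of
  their factors. Primes above R have \<open>max_exp\<close> 0 and contribute a factor 1 to the
  truncated product.\<close>

lemma tau_fin_approx:
  assumes R: "R \<ge> 1"
  shows "\<bar>(\<Prod>p\<in>primes_le R. 1 - bad_density p (max_exp R p)) - tau_fin\<bar> \<le> R powr (- (1 / 3)) * total_weight"
proof -
  let ?c = "\<Prod>p\<in>primes_le R. 1 - bad_density p (max_exp R p)"
  let ?f = "\<lambda>n. if prime n then tau_prime n else 1"
  have fin: "\<bar>?c - (\<Prod>i\<le>n. ?f i)\<bar> \<le> R powr (- (1 / 3)) * total_weight" if n: "real n \<ge> R" for n
  proof -
    let ?D = "primes_le (real n)"
    have sub: "primes_le R \<subseteq> ?D" using n by (auto simp: primes_le_def)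
    have c: "?c = (\<Prod>p\<in>?D. 1 - bad_density p (max_exp R p))"
    proof (rule prod.mono_neutral_left[OF finite_primes_le sub], rule ballI)
      fix p assume "p \<in> ?D - primes_le R"
      then have "max_exp R p = 0" by (intro max_exp_eq_0) (auto simp: primes_le_def)
      then show "1 - bad_density p (max_exp R p) = 1" by (simp add: bad_density_def)
    qed
    have K: "\<bar>?c - (\<Prod>p\<in>?D. 1 - bad_density p K)\<bar> \<le> R powr (- (1 / 3)) * total_weight"
      if K: "K \<ge> (\<Sum>p\<in>?D. max_exp R p)" for K
    proof -
      have le: "norm (1 - bad_density p K') \<le> 1" if "p \<in> ?D" for p K'
        using bad_density_bounds[OF primes_leD(1)[OF that], of K'] by simp
      have "\<bar>?c - (\<Prod>p\<in>?D. 1 - bad_density p K)\<bar> \<le>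
          (\<Sum>p\<in>?D. norm ((1 - bad_density p (max_exp R p)) - (1 - bad_density p K)))"
        unfolding c real_norm_def[symmetric] by (rule norm_prod_diff) (use le in auto)
      also have "\<dots> \<le> (\<Sum>p\<in>?D. R powr (- (1 / 3)) * prime_weight p)"
      proof (rule sum_mono)
        fix p assume p: "p \<in> ?D"
        have "max_exp R p \<le> (\<Sum>p\<in>?D. max_exp R p)" using p finite_primes_le by (intro member_le_sum) auto
        then show "norm ((1 - bad_density p (max_exp R p)) - (1 - bad_density p K)) \<le> R powr (- (1 / 3)) * prime_weight p"
          using bad_density_truncation[OF primes_leD(1)[OF p] R, of K] K by simp
      qed
      also have "\<dots> = R powr (- (1 / 3)) * sum prime_weight ?D" by (simp only: sum_distrib_left)
      also have "\<dots> \<le> R powr (- (1 / 3)) * total_weight"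
        by (intro mult_left_mono sum_prime_weight_le finite_primes_le) simp
      finally show ?thesis .
    qed
    have T: "(\<lambda>K. \<Prod>p\<in>?D. 1 - bad_density p K) \<longlonglongrightarrow> (\<Prod>p\<in>?D. tau_prime p)"
      by (intro tendsto_prod) (use tau_prime_limit primes_leD(1) in \<open>auto simp: bad_density_def\<close>)
    have "(\<lambda>K. \<bar>?c - (\<Prod>p\<in>?D. 1 - bad_density p K)\<bar>) \<longlonglongrightarrow> \<bar>?c - (\<Prod>p\<in>?D. tau_prime p)\<bar>"
      by (intro tendsto_rabs tendsto_diff tendsto_const T)
    then have "\<bar>?c - (\<Prod>p\<in>?D. tau_prime p)\<bar> \<le> R powr (- (1 / 3)) * total_weight"
      by (rule LIMSEQ_le_const2) (use K in blast)
    moreover have "(\<Prod>i\<le>n. ?f i) = (\<Prod>p\<in>?D. tau_prime p)"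
      by (rule prod.mono_neutral_cong_right) (auto simp: primes_le_def)
    ultimately show ?thesis by simp
  qed
  have "norm (?f i - 1) \<le> prime_weight i" for i
    using tau_prime_bounds[of i] prime_weight_nonneg[of i] by simp
  then have "summable (\<lambda>i. norm (?f i - 1))" using summable_comparison_test[OF _ summable_prime_weight, of "\<lambda>i. norm (?f i - 1)"] by auto
  then have "convergent_prod ?f"
    by (rule abs_convergent_prod_imp_convergent_prod[OF summable_imp_abs_convergent_prod])
  then have T: "(\<lambda>n. \<Prod>i\<le>n. ?f i) \<longlonglongrightarrow> tau_fin" unfolding tau_fin_def by (rule convergent_prod_LIMSEQ)
  have L: "(\<lambda>n. \<bar>?c - (\<Prod>i\<le>n. ?f i)\<bar>) \<longlonglongrightarrow> \<bar>?c - tau_fin\<bar>"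
    by (intro tendsto_rabs tendsto_diff tendsto_const T)
  obtain n0 where n0: "real n0 \<ge> R" using real_arch_simple by blast
  have "\<bar>?c - (\<Prod>i\<le>n. ?f i)\<bar> \<le> R powr (- (1 / 3)) * total_weight" if "n \<ge> n0" for n
    by (rule fin) (use n0 that in linarith)
  then show ?thesis using LIMSEQ_le_const2[OF L] by blast
qed

section \<open>Expansion over moduli\<close>

text \<open>Exponent 0 stands for a prime absent from the modulus, hence the constant 1;
  \<open>new_ind p 0\<close> would be 0.\<close>

definition level_ind :: "nat \<Rightarrow> nat \<Rightarrow> int \<Rightarrow> int \<Rightarrow> int \<Rightarrow> int \<Rightarrow> real" where
  "level_ind p k a b c d = (if k = 0 then 1 else new_ind p k a b c d)"

definition level_density :: "nat \<Rightarrow> nat \<Rightarrow> real" where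
  "level_density p k = (if k = 0 then 1 else new_density p k)"

definition mod_of :: "nat set \<Rightarrow> (nat \<Rightarrow> nat) \<Rightarrow> nat" where
  "mod_of D e = (\<Prod>p\<in>D. p ^ e p)"

definition mod_ind :: "nat set \<Rightarrow> (nat \<Rightarrow> nat) \<Rightarrow> int \<Rightarrow> int \<Rightarrow> int \<Rightarrow> int \<Rightarrow> real" where
  "mod_ind D e a b c d = (\<Prod>p\<in>D. level_ind p (e p) a b c d)"

definition mod_density :: "nat set \<Rightarrow> (nat \<Rightarrow> nat) \<Rightarrow> real" where
  "mod_density D e = (\<Prod>p\<in>D. level_density p (e p))"

lemma level_ind_01: "level_ind p k a b c d = 0 \<or> level_ind p k a b c d = 1"
  by (simp add: level_ind_def new_ind_of_bool)

lemma mod_ind_01: "mod_ind D e a b c d = 0 \<or> mod_ind D e a b c d = 1"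
proof (cases "\<exists>p\<in>D. level_ind p (e p) a b c d = 0 \<and> finite D")
  case True
  then show ?thesis unfolding mod_ind_def by (auto intro: prod_zero)
next
  case False
  show ?thesis
  proof (cases "finite D")
    case True
    then have "\<forall>p\<in>D. level_ind p (e p) a b c d = 1" using False level_ind_01 by blast
    then show ?thesis by (simp add: mod_ind_def)
  qed (simp add: mod_ind_def)
qed

lemma mod_ind_nonneg: "mod_ind D e a b c d \<ge> 0"
  using mod_ind_01[of D e a b c d] by auto

lemma mod_of_pos: "(\<And>p. p \<in> D \<Longrightarrow> prime p) \<Longrightarrow> mod_of D e > 0"
  unfolding mod_of_def by (intro prod_pos) (auto simp: prime_gt_0_nat)

lemma mod_density_nonneg: "(\<And>p. p \<in> D \<Longrightarrow> prime p) \<Longrightarrow> mod_density D e \<ge> 0"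
  unfolding mod_density_def by (intro prod_nonneg) (auto simp: level_density_def new_density_nonneg)

lemma periodic_level_ind: "periodic4 (int p ^ k) (level_ind p k)"
  using periodic_new_ind[of p k] by (cases "k = 0") (simp_all add: level_ind_def[abs_def] periodic4_def)

lemma mean_level_ind: "prime p \<Longrightarrow> mean4 (int p ^ k) (level_ind p k) = level_density p k"
  by (cases "k = 0")
     (simp_all add: level_ind_def[abs_def] level_density_def new_density_def mean4_def sum4_def)

lemma mod_ind_mean:
  assumes "finite D" "\<And>p. p \<in> D \<Longrightarrow> prime p"
  shows "periodic4 (int (mod_of D e)) (mod_ind D e) \<and> mean4 (int (mod_of D e)) (mod_ind D e) = mod_density D e"
  using assms
proof (induction D rule: finite_induct)
  case empty
  then show ?case by (simp add: mod_of_def mod_ind_def[abs_def] mod_density_def mean4_def sum4_def periodic4_def)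
next
  case (insert p D)
  have p: "prime p" using insert by blast
  have IH: "periodic4 (int (mod_of D e)) (mod_ind D e)" "mean4 (int (mod_of D e)) (mod_ind D e) = mod_density D e"
    using insert by auto
  have m: "int (mod_of (insert p D) e) = int p ^ e p * int (mod_of D e)" using insert by (simp add: mod_of_def)
  have i: "mod_ind (insert p D) e = (\<lambda>a b c d. level_ind p (e p) a b c d * mod_ind D e a b c d)"
    using insert by (simp add: mod_ind_def[abs_def])
  have pos: "int p ^ e p > 0" "int (mod_of D e) > 0" using p insert mod_of_pos[of D e] by (auto simp: prime_gt_0_nat)
  have "coprime p (q ^ e q)" if "q \<in> D" for q
  proof -
    have "p \<noteq> q" "prime q" using that insert by auto
    then show ?thesis using p primes_coprime by (metis coprime_power_right_iff)
  qed
  then have "coprime p (mod_of D e)" unfolding mod_of_def by (intro prod_coprime_right) auto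
  then have co: "coprime (int p ^ e p) (int (mod_of D e))" by (simp add: coprime_power_left_iff)
  have "periodic4 (int (mod_of (insert p D) e)) (mod_ind (insert p D) e)"
    unfolding i m by (intro periodic4_mult periodic4_dvd[OF periodic_level_ind] periodic4_dvd[OF IH(1)]) auto
  moreover have "mean4 (int (mod_of (insert p D) e)) (mod_ind (insert p D) e) = mod_density (insert p D) e"
    unfolding i m mean4_crt[OF pos co periodic_level_ind IH(1)] IH(2) mean_level_ind[OF p]
    using insert by (simp add: mod_density_def)
  ultimately show ?case by blast
qed

definition exps :: "real \<Rightarrow> (nat \<Rightarrow> nat) set" where
  "exps R = PiE (primes_le R) (\<lambda>p. {0..max_exp R p})"

lemma finite_exps: "finite (exps R)"
  unfolding exps_def by (intro finite_PiE finite_primes_le) auto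

definition sieve :: "real \<Rightarrow> int \<Rightarrow> int \<Rightarrow> int \<Rightarrow> int \<Rightarrow> real" where
  "sieve R a b c d = (\<Prod>p\<in>primes_le R. 1 - bad_ind p (max_exp R p) a b c d)"

text \<open>With s = -1 this expands the sieve and the Euler product in parallel, so that they can
  be compared modulus by modulus. With s = 1 it evaluates sums of nonnegative terms over all
  moduli.\<close>

lemma prod_one_plus_expand:
  fixes s :: real and f :: "nat \<Rightarrow> nat \<Rightarrow> real"
  shows "(\<Prod>p\<in>primes_le R. 1 + s * (\<Sum>k=1..max_exp R p. f p k)) =
    (\<Sum>e\<in>exps R. (\<Prod>p\<in>primes_le R. if e p = 0 then 1 else s) * (\<Prod>p\<in>primes_le R. if e p = 0 then 1 else f p (e p)))"
proof -
  have "1 + s * (\<Sum>k=1..K. f p k) = (\<Sum>k\<in>{0..K}. (if k = 0 then 1 else s) * (if k = 0 then 1 else f p k))" for p K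
  proof -
    have "{0..K} = insert 0 {1..K}" by auto
    then have "(\<Sum>k\<in>{0..K}. (if k = 0 then 1 else s) * (if k = 0 then 1 else f p k)) = 
        1 + (\<Sum>k=1..K. (if k = 0 then 1 else s) * (if k = 0 then 1 else f p k))" by simp
    also have "(\<Sum>k=1..K. (if k = 0 then 1 else s) * (if k = 0 then 1 else f p k)) = (\<Sum>k=1..K. s * f p k)"
      by (intro sum.cong) auto
    finally show ?thesis by (simp add: sum_distrib_left)
  qed
  then have "(\<Prod>p\<in>primes_le R. 1 + s * (\<Sum>k=1..max_exp R p. f p k)) =
    (\<Prod>p\<in>primes_le R. \<Sum>k\<in>{0..max_exp R p}. (if k = 0 then 1 else s) * (if k = 0 then 1 else f p k))" by simp
  also have "\<dots> = (\<Sum>e\<in>exps R. \<Prod>p\<in>primes_le R. (if e p = 0 then 1 else s) * (if e p = 0 then 1 else f p (e p)))"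
    unfolding exps_def by (intro prod_sum_PiE finite_primes_le) simp
  finally show ?thesis by (simp add: prod.distrib)
qed

definition mod_sign :: "real \<Rightarrow> (nat \<Rightarrow> nat) \<Rightarrow> real" where
  "mod_sign R e = (\<Prod>p\<in>primes_le R. if e p = 0 then 1 else - 1)"

lemma abs_mod_sign: "\<bar>mod_sign R e\<bar> = 1"
  unfolding mod_sign_def abs_prod by (intro prod.neutral) auto

lemma mod_ind_alt: "mod_ind D e a b c d = (\<Prod>p\<in>D. if e p = 0 then 1 else new_ind p (e p) a b c d)"
  by (simp add: mod_ind_def level_ind_def)

lemma mod_density_alt: "mod_density D e = (\<Prod>p\<in>D. if e p = 0 then 1 else new_density p (e p))"
  by (simp add: mod_density_def level_density_def)

lemma sieve_expand:
  "sieve R a b c d = (\<Sum>e\<in>exps R. mod_sign R e * mod_ind (primes_le R) e a b c d)"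
proof -
  have "sieve R a b c d = (\<Prod>p\<in>primes_le R. 1 + (- 1) * (\<Sum>k=1..max_exp R p. new_ind p k a b c d))"
    unfolding sieve_def using sum_new_ind primes_leD(1) by (intro prod.cong) auto
  then show ?thesis unfolding prod_one_plus_expand mod_sign_def mod_ind_alt .
qed

lemma density_expand:
  "(\<Prod>p\<in>primes_le R. 1 - bad_density p (max_exp R p)) = (\<Sum>e\<in>exps R. mod_sign R e * mod_density (primes_le R) e)"
proof -
  have "(\<Prod>p\<in>primes_le R. 1 - bad_density p (max_exp R p)) = (\<Prod>p\<in>primes_le R. 1 + (- 1) * (\<Sum>k=1..max_exp R p. new_density p k))"
    by (simp add: bad_density_def)
  then show ?thesis unfolding prod_one_plus_expand mod_sign_def mod_density_alt .
qed

text \<open>Rankin's bound for whole moduli: by multiplicativity the weighted sum is an Euler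
  product, and 1 + x <= exp x bounds it uniformly in \<open>R\<close>.\<close>

lemma sum_mod_density_weighted_le:
  "(\<Sum>e\<in>exps R. real (mod_of (primes_le R) e) powr (1 / 3) * mod_density (primes_le R) e) \<le> exp total_weight"
proof -
  let ?D = "primes_le R"
  have "(\<Sum>e\<in>exps R. real (mod_of ?D e) powr (1 / 3) * mod_density ?D e) =
     (\<Sum>e\<in>exps R. (\<Prod>p\<in>?D. if e p = 0 then 1 else 1) * (\<Prod>p\<in>?D. if e p = 0 then 1 else (real p ^ e p) powr (1 / 3) * new_density p (e p)))"
  proof (intro sum.cong refl)
    fix e
    have "real (mod_of ?D e) powr (1 / 3) = (\<Prod>p\<in>?D. (real p ^ e p) powr (1 / 3))"
      unfolding mod_of_def by (simp add: prod_powr_distrib)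
    then show "real (mod_of ?D e) powr (1 / 3) * mod_density ?D e =
      (\<Prod>p\<in>?D. if e p = 0 then 1 else 1) * (\<Prod>p\<in>?D. if e p = 0 then 1 else (real p ^ e p) powr (1 / 3) * new_density p (e p))"
      unfolding mod_density_alt by (auto simp flip: prod.distrib intro!: prod.cong)
  qed
  also have "\<dots> = (\<Prod>p\<in>?D. 1 + 1 * (\<Sum>k=1..max_exp R p. (real p ^ k) powr (1 / 3) * new_density p k))"
    by (rule prod_one_plus_expand[symmetric])
  also have "\<dots> \<le> (\<Prod>p\<in>?D. exp (prime_weight p))"
  proof (rule prod_mono)
    fix p assume p: "p \<in> ?D"
    let ?s = "\<Sum>k=1..max_exp R p. (real p ^ k) powr (1 / 3) * new_density p k"
    have pp: "prime p" using p primes_leD by blast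
    have "?s \<ge> 0" by (intro sum_nonneg mult_nonneg_nonneg new_density_nonneg[OF pp]) auto
    moreover have "1 + ?s \<le> exp (prime_weight p)"
      using sum_new_density_weighted_le[OF pp, of "max_exp R p"] exp_ge_add_one_self[of "prime_weight p"] by linarith
    ultimately show "0 \<le> 1 + 1 * ?s \<and> 1 + 1 * ?s \<le> exp (prime_weight p)" by simp
  qed
  also have "\<dots> = exp (sum prime_weight ?D)" by (simp add: exp_sum finite_primes_le)
  also have "\<dots> \<le> exp total_weight" using sum_prime_weight_le[OF finite_primes_le] by simp
  finally show ?thesis .
qed
subsection \<open>The sieve in one orthant\<close>

text \<open>Beyond some M every factor n^\<delta> is at least 2, and fewer than M + 1 primes lie
  below M; these cost the constant 2^M.\<close>

lemma two_power_card_le: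
  fixes \<delta> :: real
  assumes \<delta>: "\<delta> > 0"
  obtains C where "C \<ge> 1" "\<And>S. finite S \<Longrightarrow> (\<And>p. p \<in> S \<Longrightarrow> prime p) \<Longrightarrow> 2 ^ card S \<le> C * real (\<Prod>S) powr \<delta>"
proof -
  have "filterlim (\<lambda>n. real n powr \<delta>) at_top sequentially"
    using \<delta> by (rule filterlim_compose[OF real_powr_at_top filterlim_real_sequentially])
  then have "eventually (\<lambda>n. real n powr \<delta> \<ge> 2) sequentially" by (simp add: filterlim_at_top)
  then obtain M where M: "\<And>n. n \<ge> M \<Longrightarrow> real n powr \<delta> \<ge> 2" by (auto simp: eventually_sequentially)
  define C :: real where "C = 2 ^ M"
  have C1: "C \<ge> 1" by (simp add: C_def one_le_power)
  have main: "2 ^ card S \<le> C * real (\<Prod>S) powr \<delta>" if S: "finite S" "\<And>p. p \<in> S \<Longrightarrow> prime p" for S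
  proof -
    let ?A = "S \<inter> {..<M}" and ?B = "S - {..<M}"
    have "card S = card ?A + card ?B" using S(1) by (metis card_Int_Diff add.commute)
    then have "(2::real) ^ card S = 2 ^ card ?A * 2 ^ card ?B" by (simp add: power_add)
    also have "(2::real) ^ card ?A \<le> C"
    proof -
      have "card ?A \<le> card {..<M}" by (intro card_mono) auto
      then show ?thesis unfolding C_def by (intro power_increasing) auto
    qed
    also have "(2::real) ^ card ?B = (\<Prod>p\<in>?B. 2)" by simp
    also have "\<dots> \<le> (\<Prod>p\<in>?B. real p powr \<delta>)" using M by (intro prod_mono) auto
    also have "\<dots> \<le> (\<Prod>p\<in>S. real p powr \<delta>)"
    proof -
      have "(\<Prod>p\<in>S. real p powr \<delta>) = (\<Prod>p\<in>?B. real p powr \<delta>) * (\<Prod>p\<in>?A. real p powr \<delta>)"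
        using S(1) by (subst prod.union_disjoint[symmetric]) (auto intro: prod.cong)
      moreover have "(\<Prod>p\<in>?A. real p powr \<delta>) \<ge> 1"
      proof (rule prod_ge_1)
        fix p assume "p \<in> ?A"
        then have "p \<ge> 1" using S(2) prime_ge_1_nat by blast
        then show "1 \<le> real p powr \<delta>" using \<delta> by (simp add: ge_one_powr_ge_zero)
      qed
      moreover have "(\<Prod>p\<in>?B. real p powr \<delta>) \<ge> 0" by (intro prod_nonneg) auto
      ultimately show ?thesis by (simp add: mult_le_cancel_left1)
    qed
    also have "(\<Prod>p\<in>S. real p powr \<delta>) = real (\<Prod>S) powr \<delta>" by (simp add: prod_powr_distrib)
    finally show ?thesis using C1 by (simp add: mult_left_mono mult_right_mono)
  qed
  show ?thesis using that[OF C1 main] .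
qed

lemma prod_primes_dvd:
  fixes n :: nat
  assumes "finite T" "\<And>p. p \<in> T \<Longrightarrow> prime p" "\<And>p. p \<in> T \<Longrightarrow> p dvd n"
  shows "\<Prod>T dvd n"
  using assms
proof (induction T rule: finite_induct)
  case (insert p T)
  have "coprime p q" if "q \<in> T" for q using insert that by (intro primes_coprime) auto
  then have "coprime p (\<Prod>T)" by (intro prod_coprime_right)
  then show ?case using insert by (simp add: divides_mult)
qed simp

text \<open>When the factors are multiplied one at a time, the step that first exceeds
  \<open>Q\<close> overshoots by at most one factor, which is at most \<open>R\<close>.\<close>

lemma ex_subset_prod_between:
  fixes w :: "'a \<Rightarrow> real"
  assumes "finite S" "Q \<ge> 1" "R \<ge> 1" "\<And>x. x \<in> S \<Longrightarrow> 1 \<le> w x \<and> w x \<le> R" "(\<Prod>x\<in>S. w x) > Q"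
  shows "\<exists>T\<subseteq>S. Q < (\<Prod>x\<in>T. w x) \<and> (\<Prod>x\<in>T. w x) \<le> Q * R"
  using assms(1,4,5)
proof (induction S rule: finite_induct)
  case empty
  then show ?case using assms(2) by simp
next
  case (insert x S)
  show ?case
  proof (cases "(\<Prod>x\<in>S. w x) > Q")
    case True
    then obtain T where "T \<subseteq> S" "Q < prod w T \<and> prod w T \<le> Q * R" using insert by auto
    then show ?thesis by blast
  next
    case False
    have "(\<Prod>x\<in>insert x S. w x) = (\<Prod>x\<in>S. w x) * w x" using insert.hyps by (simp add: mult.commute)
    also have "\<dots> \<le> Q * R" using False insert.prems(1)[of x] assms(2) by (intro mult_mono) auto
    finally show ?thesis using insert.prems(2) by blast
  qed
qed

definition everywhere_good :: "int \<Rightarrow> int \<Rightarrow> int \<Rightarrow> int \<Rightarrow> bool" where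
  "everywhere_good a b c d \<longleftrightarrow> (\<forall>p. prime p \<longrightarrow> good p a b c d)"

text \<open>\<open>Q * R \<le> real N\<close> is the coupling of the two parameters: a modulus that
  exceeds \<open>Q\<close> by at most one prime power still fits into the box, so periodicity counts
  its points.\<close>

locale box =
  fixes N :: nat and s1 s2 s3 s4 :: bool and R Q :: real
  assumes N: "N \<ge> 2" and R: "1 \<le> R" and Q: "1 \<le> Q" and QR: "Q * R \<le> real N"
begin

abbreviation "S \<equiv> sum4 (side N s1) (side N s2) (side N s3) (side N s4)"
abbreviation "D \<equiv> primes_le R"
abbreviation "md \<equiv> mod_of D"
abbreviation "ind \<equiv> mod_ind D"
abbreviation "dens \<equiv> mod_density D"

lemma Q_le: "Q \<le> real N"
proof -
  have "Q * 1 \<le> Q * R" using Q R by (intro mult_left_mono) auto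
  then show ?thesis using QR by simp
qed

lemma md_pos: "md e > 0"
  by (rule mod_of_pos) (rule primes_leD)

lemma dens_nonneg: "dens e \<ge> 0"
  by (rule mod_density_nonneg) (rule primes_leD)

lemma sum_mod_ind:
  assumes "real (md e) \<le> real N"
  shows "\<bar>S (ind e) - real N ^ 4 * dens e\<bar> \<le> 15 * real N ^ 3 * real (md e) * dens e"
    and "S (ind e) \<le> 16 * real N ^ 4 * dens e"
proof -
  have pr: "prime p" if "p \<in> D" for p using that by (rule primes_leD)
  have m: "periodic4 (int (md e)) (ind e)" "mean4 (int (md e)) (ind e) = dens e"
    using mod_ind_mean[where D = D and e = e, OF finite_primes_le pr] by blast+
  have q: "int (md e) > 0" "of_int (int (md e)) \<le> real N" using md_pos assms by auto
  show "\<bar>S (ind e) - real N ^ 4 * dens e\<bar> \<le> 15 * real N ^ 3 * real (md e) * dens e"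
    "S (ind e) \<le> 16 * real N ^ 4 * dens e"
    using sum4_periodic_mean[OF q(1) m(1) mod_ind_nonneg q(2)] unfolding m(2) side_eq by simp_all
qed

lemma md_powr_ge_1: "real (md e) powr (1 / 3) \<ge> 1"
proof -
  have "real (md e) \<ge> 1" using md_pos[of e] by linarith
  then show ?thesis by (simp add: ge_one_powr_ge_zero)
qed

lemma sum_dens_le: "(\<Sum>e\<in>exps R. dens e) \<le> exp total_weight"
proof -
  have "dens e \<le> real (md e) powr (1 / 3) * dens e" for e
    using mult_right_mono[OF md_powr_ge_1 dens_nonneg, of e e] by simp
  then have "(\<Sum>e\<in>exps R. dens e) \<le> (\<Sum>e\<in>exps R. real (md e) powr (1 / 3) * dens e)" by (intro sum_mono)
  then show ?thesis using sum_mod_density_weighted_le[of R] by linarith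
qed

lemma sum_dens_tail: "(\<Sum>e\<in>{e \<in> exps R. real (md e) > Q}. dens e) \<le> Q powr (- (1 / 3)) * exp total_weight"
proof -
  have le: "dens e \<le> Q powr (- (1 / 3)) * (real (md e) powr (1 / 3) * dens e)" if "real (md e) > Q" for e
  proof -
    have "Q powr (1 / 3) \<le> real (md e) powr (1 / 3)" using that Q by (intro powr_mono2) auto
    then have "Q powr (- (1 / 3)) * Q powr (1 / 3) \<le> Q powr (- (1 / 3)) * real (md e) powr (1 / 3)"
      by (intro mult_left_mono) auto
    moreover have "Q powr (- (1 / 3)) * Q powr (1 / 3) = 1" using Q by (simp flip: powr_add)
    ultimately have "1 \<le> Q powr (- (1 / 3)) * real (md e) powr (1 / 3)" by simp
    then have "1 * dens e \<le> (Q powr (- (1 / 3)) * real (md e) powr (1 / 3)) * dens e"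
      by (intro mult_right_mono dens_nonneg)
    then show ?thesis by (simp add: mult.assoc)
  qed
  have "(\<Sum>e\<in>{e \<in> exps R. real (md e) > Q}. dens e) \<le>
      (\<Sum>e\<in>{e \<in> exps R. real (md e) > Q}. Q powr (- (1 / 3)) * (real (md e) powr (1 / 3) * dens e))"
    by (intro sum_mono le) simp
  also have "\<dots> \<le> (\<Sum>e\<in>exps R. Q powr (- (1 / 3)) * (real (md e) powr (1 / 3) * dens e))"
    by (intro sum_mono2 finite_exps) (auto intro!: mult_nonneg_nonneg dens_nonneg)
  also have "\<dots> = Q powr (- (1 / 3)) * (\<Sum>e\<in>exps R. real (md e) powr (1 / 3) * dens e)"
    by (simp only: sum_distrib_left)
  also have "\<dots> \<le> Q powr (- (1 / 3)) * exp total_weight"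
    by (intro mult_left_mono sum_mod_density_weighted_le) simp
  finally show ?thesis .
qed

lemma all_bad_dvd_product:
  assumes "prime p" "k \<ge> 1" "all_bad p k a b c d"
  shows "int p dvd 2 * a * b * c * d"
proof (cases "p = 2")
  case False
  then show ?thesis using all_bad_dvd[OF assms(1) False assms(2,3)] by (auto simp: mult.assoc)
qed (simp add: mult.assoc)

text \<open>Without signs the expansion counts the sets of primes at which the point is seen to be
  bad, 2^(number of such primes). They all divide 2abcd, where the 2 is there because nothing is
  claimed about divisibility at the prime 2, and this number is nonzero in an orthant.\<close>

lemma sum_ind_le:
  assumes C: "C \<ge> 1" "\<And>S. finite S \<Longrightarrow> (\<And>p. p \<in> S \<Longrightarrow> prime p) \<Longrightarrow> 2 ^ card S \<le> C * real (\<Prod>S) powr \<delta>" and \<delta>: "\<delta> > 0"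
    and x: "a \<in> side N s1" "b \<in> side N s2" "c \<in> side N s3" "d \<in> side N s4"
  shows "(\<Sum>e\<in>exps R. ind e a b c d) \<le> C * (2 * real N ^ 4) powr \<delta>"
proof -
  let ?T = "{p \<in> D. all_bad p (max_exp R p) a b c d}"
  have fT: "finite ?T" using finite_primes_le by simp
  have "(\<Sum>e\<in>exps R. ind e a b c d) = (\<Prod>p\<in>D. 1 + 1 * (\<Sum>k=1..max_exp R p. new_ind p k a b c d))"
    unfolding prod_one_plus_expand mod_ind_alt by simp
  also have "\<dots> = (\<Prod>p\<in>D. 1 + bad_ind p (max_exp R p) a b c d)"
    by (intro prod.cong refl) (simp only: sum_new_ind[OF primes_leD(1)] mult_1)
  also have "\<dots> = (\<Prod>p\<in>?T. 2)"
    by (rule prod.mono_neutral_cong_right[OF finite_primes_le]) (auto simp: bad_ind_def)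
  also have "\<dots> = 2 ^ card ?T" by simp
  also have "\<dots> \<le> C * real (\<Prod>?T) powr \<delta>" using C(2)[OF fT] primes_leD(1) by blast
  also have "\<dots> \<le> C * (2 * real N ^ 4) powr \<delta>"
  proof -
    have nz: "2 * a * b * c * d \<noteq> 0" using x sideD by auto
    have "\<Prod>?T dvd nat \<bar>2 * a * b * c * d\<bar>"
    proof (rule prod_primes_dvd[OF fT])
      fix p assume p: "p \<in> ?T"
      then show "prime p" using primes_leD(1) by blast
      have k: "max_exp R p \<ge> 1" using p not_all_bad_0[of p] primes_leD(1) by (cases "max_exp R p") auto
      have "int p dvd 2 * a * b * c * d" using all_bad_dvd_product[OF _ k] p primes_leD(1) by blast
      then show "p dvd nat \<bar>2 * a * b * c * d\<bar>" by (simp add: nat_dvd_iff flip: int_dvd_int_iff)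
    qed
    then have "\<Prod>?T \<le> nat \<bar>2 * a * b * c * d\<bar>" using nz by (intro dvd_imp_le) auto
    then have "real (\<Prod>?T) \<le> real_of_int \<bar>2 * a * b * c * d\<bar>" by linarith
    also have "\<dots> = 2 * \<bar>real_of_int a\<bar> * \<bar>real_of_int b\<bar> * \<bar>real_of_int c\<bar> * \<bar>real_of_int d\<bar>" by (simp add: abs_mult)
    also have "\<dots> \<le> 2 * real N * real N * real N * real N"
    proof -
      have "\<bar>real_of_int a\<bar> \<le> real N" "\<bar>real_of_int b\<bar> \<le> real N" "\<bar>real_of_int c\<bar> \<le> real N" "\<bar>real_of_int d\<bar> \<le> real N"
        using sideD[OF x(1)] sideD[OF x(2)] sideD[OF x(3)] sideD[OF x(4)] by linarith+
      then show ?thesis by (intro mult_mono mult_nonneg_nonneg) auto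
    qed
    also have "\<dots> = 2 * real N ^ 4" by (simp add: power4_eq_xxxx)
    finally have "real (\<Prod>?T) \<le> 2 * real N ^ 4" .
    then have "real (\<Prod>?T) powr \<delta> \<le> (2 * real N ^ 4) powr \<delta>"
      by (rule powr_mono2[OF less_imp_le[OF \<delta>] of_nat_0_le_iff])
    then show ?thesis using C by (intro mult_left_mono) auto
  qed
  finally show ?thesis .
qed

lemma ex_medium_modulus:
  assumes e: "e \<in> exps R" and big: "real (md e) > Q" and i: "ind e a b c d = 1"
  obtains e' where "e' \<in> exps R" "real (md e') > Q" "real (md e') \<le> Q * R" "ind e' a b c d = 1"
proof -
  have w: "1 \<le> real p ^ e p \<and> real p ^ e p \<le> R" if p: "p \<in> D" for p
  proof -
    have pp: "prime p" using p primes_leD by blast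
    have p1: "real p \<ge> 1" using prime_ge_1_nat[OF pp] by simp
    have "e p \<le> max_exp R p" using e p unfolding exps_def by auto
    then have "real p ^ e p \<le> real p ^ max_exp R p" using p1 by (intro power_increasing) auto
    then show ?thesis using max_exp(1)[OF pp R] p1 by (auto intro: one_le_power)
  qed
  have "(\<Prod>p\<in>D. real p ^ e p) > Q" using big by (simp add: mod_of_def)
  from ex_subset_prod_between[OF finite_primes_le Q R w this]
  obtain T where T: "T \<subseteq> D" "Q < (\<Prod>p\<in>T. real p ^ e p)" "(\<Prod>p\<in>T. real p ^ e p) \<le> Q * R" by blast
  \<comment> \<open>\<open>exps\<close> consists of extensional functions, hence
    \<open>undefined\<close> outside \<open>D\<close>.\<close>
  define e' where "e' = (\<lambda>p. if p \<in> T then e p else if p \<in> D then 0 else undefined)"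
  have "e' \<in> exps R" using e T(1) unfolding exps_def e'_def by (auto simp: PiE_def extensional_def Pi_def)
  moreover have "real (md e') = (\<Prod>p\<in>T. real p ^ e p)"
    unfolding mod_of_def of_nat_prod
    by (rule prod.mono_neutral_cong_right[OF finite_primes_le T(1)]) (use T(1) in \<open>auto simp: e'_def\<close>)
  moreover have "ind e' a b c d = 1"
  proof -
    have lev: "level_ind p (e p) a b c d = 1" if "p \<in> D" for p
      using i level_ind_01[of p "e p" a b c d] that finite_primes_le unfolding mod_ind_def by (metis prod_zero zero_neq_one)
    show ?thesis unfolding mod_ind_def
    proof (intro prod.neutral ballI)
      fix p assume "p \<in> D"
      then show "level_ind p (e' p) a b c d = 1"
        using lev[of p] by (cases "p \<in> T") (simp_all add: e'_def level_ind_def[of _ 0])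
    qed
  qed
  ultimately show ?thesis using that T by auto
qed

text \<open>The three errors are: the box count for moduli up to \<open>Q\<close>, the large moduli
  in the density expansion, and the large moduli in the sieve. Only the last needs an idea, the
  majorant by the medium moduli \<open>?M\<close>.\<close>

lemma sum_sieve:
  assumes C: "C \<ge> 1" "\<And>S. finite S \<Longrightarrow> (\<And>p. p \<in> S \<Longrightarrow> prime p) \<Longrightarrow> 2 ^ card S \<le> C * real (\<Prod>S) powr \<delta>" and \<delta>: "\<delta> > 0"
  shows "\<bar>S (sieve R) - real N ^ 4 * (\<Prod>p\<in>D. 1 - bad_density p (max_exp R p))\<bar> \<le>
    exp total_weight * (15 * real N ^ 3 * Q + real N ^ 4 * Q powr (- (1 / 3)) +
      C * (2 * real N ^ 4) powr \<delta> * 16 * real N ^ 4 * Q powr (- (1 / 3)))"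
proof -
  let ?E = "exps R" and ?sg = "mod_sign R"
  let ?L = "{e \<in> ?E. real (md e) \<le> Q}" and ?H = "{e \<in> ?E. real (md e) > Q}"
  let ?M = "{e \<in> ?E. Q < real (md e) \<and> real (md e) \<le> Q * R}"
  let ?c = "C * (2 * real N ^ 4) powr \<delta>"
  have c0: "?c \<ge> 0" using C by simp
  have fE: "finite ?L" "finite ?H" "finite ?M" using finite_exps by auto
  have split: "sum g ?E = sum g ?L + sum g ?H" for g :: "(nat \<Rightarrow> nat) \<Rightarrow> real"
  proof -
    have "?E = ?L \<union> ?H" by auto
    then show ?thesis using fE by (metis (no_types, lifting) sum.union_disjoint disjoint_iff mem_Collect_eq not_le)
  qed
  have Ssum: "S (\<lambda>a b c d. \<Sum>e\<in>A. ?sg e * ind e a b c d) = (\<Sum>e\<in>A. ?sg e * S (ind e))" for A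
    by (simp only: sum4_sum sum4_cmult)
  have "S (sieve R) = S (\<lambda>a b c d. (\<Sum>e\<in>?L. ?sg e * ind e a b c d) + (\<Sum>e\<in>?H. ?sg e * ind e a b c d))"
    by (simp only: sieve_expand[abs_def] split)
  also have "\<dots> = (\<Sum>e\<in>?L. ?sg e * S (ind e)) + S (\<lambda>a b c d. \<Sum>e\<in>?H. ?sg e * ind e a b c d)"
    by (simp only: sum4_add Ssum)
  finally have A: "S (sieve R) = (\<Sum>e\<in>?L. ?sg e * S (ind e)) + S (\<lambda>a b c d. \<Sum>e\<in>?H. ?sg e * ind e a b c d)" .
  have B: "real N ^ 4 * (\<Prod>p\<in>D. 1 - bad_density p (max_exp R p)) =
     (\<Sum>e\<in>?L. ?sg e * (real N ^ 4 * dens e)) + real N ^ 4 * (\<Sum>e\<in>?H. ?sg e * dens e)"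
    unfolding density_expand split by (simp add: distrib_left sum_distrib_left mult.left_commute)
  have E: "S (sieve R) - real N ^ 4 * (\<Prod>p\<in>D. 1 - bad_density p (max_exp R p)) =
     (\<Sum>e\<in>?L. ?sg e * (S (ind e) - real N ^ 4 * dens e)) + S (\<lambda>a b c d. \<Sum>e\<in>?H. ?sg e * ind e a b c d)
      - real N ^ 4 * (\<Sum>e\<in>?H. ?sg e * dens e)"
    unfolding A B by (simp add: right_diff_distrib sum_subtractf)
  have main: "\<bar>S (sieve R) - real N ^ 4 * (\<Prod>p\<in>D. 1 - bad_density p (max_exp R p))\<bar> \<le>
    \<bar>\<Sum>e\<in>?L. ?sg e * (S (ind e) - real N ^ 4 * dens e)\<bar>
      + \<bar>S (\<lambda>a b c d. \<Sum>e\<in>?H. ?sg e * ind e a b c d)\<bar> + \<bar>real N ^ 4 * (\<Sum>e\<in>?H. ?sg e * dens e)\<bar>"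
    unfolding E by linarith
  have 1: "\<bar>\<Sum>e\<in>?L. ?sg e * (S (ind e) - real N ^ 4 * dens e)\<bar> \<le> 15 * real N ^ 3 * Q * exp total_weight"
  proof -
    have "\<bar>\<Sum>e\<in>?L. ?sg e * (S (ind e) - real N ^ 4 * dens e)\<bar> \<le> (\<Sum>e\<in>?L. \<bar>?sg e * (S (ind e) - real N ^ 4 * dens e)\<bar>)"
      by (rule sum_abs)
    also have "\<dots> \<le> (\<Sum>e\<in>?L. 15 * real N ^ 3 * Q * dens e)"
    proof (rule sum_mono)
      fix e assume e: "e \<in> ?L"
      then have "real (md e) \<le> real N" using Q_le by auto
      then have "\<bar>S (ind e) - real N ^ 4 * dens e\<bar> \<le> 15 * real N ^ 3 * real (md e) * dens e" by (rule sum_mod_ind)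
      also have "\<dots> \<le> 15 * real N ^ 3 * Q * dens e"
        using e by (intro mult_right_mono mult_left_mono dens_nonneg) auto
      finally show "\<bar>?sg e * (S (ind e) - real N ^ 4 * dens e)\<bar> \<le> 15 * real N ^ 3 * Q * dens e"
        by (simp add: abs_mult abs_mod_sign)
    qed
    also have "\<dots> = 15 * real N ^ 3 * Q * (\<Sum>e\<in>?L. dens e)" by (simp only: sum_distrib_left)
    also have "\<dots> \<le> 15 * real N ^ 3 * Q * (\<Sum>e\<in>?E. dens e)"
      using Q finite_exps by (intro mult_left_mono sum_mono2 dens_nonneg) auto
    also have "\<dots> \<le> 15 * real N ^ 3 * Q * exp total_weight"
      using Q by (intro mult_left_mono sum_dens_le) auto
    finally show ?thesis .
  qed
  have 3: "\<bar>real N ^ 4 * (\<Sum>e\<in>?H. ?sg e * dens e)\<bar> \<le> real N ^ 4 * (Q powr (- (1 / 3)) * exp total_weight)"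
  proof -
    have "\<bar>\<Sum>e\<in>?H. ?sg e * dens e\<bar> \<le> (\<Sum>e\<in>?H. \<bar>?sg e * dens e\<bar>)" by (rule sum_abs)
    also have "\<dots> = (\<Sum>e\<in>?H. dens e)" by (intro sum.cong) (auto simp: abs_mult abs_mod_sign dens_nonneg)
    also have "\<dots> \<le> Q powr (- (1 / 3)) * exp total_weight" by (rule sum_dens_tail)
    finally show ?thesis by (simp add: abs_mult mult_left_mono)
  qed
  have 2: "\<bar>S (\<lambda>a b c d. \<Sum>e\<in>?H. ?sg e * ind e a b c d)\<bar> \<le> ?c * (16 * real N ^ 4 * (Q powr (- (1 / 3)) * exp total_weight))"
  proof -
    have "\<bar>S (\<lambda>a b c d. \<Sum>e\<in>?H. ?sg e * ind e a b c d)\<bar> \<le> S (\<lambda>a b c d. \<bar>\<Sum>e\<in>?H. ?sg e * ind e a b c d\<bar>)"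
      by (rule sum4_abs)
    also have "\<dots> \<le> S (\<lambda>a b c d. ?c * (\<Sum>e\<in>?M. ind e a b c d))"
    proof (rule sum4_mono)
      fix a b c d assume x: "a \<in> side N s1" "b \<in> side N s2" "c \<in> side N s3" "d \<in> side N s4"
      have "\<bar>\<Sum>e\<in>?H. ?sg e * ind e a b c d\<bar> \<le> (\<Sum>e\<in>?H. \<bar>?sg e * ind e a b c d\<bar>)" by (rule sum_abs)
      also have "\<dots> = (\<Sum>e\<in>?H. ind e a b c d)" by (intro sum.cong) (auto simp: abs_mult abs_mod_sign mod_ind_nonneg)
      \<comment> \<open>A sum over large moduli that does not vanish at this point is at most
        \<open>?c\<close>, and then some medium modulus contributes 1 on the right. So the
        inequality holds pointwise.\<close>
      also have "\<dots> \<le> ?c * (\<Sum>e\<in>?M. ind e a b c d)"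
      proof (cases "\<exists>e\<in>?H. ind e a b c d = 1")
        case True
        then obtain e where "e \<in> exps R" "real (md e) > Q" "ind e a b c d = 1" by auto
        then obtain e' where e': "e' \<in> ?M" "ind e' a b c d = 1" using ex_medium_modulus by (metis (mono_tags, lifting) mem_Collect_eq)
        have "(\<Sum>e\<in>?H. ind e a b c d) \<le> (\<Sum>e\<in>?E. ind e a b c d)"
          by (intro sum_mono2 finite_exps mod_ind_nonneg) auto
        also have "\<dots> \<le> ?c" by (rule sum_ind_le[OF C \<delta> x])
        also have "\<dots> \<le> ?c * (\<Sum>e\<in>?M. ind e a b c d)"
        proof -
          have "ind e' a b c d \<le> (\<Sum>e\<in>?M. ind e a b c d)" by (rule member_le_sum[OF e'(1) mod_ind_nonneg fE(3)])
          then show ?thesis using e'(2) c0 by (simp add: mult_le_cancel_left1)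
        qed
        finally show ?thesis .
      next
        case False
        then have "(\<Sum>e\<in>?H. ind e a b c d) = 0" using mod_ind_01 by (intro sum.neutral) blast
        moreover have "(\<Sum>e\<in>?M. ind e a b c d) \<ge> 0" by (intro sum_nonneg mod_ind_nonneg)
        ultimately show ?thesis using c0 by simp
      qed
      finally show "\<bar>\<Sum>e\<in>?H. ?sg e * ind e a b c d\<bar> \<le> ?c * (\<Sum>e\<in>?M. ind e a b c d)" .
    qed
    also have "\<dots> = ?c * (\<Sum>e\<in>?M. S (ind e))" by (simp only: sum4_cmult sum4_sum)
    also have "\<dots> \<le> ?c * (\<Sum>e\<in>?M. 16 * real N ^ 4 * dens e)"
      using QR by (intro mult_left_mono[OF _ c0] sum_mono sum_mod_ind(2)) auto
    also have "\<dots> = ?c * (16 * real N ^ 4 * (\<Sum>e\<in>?M. dens e))" by (simp only: sum_distrib_left)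
    also have "\<dots> \<le> ?c * (16 * real N ^ 4 * (\<Sum>e\<in>?H. dens e))"
      by (intro mult_left_mono[OF _ c0] mult_left_mono sum_mono2 fE dens_nonneg) auto
    also have "\<dots> \<le> ?c * (16 * real N ^ 4 * (Q powr (- (1 / 3)) * exp total_weight))"
      by (intro mult_left_mono[OF _ c0] mult_left_mono sum_dens_tail) auto
    finally show ?thesis .
  qed
  have "\<bar>S (sieve R) - real N ^ 4 * (\<Prod>p\<in>D. 1 - bad_density p (max_exp R p))\<bar> \<le>
     15 * real N ^ 3 * Q * exp total_weight + ?c * (16 * real N ^ 4 * (Q powr (- (1 / 3)) * exp total_weight))
      + real N ^ 4 * (Q powr (- (1 / 3)) * exp total_weight)"
    using main 1 2 3 by linarith
  then show ?thesis by (simp add: algebra_simps)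
qed

section \<open>Badness that the truncated sieve misses\<close>

definition exceptional :: "nat \<Rightarrow> int \<Rightarrow> int \<Rightarrow> int \<Rightarrow> int \<Rightarrow> bool" where
  "exceptional p a b c d \<longleftrightarrow> nondegenerate a b c d \<and> \<not> good p a b c d \<and> \<not> all_bad p (max_exp R p) a b c d"

lemma sum4_one: "S (\<lambda>a b c d. 1) = real N ^ 4"
  by (simp add: sum4_def power4_eq_xxxx)

lemma exceptional_cong:
  assumes p: "prime p" and ex: "exceptional p a b c d" and k: "k = max_exp R p" "k \<ge> 2" "k \<ge> iso_loss p + class_loss p"
  defines "r \<equiv> int p ^ (k - (iso_loss p + class_loss p))"
  shows "r dvd a \<or> r dvd b \<or> r dvd c \<or> r dvd d"
proof -
  obtain a' b' c' d' where "good p a' b' c' d'" "[a' = a] (mod int p ^ k)" "[b' = b] (mod int p ^ k)"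
    "[c' = c] (mod int p ^ k)" "[d' = d] (mod int p ^ k)"
    using ex unfolding exceptional_def all_bad_def k(1) by blast
  then show ?thesis using bad_cong(1)[OF p k(2,3), of a' b' c' d' a b c d] ex unfolding exceptional_def r_def by blast
qed

text \<open>Exceptional points need not be periodic for any modulus inside the box, so they are
  counted through the divisibilities that they force. This includes primes above \<open>R\<close>,
  where \<open>max_exp\<close> is 0 and \<open>bad_dvd\<close> alone gives p^(-2).\<close>

lemma sum_exceptional_le:
  assumes p: "prime p"
  shows "S (\<lambda>a b c d. of_bool (exceptional p a b c d)) \<le> 32 * real N ^ 4 * (1 / real p) ^ max 2 (max_exp R p)"
proof -
  let ?k = "max_exp R p"
  have p0: "int p > 0" and p1: "real p > 0" using p by (auto simp: prime_gt_0_nat)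
  have le: "of_bool P \<le> (x::real)" if "P \<Longrightarrow> x \<ge> 1" "x \<ge> 0" for P x using that by auto
  have one: "S (\<lambda>a b c d. dvd4 r 1 1 1 a b c d + (dvd4 1 r 1 1 a b c d + (dvd4 1 1 r 1 a b c d + dvd4 1 1 1 r a b c d))) \<le> 4 * real N ^ 4 / of_int r"
    if "r > 0" for r
    unfolding sum4_add using sum4_dvd4_side[of r 1 1 1 N s1 s2 s3 s4] sum4_dvd4_side[of 1 r 1 1 N s1 s2 s3 s4]
      sum4_dvd4_side[of 1 1 r 1 N s1 s2 s3 s4] sum4_dvd4_side[of 1 1 1 r N s1 s2 s3 s4] that by simp
  have dv: "1 \<le> dvd4 r 1 1 1 a b c d + (dvd4 1 r 1 1 a b c d + (dvd4 1 1 r 1 a b c d + dvd4 1 1 1 r a b c d))"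
    if "r dvd a \<or> r dvd b \<or> r dvd c \<or> r dvd d" for r a b c d
    using that by (auto simp: dvd4_def)
  consider "p = 2" "?k \<le> 5" | "p = 2" "?k \<ge> 6" | "p \<noteq> 2" "?k \<le> 2" | "p \<noteq> 2" "?k \<ge> 3" by linarith
  then show ?thesis
  proof cases
    case 1
    \<comment> \<open>The trivial bound again, now with 32 / 2^5 = 1. Here the good point shares
      level \<open>?k\<close> itself, so 4 * 2^3 = 32 takes the place of 64.\<close>
    have "(1 / 2 :: real) ^ 5 \<le> (1 / 2) ^ max 2 ?k" using 1 by (intro power_decreasing) auto
    then have "1 \<le> 32 * (1 / real p) ^ max 2 ?k" using 1 by (simp add: power_divide)
    then have "real N ^ 4 * 1 \<le> real N ^ 4 * (32 * (1 / real p) ^ max 2 ?k)" by (intro mult_left_mono) auto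
    moreover have "S (\<lambda>a b c d. of_bool (exceptional p a b c d)) \<le> S (\<lambda>a b c d. 1)" by (intro sum4_mono) simp
    ultimately show ?thesis unfolding sum4_one by (simp add: mult_ac)
  next
    case 2
    define r where "r = int p ^ (?k - (iso_loss p + class_loss p))"
    have "S (\<lambda>a b c d. of_bool (exceptional p a b c d)) \<le> S (\<lambda>a b c d. dvd4 r 1 1 1 a b c d + (dvd4 1 r 1 1 a b c d + (dvd4 1 1 r 1 a b c d + dvd4 1 1 1 r a b c d)))"
    proof (rule sum4_mono, rule le, rule dv)
      fix a b c d assume "exceptional p a b c d"
      then show "r dvd a \<or> r dvd b \<or> r dvd c \<or> r dvd d"
        unfolding r_def using 2 by (intro exceptional_cong[OF p]) (auto simp: iso_loss_def class_loss_def)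
    qed (simp add: dvd4_nonneg)
    also have "\<dots> \<le> 4 * real N ^ 4 / of_int r" by (rule one) (use p0 in \<open>simp add: r_def\<close>)
    also have "\<dots> = 32 * real N ^ 4 * (1 / real p) ^ max 2 ?k"
    proof -
      have "?k = (?k - 3) + 3" using 2 by simp
      then have "(2::real) ^ ?k = 2 ^ (?k - 3) * 2 ^ 3" by (metis power_add)
      then show ?thesis using 2 by (simp add: r_def iso_loss_def class_loss_def power_divide max_def)
    qed
    finally show ?thesis .
  next
    case 3
    let ?p = "int p"
    have "S (\<lambda>a b c d. of_bool (exceptional p a b c d)) \<le> S (\<lambda>a b c d. dvd4 ?p ?p 1 1 a b c d + (dvd4 1 1 ?p ?p a b c d + (dvd4 ?p 1 ?p 1 a b c d + dvd4 1 ?p 1 ?p a b c d)))"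
    proof (rule sum4_mono, rule le)
      fix a b c d assume "exceptional p a b c d"
      then have "?p dvd a \<and> ?p dvd b \<or> ?p dvd c \<and> ?p dvd d \<or> ?p ^ 2 dvd a \<and> ?p ^ 2 dvd c \<or> ?p ^ 2 dvd b \<and> ?p ^ 2 dvd d"
        using bad_dvd[OF p 3(1)] unfolding exceptional_def by blast
      moreover have "?p ^ 2 dvd x \<Longrightarrow> ?p dvd x" for x using power_le_dvd[of ?p 2 x 1] by simp
      ultimately show "1 \<le> dvd4 ?p ?p 1 1 a b c d + (dvd4 1 1 ?p ?p a b c d + (dvd4 ?p 1 ?p 1 a b c d + dvd4 1 ?p 1 ?p a b c d))"
        by (auto simp: dvd4_def)
    qed (simp add: dvd4_nonneg)
    also have "\<dots> \<le> 4 * real N ^ 4 * (1 / real p) ^ 2"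
      unfolding sum4_add using sum4_dvd4_side[of ?p ?p 1 1 N s1 s2 s3 s4] sum4_dvd4_side[of 1 1 ?p ?p N s1 s2 s3 s4]
        sum4_dvd4_side[of ?p 1 ?p 1 N s1 s2 s3 s4] sum4_dvd4_side[of 1 ?p 1 ?p N s1 s2 s3 s4] p0
      by (simp add: power2_eq_square)
    also have "\<dots> \<le> 32 * real N ^ 4 * (1 / real p) ^ 2" by (intro mult_right_mono) auto
    finally show ?thesis using 3 by (simp add: max_def)
  next
    case 4
    define r where "r = int p ^ (?k - (iso_loss p + class_loss p))"
    have "S (\<lambda>a b c d. of_bool (exceptional p a b c d)) \<le> S (\<lambda>a b c d. dvd4 r 1 1 1 a b c d + (dvd4 1 r 1 1 a b c d + (dvd4 1 1 r 1 a b c d + dvd4 1 1 1 r a b c d)))"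
    proof (rule sum4_mono, rule le, rule dv)
      fix a b c d assume "exceptional p a b c d"
      then show "r dvd a \<or> r dvd b \<or> r dvd c \<or> r dvd d"
        unfolding r_def using 4 by (intro exceptional_cong[OF p]) (auto simp: iso_loss_def class_loss_def)
    qed (simp add: dvd4_nonneg)
    also have "\<dots> \<le> 4 * real N ^ 4 / of_int r" by (rule one) (use p0 in \<open>simp add: r_def\<close>)
    also have "\<dots> = 4 * real N ^ 4 * (1 / real p) ^ ?k"
      using 4 by (simp add: r_def iso_loss_def class_loss_def power_divide)
    also have "\<dots> \<le> 32 * real N ^ 4 * (1 / real p) ^ ?k" by (intro mult_right_mono) auto
    finally show ?thesis using 4 by (simp add: max_def)
  qed
qed

text \<open>The exponent 2/9 comes from max 2 k >= (2/9) (k + 1) + 4/3, which is an equality at k =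
  2, together with p^(k + 1) > R. The part p^(-4/3) is kept for summation over the primes.\<close>

lemma exceptional_weight:
  assumes p: "prime p"
  shows "32 * (1 / real p) ^ max 2 (max_exp R p) \<le> R powr (- (2 / 9)) * prime_weight p"
proof -
  let ?k = "max_exp R p"
  have p1: "real p > 0" "real p \<ge> 1" using prime_ge_1_nat[OF p] by auto
  have "real p powr (- real (max 2 ?k)) \<le> real p powr (- (2 / 9) * real (Suc ?k) + - (4 / 3))"
    using p1 by (intro powr_mono) (auto simp: max_def field_simps)
  also have "\<dots> = (real p ^ Suc ?k) powr (- (2 / 9)) * real p powr (- (4 / 3))"
    using p1 unfolding powr_add by (simp add: powr_realpow[symmetric] powr_powr mult.commute del: power_Suc)
  also have "\<dots> \<le> R powr (- (2 / 9)) * real p powr (- (4 / 3))"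
    using max_exp(2)[OF p R] R by (intro mult_right_mono powr_mono2') auto
  finally have "real p powr (- real (max 2 ?k)) \<le> R powr (- (2 / 9)) * real p powr (- (4 / 3))" .
  moreover have "(1 / real p) ^ max 2 ?k = real p powr (- real (max 2 ?k))"
    using p1 by (simp add: powr_minus powr_realpow power_one_over inverse_eq_divide)
  moreover have "R powr (- (2 / 9)) * real p powr (- (4 / 3)) \<ge> 0" by simp
  moreover have "R powr (- (2 / 9)) * prime_weight p = 288 * (R powr (- (2 / 9)) * real p powr (- (4 / 3)))"
    by (simp add: prime_weight_def)
  ultimately show ?thesis by linarith
qed

lemma sieve_of_bool: "sieve R a b c d = of_bool (\<forall>p\<in>D. \<not> all_bad p (max_exp R p) a b c d)"
proof (cases "\<forall>p\<in>D. \<not> all_bad p (max_exp R p) a b c d")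
  case True
  then show ?thesis unfolding sieve_def bad_ind_def by (auto intro: prod.neutral)
next
  case False
  then show ?thesis unfolding sieve_def bad_ind_def using finite_primes_le by (auto intro: prod_zero)
qed

text \<open>The sieve never rejects a good point. A bad point that it accepts is degenerate, which
  happens for at most N^3 points, or exceptional at some prime.\<close>

lemma sum_everywhere_good_sieve:
  "\<bar>S (\<lambda>a b c d. of_bool (everywhere_good a b c d)) - S (sieve R)\<bar> \<le>
     real N ^ 3 + real N ^ 4 * (R powr (- (2 / 9)) * total_weight)"
proof -
  let ?f = "\<lambda>a b c d. of_bool (everywhere_good a b c d) :: real"
  let ?P = "primes_le (real N)"
  have pt: "\<bar>?f a b c d - sieve R a b c d\<bar> \<le> of_bool (a * d = b * c) + (\<Sum>p\<in>?P. of_bool (exceptional p a b c d))"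
    if x: "a \<in> side N s1" "b \<in> side N s2" "c \<in> side N s3" "d \<in> side N s4" for a b c d
  proof -
    have nn: "(\<Sum>p\<in>?P. of_bool (exceptional p a b c d)) \<ge> (0::real)" by (intro sum_nonneg) simp
    show ?thesis
    proof (cases "everywhere_good a b c d")
      case True
      then have "sieve R a b c d = 1" unfolding sieve_of_bool everywhere_good_def using not_all_bad_of_good primes_leD(1) by auto
      then show ?thesis using True nn by simp
    next
      case ng: False
      show ?thesis
      proof (cases "(\<forall>p\<in>D. \<not> all_bad p (max_exp R p) a b c d) \<and> a * d \<noteq> b * c")
        case True
        have nd: "nondegenerate a b c d" using True x sideD by (auto simp: nondegenerate_def)
        obtain p where p: "prime p" "\<not> good p a b c d" using ng unfolding everywhere_good_def by blast
        \<comment> \<open>A prime above N divides no nonzero coefficient in the box, and N >= 2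
          makes it odd, so \<open>bad_dvd\<close> excludes it.\<close>
        have "p \<in> ?P"
        proof (rule ccontr)
          assume "p \<notin> ?P"
          then have pN: "int p > int N" using p by (simp add: primes_le_def)
          then have "p \<noteq> 2" using N by simp
          have small: "\<not> int p dvd y" if "y \<in> side N s" for y s
            using sideD[OF that] pN zdvd_imp_le[of "int p" "\<bar>y\<bar>"] by auto
          have "\<not> int p ^ 2 dvd y" if "y \<in> side N s" for y s
            using small[OF that] power_le_dvd[of "int p" 2 y 1] by auto
          then show False using bad_dvd[OF p(1) \<open>p \<noteq> 2\<close> nd p(2)] small x by blast
        qed
        moreover have "exceptional p a b c d"
        proof -
          have "\<not> all_bad p (max_exp R p) a b c d"
          proof (cases "p \<in> D")
            case False
            then have "max_exp R p = 0" using p(1) by (intro max_exp_eq_0) (auto simp: primes_le_def)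
            then show ?thesis using not_all_bad_0[OF p(1)] by simp
          qed (use True in blast)
          then show ?thesis using nd p by (simp add: exceptional_def)
        qed
        ultimately have "of_bool (exceptional p a b c d) \<le> (\<Sum>p\<in>?P. of_bool (exceptional p a b c d) :: real)"
          by (intro member_le_sum finite_primes_le) auto
        then have "(1::real) \<le> (\<Sum>p\<in>?P. of_bool (exceptional p a b c d))" using \<open>exceptional p a b c d\<close> by simp
        then show ?thesis using ng True unfolding sieve_of_bool by simp
      next
        case False
        then show ?thesis using ng nn unfolding sieve_of_bool by auto
      qed
    qed
  qed
  have "\<bar>S ?f - S (sieve R)\<bar> = \<bar>S (\<lambda>a b c d. ?f a b c d - sieve R a b c d)\<bar>" by (simp only: sum4_diff)
  also have "\<dots> \<le> S (\<lambda>a b c d. \<bar>?f a b c d - sieve R a b c d\<bar>)" by (rule sum4_abs)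
  also have "\<dots> \<le> S (\<lambda>a b c d. of_bool (a * d = b * c) + (\<Sum>p\<in>?P. of_bool (exceptional p a b c d)))"
    by (rule sum4_mono) (rule pt)
  also have "\<dots> = S (\<lambda>a b c d. of_bool (a * d = b * c)) + (\<Sum>p\<in>?P. S (\<lambda>a b c d. of_bool (exceptional p a b c d)))"
    by (simp only: sum4_add sum4_sum)
  also have "S (\<lambda>a b c d. of_bool (a * d = b * c)) \<le> real N ^ 3"
  proof -
    have "(\<Sum>d\<in>side N s4. of_bool (a * d = b * c)) \<le> (1::real)" if "a \<in> side N s1" for a b c
    proof -
      have a0: "a \<noteq> 0" using sideD[OF that] by simp
      have "{d \<in> side N s4. a * d = b * c} \<subseteq> {b * c div a}"
        using a0 by (auto, metis nonzero_mult_div_cancel_left)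
      then have "card {d \<in> side N s4. a * d = b * c} \<le> card {b * c div a}" by (rule card_mono[rotated]) simp
      then show ?thesis by (simp add: of_bool_def sum.If_cases Int_def)
    qed
    then have "S (\<lambda>a b c d. of_bool (a * d = b * c)) \<le> (\<Sum>a\<in>side N s1. \<Sum>b\<in>side N s2. \<Sum>c\<in>side N s3. 1)"
      unfolding sum4_def by (intro sum_mono)
    also have "\<dots> = real N ^ 3" by (simp add: power3_eq_cube)
    finally show ?thesis .
  qed
  also have "(\<Sum>p\<in>?P. S (\<lambda>a b c d. of_bool (exceptional p a b c d))) \<le> (\<Sum>p\<in>?P. real N ^ 4 * (R powr (- (2 / 9)) * prime_weight p))"
  proof (rule sum_mono)
    fix p assume "p \<in> ?P"
    then have p: "prime p" by (rule primes_leD)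
    have "S (\<lambda>a b c d. of_bool (exceptional p a b c d)) \<le> real N ^ 4 * (32 * (1 / real p) ^ max 2 (max_exp R p))"
      using sum_exceptional_le[OF p] by (simp add: mult_ac)
    also have "\<dots> \<le> real N ^ 4 * (R powr (- (2 / 9)) * prime_weight p)"
      by (intro mult_left_mono exceptional_weight[OF p]) simp
    finally show "S (\<lambda>a b c d. of_bool (exceptional p a b c d)) \<le> real N ^ 4 * (R powr (- (2 / 9)) * prime_weight p)" .
  qed
  also have "\<dots> = real N ^ 4 * (R powr (- (2 / 9)) * sum prime_weight ?P)" by (simp only: sum_distrib_left)
  also have "\<dots> \<le> real N ^ 4 * (R powr (- (2 / 9)) * total_weight)"
    by (intro mult_left_mono sum_prime_weight_le finite_primes_le) auto
  finally show ?thesis by simp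
qed

end
subsection \<open>The counting function\<close>

lemma everywhere_good_asymptotic:
  obtains C where "C \<ge> 0" "\<And>N s1 s2 s3 s4. N \<ge> 2 \<Longrightarrow>
    \<bar>sum4 (side N s1) (side N s2) (side N s3) (side N s4) (\<lambda>a b c d. of_bool (everywhere_good a b c d)) - tau_fin * real N ^ 4\<bar>
      \<le> C * real N powr (31 / 8)"
proof -
  \<comment> \<open>The divisor bound is applied to a number of size at most 2 N^4, so 1/480 costs
    N^(1/120), which is the gap between 2/15 and 1/8.\<close>
  have "(1 / 480 :: real) > 0" by simp
  then obtain B where B: "B \<ge> 1"
    "\<And>S. finite S \<Longrightarrow> (\<And>p. p \<in> S \<Longrightarrow> prime p) \<Longrightarrow> 2 ^ card S \<le> B * real (\<Prod>S) powr (1 / 480)"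
    using two_power_card_le by blast
  let ?V = total_weight
  define b where "b = B * 2 powr (1 / 480)"
  have b0: "b \<ge> 0" using B by (simp add: b_def)
  define C where "C = 1 + ?V + exp ?V * (15 + 1 + 16 * b) + ?V"
  have C0: "C \<ge> 0" using total_weight_nonneg b0 by (simp add: C_def)
  have main: "\<bar>sum4 (side N s1) (side N s2) (side N s3) (side N s4) (\<lambda>a b c d. of_bool (everywhere_good a b c d)) - tau_fin * real N ^ 4\<bar>
      \<le> C * real N powr (31 / 8)" if N: "N \<ge> 2" for N s1 s2 s3 s4
  proof -
    define n where "n = real N"
    have n: "n \<ge> 2" "n > 0" using N by (auto simp: n_def)
    define R where "R = n powr (3 / 5)"
    define Q where "Q = n powr (2 / 5)"
    have QR: "Q * R = n" using n by (simp add: Q_def R_def flip: powr_add)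
    have RQ1: "R \<ge> 1" "Q \<ge> 1" using n by (auto simp: R_def Q_def ge_one_powr_ge_zero)
    interpret box N s1 s2 s3 s4 R Q
      by unfold_locales (use N RQ1 QR in \<open>auto simp: n_def\<close>)
    let ?f = "\<lambda>a b c d. of_bool (everywhere_good a b c d) :: real"
    let ?Pi = "\<Prod>p\<in>D. 1 - bad_density p (max_exp R p)"
    define z where "z = n powr (31 / 8)"
    have z0: "z \<ge> 0" by (simp add: z_def)
    have mono: "n powr r \<le> z" if "r \<le> 31 / 8" for r unfolding z_def using n that by (intro powr_mono) auto
    have n3: "n ^ 3 = n powr 3" and n4: "n ^ 4 = n powr 4" using n by (simp_all flip: powr_numeral)
    have t1: "n ^ 3 \<le> z" unfolding n3 by (rule mono) simp
    have t2: "n ^ 4 * R powr (- (2 / 9)) \<le> z"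
    proof -
      have "n ^ 4 * R powr (- (2 / 9)) = n powr (4 - 2 / 15)" unfolding n4 R_def by (simp add: powr_powr flip: powr_add)
      also have "\<dots> \<le> z" by (rule mono) simp
      finally show ?thesis .
    qed
    have t3: "n ^ 3 * Q \<le> z"
    proof -
      have "n ^ 3 * Q = n powr (17 / 5)" unfolding n3 Q_def by (simp flip: powr_add)
      also have "\<dots> \<le> z" by (rule mono) simp
      finally show ?thesis .
    qed
    have t4: "n ^ 4 * Q powr (- (1 / 3)) \<le> z"
    proof -
      have "n ^ 4 * Q powr (- (1 / 3)) = n powr (4 - 2 / 15)" unfolding n4 Q_def by (simp add: powr_powr flip: powr_add)
      also have "\<dots> \<le> z" by (rule mono) simp
      finally show ?thesis .
    qed
    have t5: "B * (2 * n ^ 4) powr (1 / 480) * 16 * n ^ 4 * Q powr (- (1 / 3)) \<le> 16 * b * z"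
    proof -
      have "(2 * n ^ 4) powr (1 / 480) = 2 powr (1 / 480) * n powr (1 / 120)"
      proof -
        have "(2 * n ^ 4) powr (1 / 480) = 2 powr (1 / 480) * (n ^ 4) powr (1 / 480)" by (simp add: powr_mult)
        also have "(n ^ 4) powr (1 / 480) = n powr (1 / 120)" unfolding n4 powr_powr by simp
        finally show ?thesis .
      qed
      then have "B * (2 * n ^ 4) powr (1 / 480) * 16 * n ^ 4 * Q powr (- (1 / 3)) =
          16 * b * (n powr (1 / 120) * (n ^ 4 * Q powr (- (1 / 3))))" by (simp add: b_def)
      also have "n powr (1 / 120) * (n ^ 4 * Q powr (- (1 / 3))) = n powr (31 / 8)"
        unfolding n4 Q_def by (simp add: powr_powr flip: powr_add)
      finally show ?thesis by (simp add: z_def)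
    qed
    have t6: "n ^ 4 * R powr (- (1 / 3)) \<le> z"
    proof -
      have "n ^ 4 * R powr (- (1 / 3)) = n powr (4 - 1 / 5)" unfolding n4 R_def by (simp add: powr_powr flip: powr_add)
      also have "\<dots> \<le> z" by (rule mono) simp
      finally show ?thesis .
    qed
    have "\<bar>S ?f - S (sieve R)\<bar> \<le> n ^ 3 + (n ^ 4 * R powr (- (2 / 9))) * ?V"
      using sum_everywhere_good_sieve by (simp add: n_def mult.assoc)
    also have "\<dots> \<le> z + z * ?V" using t1 t2 total_weight_nonneg by (intro add_mono mult_right_mono) auto
    finally have e1: "\<bar>S ?f - S (sieve R)\<bar> \<le> z + z * ?V" .
    have "\<bar>S (sieve R) - n ^ 4 * ?Pi\<bar> \<le> exp ?V * (15 * (n ^ 3 * Q) + n ^ 4 * Q powr (- (1 / 3)) +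
        B * (2 * n ^ 4) powr (1 / 480) * 16 * n ^ 4 * Q powr (- (1 / 3)))"
      using sum_sieve[OF B] by (simp add: n_def mult.assoc)
    also have "\<dots> \<le> exp ?V * (15 * z + z + 16 * b * z)"
      using t3 t4 t5 by (intro mult_left_mono add_mono) auto
    finally have e2: "\<bar>S (sieve R) - n ^ 4 * ?Pi\<bar> \<le> exp ?V * (15 * z + z + 16 * b * z)" .
    have "\<bar>n ^ 4 * ?Pi - n ^ 4 * tau_fin\<bar> = n ^ 4 * \<bar>?Pi - tau_fin\<bar>"
      using n by (simp add: abs_mult flip: right_diff_distrib)
    also have "\<dots> \<le> n ^ 4 * (R powr (- (1 / 3)) * ?V)" using tau_fin_approx[OF R] by (intro mult_left_mono) auto
    also have "\<dots> = (n ^ 4 * R powr (- (1 / 3))) * ?V" by simp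
    also have "\<dots> \<le> z * ?V" using t6 total_weight_nonneg by (intro mult_right_mono) auto
    finally have e3: "\<bar>n ^ 4 * ?Pi - n ^ 4 * tau_fin\<bar> \<le> z * ?V" .
    have "\<bar>S ?f - n ^ 4 * tau_fin\<bar> \<le> (z + z * ?V) + exp ?V * (15 * z + z + 16 * b * z) + z * ?V"
      using e1 e2 e3 by linarith
    also have "\<dots> = C * z" by (simp add: C_def algebra_simps)
    finally show ?thesis unfolding z_def n_def by (simp add: mult.commute)
  qed
  show ?thesis using that[OF C0 main] .
qed

section \<open>Global gcd conditions as conjunctions of local ones\<close>

lemma all_int_primes_iff: "(\<forall>q::int. prime q \<longrightarrow> P q) \<longleftrightarrow> (\<forall>p::nat. prime p \<longrightarrow> P (int p))"
proof
  assume L: "\<forall>p::nat. prime p \<longrightarrow> P (int p)"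
  show "\<forall>q::int. prime q \<longrightarrow> P q"
  proof (intro allI impI)
    fix q :: int assume q: "prime q"
    then have "q = int (nat q)" using prime_ge_0_int by simp
    then show "P q" using L q by (metis prime_nat_int_transfer)
  qed
qed auto

lemma gcd_in_set_A_iff:
  assumes "a \<noteq> 0"
  shows "gcd a b \<in> set_A \<longleftrightarrow> (\<forall>p. prime p \<longrightarrow> \<not> (int p ^ 2 dvd a \<and> int p ^ 2 dvd b))"
proof -
  have g: "gcd a b \<noteq> 0" "gcd a b > 0" using assms by auto
  have "gcd a b \<in> set_A \<longleftrightarrow> (\<forall>q::int. prime q \<longrightarrow> \<not> q ^ 2 dvd gcd a b)"
    unfolding set_A_def using squarefree_factorial_semiring[OF g(1)] g(2) by simp
  then show ?thesis unfolding all_int_primes_iff by simp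
qed

lemma gcd_in_set_B_iff:
  assumes "a \<noteq> 0"
  shows "gcd a b \<in> set_B \<longleftrightarrow>
    (\<forall>p. prime p \<longrightarrow> \<not> (int p ^ (if [p = 3] (mod 4) then 2 else 1) dvd a \<and> int p ^ (if [p = 3] (mod 4) then 2 else 1) dvd b))"
proof -
  have 3: "[int p = 3] (mod 4) \<longleftrightarrow> [p = 3] (mod 4)" for p
    using cong_int_iff[of p 3 4] by simp
  have "gcd a b \<in> set_B \<longleftrightarrow> gcd a b \<in> set_A \<and> (\<forall>q::int. prime q \<longrightarrow> q dvd gcd a b \<longrightarrow> [q = 3] (mod 4))"
    unfolding set_B_def by blast
  also have "\<dots> \<longleftrightarrow> (\<forall>p. prime p \<longrightarrow> \<not> (int p ^ 2 dvd a \<and> int p ^ 2 dvd b)) \<and>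
      (\<forall>p. prime p \<longrightarrow> int p dvd a \<and> int p dvd b \<longrightarrow> [p = 3] (mod 4))"
    unfolding gcd_in_set_A_iff[OF assms] all_int_primes_iff 3 by simp
  also have "\<dots> \<longleftrightarrow> (\<forall>p. prime p \<longrightarrow> \<not> (int p ^ (if [p = 3] (mod 4) then 2 else 1) dvd a \<and> int p ^ (if [p = 3] (mod 4) then 2 else 1) dvd b))"
  proof -
    have "int p ^ 2 dvd x \<Longrightarrow> int p dvd x" for p x using power_le_dvd[of "int p" 2 x 1] by simp
    then show ?thesis by (auto split: if_splits)
  qed
  finally show ?thesis .
qed

lemma Gcd_eq_1_iff:
  fixes a b c d :: int
  assumes "a \<noteq> 0"
  shows "Gcd {a, b, c, d} = 1 \<longleftrightarrow> (\<forall>p. prime p \<longrightarrow> \<not> (int p dvd a \<and> int p dvd b \<and> int p dvd c \<and> int p dvd d))"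
proof
  assume G: "Gcd {a, b, c, d} = 1"
  show "\<forall>p. prime p \<longrightarrow> \<not> (int p dvd a \<and> int p dvd b \<and> int p dvd c \<and> int p dvd d)"
  proof (intro allI impI notI)
    fix p :: nat assume p: "prime p" and "int p dvd a \<and> int p dvd b \<and> int p dvd c \<and> int p dvd d"
    then have "int p dvd Gcd {a, b, c, d}" by (intro Gcd_greatest) auto
    then have "int p dvd 1" unfolding G .
    then show False using p by simp
  qed
next
  assume R: "\<forall>p. prime p \<longrightarrow> \<not> (int p dvd a \<and> int p dvd b \<and> int p dvd c \<and> int p dvd d)"
  have dv: "Gcd {a, b, c, d} dvd a" "Gcd {a, b, c, d} dvd b" "Gcd {a, b, c, d} dvd c" "Gcd {a, b, c, d} dvd d"
    by (intro Gcd_dvd; simp)+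
  have G0: "Gcd {a, b, c, d} \<noteq> 0" using dv(1) assms by (metis dvd_0_left_iff)
  have "is_unit (Gcd {a, b, c, d})"
  proof (rule ccontr)
    assume "\<not> is_unit (Gcd {a, b, c, d})"
    then obtain q where q: "q dvd Gcd {a, b, c, d}" "prime q" using prime_divisor_exists[OF G0] by blast
    have "q dvd a \<and> q dvd b \<and> q dvd c \<and> q dvd d" using q(1) dv dvd_trans by blast
    then show False using R q(2) all_int_primes_iff[of "\<lambda>q. \<not> (q dvd a \<and> q dvd b \<and> q dvd c \<and> q dvd d)"] by blast
  qed
  then have "\<bar>Gcd {a, b, c, d}\<bar> = 1" by simp
  moreover have "Gcd {a, b, c, d} \<ge> 0" by (rule Gcd_int_greater_eq_0)
  ultimately show "Gcd {a, b, c, d} = 1" by simp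
qed

definition admissible :: "int \<Rightarrow> int \<Rightarrow> int \<Rightarrow> int \<Rightarrow> bool" where
  "admissible a b c d \<longleftrightarrow> everywhere_good a b c d \<and> soluble_real a b c d"

text \<open>All conditions on the gcds are conditions prime by prime, so membership in the counted
  set means being \<open>good\<close> at every prime plus the real condition. This is the form that
  the sieve treats.\<close>

lemma admissible_iff:
  "admissible a b c d \<longleftrightarrow> Gcd {a, b, c, d} = 1 \<and> nondegenerate a b c d \<and>
        gcd a c \<in> set_A \<and> gcd b d \<in> set_A \<and> gcd a b \<in> set_B \<and> gcd c d \<in> set_B \<and> everywhere_locally_soluble a b c d"
proof (cases "nondegenerate a b c d")
  case True
  then have nz: "a \<noteq> 0" "b \<noteq> 0" "c \<noteq> 0" "d \<noteq> 0" by (auto simp: nondegenerate_def)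
  show ?thesis
    unfolding admissible_def everywhere_good_def good_def gcd_ok_def Let_def everywhere_locally_soluble_def
      Gcd_eq_1_iff[OF nz(1)] gcd_in_set_A_iff[OF nz(1)] gcd_in_set_A_iff[OF nz(2)]
      gcd_in_set_B_iff[OF nz(1)] gcd_in_set_B_iff[OF nz(3)]
    using True by blast
next
  case False
  have "\<not> everywhere_good a b c d" using False two_is_prime_nat unfolding everywhere_good_def good_def by blast
  then show ?thesis using False by (simp add: admissible_def)
qed

lemma nondegenerate_minus: "nondegenerate (- a) (- b) (- c) (- d) \<longleftrightarrow> nondegenerate a b c d"
  by (simp add: nondegenerate_def)

lemma soluble_padic_minus:
  assumes "prime p" shows "soluble_padic p (- a) (- b) (- c) (- d) \<longleftrightarrow> soluble_padic p a b c d"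
proof -
  have "(of_int (- a) * u + of_int (- b) * v) * (of_int (- c) * u + of_int (- d) * v) =
    (of_int a * u + of_int b * v) * (of_int c * u + of_int d * v)" for u v :: rat
    by (simp add: algebra_simps)
  then show ?thesis unfolding soluble_padic_iff[OF assms] by simp
qed

lemma admissible_minus: "admissible (- a) (- b) (- c) (- d) \<longleftrightarrow> admissible a b c d"
proof (cases "nondegenerate a b c d")
  case True
  have "soluble_real (- a) (- b) (- c) (- d) \<longleftrightarrow> soluble_real a b c d"
    using True nondegenerate_minus[of a b c d] by (auto simp: soluble_real_iff)
  moreover have "everywhere_good (- a) (- b) (- c) (- d) \<longleftrightarrow> everywhere_good a b c d"
    unfolding everywhere_good_def good_def gcd_ok_def Let_def
    by (simp add: nondegenerate_minus soluble_padic_minus cong: imp_cong)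
  ultimately show ?thesis by (simp add: admissible_def)
next
  case False
  then show ?thesis using nondegenerate_minus[of a b c d] by (simp add: admissible_iff)
qed

section \<open>From sign classes to orthants\<close>

definition signed :: "nat \<Rightarrow> int set" where "signed N = side N True \<union> side N False"

lemma finite_signed [simp]: "finite (signed N)"
  by (simp add: signed_def)

lemma signed_iff: "a \<in> signed N \<longleftrightarrow> a \<noteq> 0 \<and> \<bar>a\<bar> \<le> int N"
  by (auto simp: signed_def side_def)

lemma sum_signed: "(\<Sum>a\<in>signed N. f a) = (\<Sum>a\<in>side N True. f a) + (\<Sum>a\<in>side N False. f a)"
  unfolding signed_def by (rule sum.union_disjoint) (auto simp: side_def)

text \<open>1/8 is the factor 1/4 of \<open>N_loc\<close> times 1/2: every sign class has two
  members because the coefficients are nonzero. \<open>admissible\<close> is invariant under the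
  sign change, so the representative that witnesses the height may be either of them.\<close>

lemma N_loc_eq:
  assumes P: "P \<ge> 0" and N: "N = nat \<lfloor>P\<rfloor>"
  shows "N_loc P = 1 / 8 * sum4 (signed N) (signed N) (signed N) (signed N) (\<lambda>a b c d. of_bool (admissible a b c d))"
proof -
  define G where "G = {(a, b, c, d). a \<in> signed N \<and> b \<in> signed N \<and> c \<in> signed N \<and> d \<in> signed N \<and> admissible a b c d}"
  define neg where "neg = (\<lambda>(a, b, c, d). (- a, - b, - c, - d) :: int \<times> int \<times> int \<times> int)"
  let ?cls = "\<lambda>v. sign_rel `` {v}"
  let ?T = "{x \<in> S_tot. \<exists>(a, b, c, d) \<in> x.
        real_of_int (Max {\<bar>a\<bar>, \<bar>b\<bar>, \<bar>c\<bar>, \<bar>d\<bar>}) \<le> P \<and> everywhere_locally_soluble a b c d}"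
  have cls: "?cls v = {v, neg v}" for v unfolding sign_rel_def neg_def by (cases v) auto
  have negneg: "neg (neg v) = v" for v by (cases v) (simp add: neg_def)
  have Gneg: "neg v \<in> G \<longleftrightarrow> v \<in> G" for v
    by (cases v) (simp add: G_def neg_def signed_iff admissible_minus)
  have G0: "neg v \<noteq> v" if "v \<in> G" for v
    using that by (cases v) (auto simp: G_def neg_def signed_iff)
  have finG: "finite G"
  proof (rule finite_subset)
    show "G \<subseteq> signed N \<times> signed N \<times> signed N \<times> signed N" by (auto simp: G_def)
  qed simp
  have bound: "real_of_int (Max {\<bar>a\<bar>, \<bar>b\<bar>, \<bar>c\<bar>, \<bar>d\<bar>}) \<le> P \<longleftrightarrow>
      \<bar>a\<bar> \<le> int N \<and> \<bar>b\<bar> \<le> int N \<and> \<bar>c\<bar> \<le> int N \<and> \<bar>d\<bar> \<le> int N" for a b c d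
  proof -
    have "real_of_int x \<le> P \<longleftrightarrow> x \<le> int N" for x using P N by (simp add: le_floor_iff)
    then show ?thesis by simp
  qed
  have inG: "(a, b, c, d) \<in> G \<longleftrightarrow> \<bar>a\<bar> \<le> int N \<and> \<bar>b\<bar> \<le> int N \<and> \<bar>c\<bar> \<le> int N \<and> \<bar>d\<bar> \<le> int N \<and> admissible a b c d" for a b c d
    unfolding G_def using admissible_iff[of a b c d] by (auto simp: signed_iff nondegenerate_def)
  define A where "A = {(a, b, c, d). Gcd {a, b, c, d} = 1 \<and> nondegenerate a b c d \<and>
        gcd a c \<in> set_A \<and> gcd b d \<in> set_A \<and> gcd a b \<in> set_B \<and> gcd c d \<in> set_B}"
  have S_tot: "S_tot = A // sign_rel" unfolding S_tot_def A_def ..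
  have adm: "admissible a b c d \<longleftrightarrow> (a, b, c, d) \<in> A \<and> everywhere_locally_soluble a b c d" for a b c d
    unfolding admissible_iff A_def mem_Collect_eq case_prod_conv by blast
  have nd: "nondegenerate a b c d" if "(a, b, c, d) \<in> A" for a b c d
    using that unfolding A_def by blast
  have T: "?T = ?cls ` G"
  proof (intro equalityI subsetI)
    fix x assume x: "x \<in> ?T"
    then have "x \<in> A // sign_rel" unfolding S_tot by blast
    then obtain v where v: "x = ?cls v" "v \<in> A" by (rule quotientE)
    obtain w where w: "w \<in> x" "case w of (a, b, c, d) \<Rightarrow>
        real_of_int (Max {\<bar>a\<bar>, \<bar>b\<bar>, \<bar>c\<bar>, \<bar>d\<bar>}) \<le> P \<and> everywhere_locally_soluble a b c d" using x by blast
    obtain a b c d where w': "w = (a, b, c, d)" by (cases w) auto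
    have ht: "real_of_int (Max {\<bar>a\<bar>, \<bar>b\<bar>, \<bar>c\<bar>, \<bar>d\<bar>}) \<le> P" and els: "everywhere_locally_soluble a b c d"
      using w(2) unfolding w' case_prod_conv by blast+
    have vw: "(a, b, c, d) = v \<or> (a, b, c, d) = neg v" using v(1) w(1) unfolding cls w' by blast
    obtain a' b' c' d' where v': "v = (a', b', c', d')" by (cases v) auto
    have "admissible a b c d"
    proof (cases "(a, b, c, d) = v")
      case True
      then show ?thesis using v(2) els unfolding adm by blast
    next
      case False
      then have n: "a = - a'" "b = - b'" "c = - c'" "d = - d'" using vw v' by (auto simp: neg_def)
      have nd': "nondegenerate a' b' c' d'" using nd v(2) v' by blast
      have "soluble_real a' b' c' d' \<longleftrightarrow> soluble_real a b c d"
        using nd' nondegenerate_minus[of a' b' c' d'] unfolding n by (auto simp: soluble_real_iff)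
      then have "everywhere_locally_soluble a' b' c' d'"
        using els soluble_padic_minus[of _ a' b' c' d'] unfolding everywhere_locally_soluble_def n by blast
      then have "admissible a' b' c' d'" using v(2) v' unfolding adm by blast
      then show ?thesis unfolding n admissible_minus .
    qed
    then have "(a, b, c, d) \<in> G" using ht unfolding bound inG by blast
    then have "v \<in> G" using vw Gneg by metis
    then show "x \<in> ?cls ` G" using v by blast
  next
    fix x assume "x \<in> ?cls ` G"
    then obtain a b c d where x: "x = ?cls (a, b, c, d)" and g: "(a, b, c, d) \<in> G" by auto
    have ad: "admissible a b c d" using g unfolding inG by blast
    have "x \<in> S_tot" unfolding S_tot x using ad adm by (intro quotientI) blast
    moreover have "(a, b, c, d) \<in> x" unfolding x cls by simp
    moreover have "real_of_int (Max {\<bar>a\<bar>, \<bar>b\<bar>, \<bar>c\<bar>, \<bar>d\<bar>}) \<le> P" using g unfolding bound inG by blast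
    moreover have "everywhere_locally_soluble a b c d" using ad adm by blast
    ultimately show "x \<in> ?T" by blast
  qed
  have pair: "{v, neg v} = {u, neg u}" if "u \<in> {v, neg v}" for u v
  proof (cases "u = v")
    case False
    then have "u = neg v" using that by simp
    then show ?thesis by (simp only: negneg insert_commute)
  qed simp
  have "2 * card ?T = card (\<Union>?T)" unfolding T
  proof (rule card_partition)
    have U: "\<Union>(?cls ` G) = G" unfolding cls using Gneg by auto
    show "finite (\<Union>(?cls ` G))" unfolding U by (rule finG)
    show "finite (?cls ` G)" using finG by simp
    show "card c = 2" if c: "c \<in> ?cls ` G" for c
    proof -
      obtain v where v: "v \<in> G" "c = {v, neg v}" using c unfolding cls by blast
      then show ?thesis using G0[OF v(1)] by (metis card_2_iff)
    qed
    show "c1 \<inter> c2 = {}" if c: "c1 \<in> ?cls ` G" "c2 \<in> ?cls ` G" "c1 \<noteq> c2" for c1 c2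
    proof (rule ccontr)
      assume "c1 \<inter> c2 \<noteq> {}"
      then obtain u where u: "u \<in> c1" "u \<in> c2" by blast
      obtain v1 v2 where "c1 = {v1, neg v1}" "c2 = {v2, neg v2}" using c unfolding cls by blast
      then have "c1 = {u, neg u}" "c2 = {u, neg u}" using pair u by blast+
      then show False using c(3) by simp
    qed
  qed
  also have "\<Union>?T = G" unfolding T cls using Gneg by auto
  also have "real (card G) = sum4 (signed N) (signed N) (signed N) (signed N) (\<lambda>a b c d. of_bool (admissible a b c d))"
    unfolding G_def by (rule sum4_of_bool_eq_card[symmetric]) simp_all
  finally show ?thesis unfolding N_loc_def by simp
qed

lemma sum_admissible_orthant:
  assumes "N \<ge> 2"
  shows "sum4 (side N s1) (side N s2) (side N s3) (side N s4) (\<lambda>a b c d. of_bool (admissible a b c d)) =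
    (if s1 = s2 \<and> s3 = s4 \<and> s1 \<noteq> s3 then 0 else
      sum4 (side N s1) (side N s2) (side N s3) (side N s4) (\<lambda>a b c d. of_bool (everywhere_good a b c d)))"
proof -
  have sg: "x \<in> side N s \<Longrightarrow> (x > 0 \<longleftrightarrow> s) \<and> (x < 0 \<longleftrightarrow> \<not> s)" for x s by (auto simp: side_def split: if_splits)
  have gen: "of_bool A = (if Y then 0 else of_bool E :: real)" if "A \<longleftrightarrow> \<not> Y" E for A Y E
    using that by simp
  have "of_bool (admissible a b c d) = (if s1 = s2 \<and> s3 = s4 \<and> s1 \<noteq> s3 then 0 else of_bool (everywhere_good a b c d) :: real)"
    if x: "a \<in> side N s1" "b \<in> side N s2" "c \<in> side N s3" "d \<in> side N s4" for a b c d
  proof (cases "everywhere_good a b c d")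
    case True
    then have nd: "nondegenerate a b c d" using two_is_prime_nat unfolding everywhere_good_def good_def by blast
    have "soluble_real a b c d \<longleftrightarrow> \<not> (s1 = s2 \<and> s3 = s4 \<and> s1 \<noteq> s3)"
      unfolding soluble_real_iff[OF nd] using sg[OF x(1)] sg[OF x(2)] sg[OF x(3)] sg[OF x(4)] by auto
    then have "admissible a b c d \<longleftrightarrow> \<not> (s1 = s2 \<and> s3 = s4 \<and> s1 \<noteq> s3)" using True unfolding admissible_def by blast
    then show ?thesis using True by (rule gen)
  qed (simp add: admissible_def)
  then have "sum4 (side N s1) (side N s2) (side N s3) (side N s4) (\<lambda>a b c d. of_bool (admissible a b c d)) =
    sum4 (side N s1) (side N s2) (side N s3) (side N s4)
      (\<lambda>a b c d. if s1 = s2 \<and> s3 = s4 \<and> s1 \<noteq> s3 then 0 else of_bool (everywhere_good a b c d) :: real)"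
    by (intro sum4_cong) blast
  moreover have "sum4 A B C D (\<lambda>a b c d. if Y then 0 else h a b c d) = (if Y then 0 else sum4 A B C D h)" for A B C D Y h
    by (cases Y) (simp_all add: sum4_def)
  ultimately show ?thesis by (simp only:)
qed

lemma sum4_signed:
  "sum4 (signed N) (signed N) (signed N) (signed N) h =
    (\<Sum>s1\<in>UNIV. \<Sum>s2\<in>UNIV. \<Sum>s3\<in>UNIV. \<Sum>s4\<in>UNIV. sum4 (side N s1) (side N s2) (side N s3) (side N s4) h)"
  unfolding sum4_def sum_signed UNIV_bool by (simp add: sum.distrib)

lemma N_loc_asymptotic:
  obtains C where "C \<ge> 0" "\<And>P. P \<ge> 2 \<Longrightarrow> \<bar>N_loc P - tau_loc * P ^ 4\<bar> \<le> C * P powr (31 / 8)"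
proof -
  obtain C where C: "C \<ge> 0" "\<And>N s1 s2 s3 s4. N \<ge> 2 \<Longrightarrow>
    \<bar>sum4 (side N s1) (side N s2) (side N s3) (side N s4) (\<lambda>a b c d. of_bool (everywhere_good a b c d)) - tau_fin * real N ^ 4\<bar>
      \<le> C * real N powr (31 / 8)" using everywhere_good_asymptotic by blast
  define C' where "C' = 14 / 8 * C + 7 * \<bar>tau_fin\<bar>"
  have C'0: "C' \<ge> 0" using C by (simp add: C'_def)
  have "\<bar>N_loc P - tau_loc * P ^ 4\<bar> \<le> C' * P powr (31 / 8)" if P: "P \<ge> 2" for P
  proof -
    define N where "N = nat \<lfloor>P\<rfloor>"
    have N: "N \<ge> 2" using P by (simp add: N_def le_nat_iff le_floor_iff)
    have NP: "real N \<le> P" "P < real N + 1" using P unfolding N_def by linarith+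
    define t where "t = tau_fin * real N ^ 4"
    define z where "z = C * real N powr (31 / 8)"
    define \<phi> where "\<phi> s1 s2 s3 s4 = sum4 (side N s1) (side N s2) (side N s3) (side N s4) (\<lambda>a b c d. of_bool (everywhere_good a b c d))" for s1 s2 s3 s4
    have \<phi>: "\<bar>\<phi> s1 s2 s3 s4 - t\<bar> \<le> z" for s1 s2 s3 s4 unfolding \<phi>_def t_def z_def by (rule C(2)[OF N])
    \<comment> \<open>Fourteen of the sixteen orthants remain; the sign patterns ++-- and --++ are
      insoluble over the reals.\<close>
    have "sum4 (signed N) (signed N) (signed N) (signed N) (\<lambda>a b c d. of_bool (admissible a b c d)) =
      \<phi> True True True True + \<phi> True True True False + \<phi> True True False True +
      \<phi> True False True True + \<phi> True False True False + \<phi> True False False True + \<phi> True False False False +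
      \<phi> False True True True + \<phi> False True True False + \<phi> False True False True + \<phi> False True False False +
      \<phi> False False True False + \<phi> False False False True + \<phi> False False False False"
      unfolding sum4_signed sum_admissible_orthant[OF N] \<phi>_def[symmetric] UNIV_bool by simp
    then have "\<bar>sum4 (signed N) (signed N) (signed N) (signed N) (\<lambda>a b c d. of_bool (admissible a b c d)) - 14 * t\<bar> \<le> 14 * z"
      using \<phi>[of True True True True] \<phi>[of True True True False] \<phi>[of True True False True]
        \<phi>[of True False True True] \<phi>[of True False True False] \<phi>[of True False False True] \<phi>[of True False False False]
        \<phi>[of False True True True] \<phi>[of False True True False] \<phi>[of False True False True] \<phi>[of False True False False]
        \<phi>[of False False True False] \<phi>[of False False False True] \<phi>[of False False False False]
      unfolding abs_le_iff by linarith
    moreover have "N_loc P = 1 / 8 * sum4 (signed N) (signed N) (signed N) (signed N) (\<lambda>a b c d. of_bool (admissible a b c d))"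
      by (rule N_loc_eq) (use P N_def in auto)
    ultimately have 1: "\<bar>N_loc P - 14 / 8 * t\<bar> \<le> 14 / 8 * z" by linarith
    have tau: "tau_loc = 7 / 4 * tau_fin" by (simp add: tau_loc_def tau_infinity_def tau_fin_def)
    \<comment> \<open>Heights are integers, so \<open>P\<close> may be replaced by its floor; this
      moves the main term by O(P^3) only.\<close>
    have pw: "\<bar>real N ^ 4 - P ^ 4\<bar> \<le> 4 * P ^ 3"
    proof -
      have "P ^ 4 - real N ^ 4 = (P - real N) * (P + real N) * (P ^ 2 + real N ^ 2)"
        by (simp add: power4_eq_xxxx power2_eq_square algebra_simps)
      also have "\<dots> \<le> 1 * (2 * P) * (2 * P ^ 2)"
      proof (intro mult_mono mult_nonneg_nonneg)
        have "real N ^ 2 \<le> P ^ 2" using NP by (intro power_mono) auto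
        then show "P ^ 2 + real N ^ 2 \<le> 2 * P ^ 2" by simp
      qed (use NP P in auto)
      also have "\<dots> = 4 * P ^ 3" by (simp add: power3_eq_cube power2_eq_square)
      finally have "P ^ 4 - real N ^ 4 \<le> 4 * P ^ 3" .
      moreover have "real N ^ 4 \<le> P ^ 4" using NP by (intro power_mono) auto
      ultimately show ?thesis by linarith
    qed
    have P3: "P ^ 3 \<le> P powr (31 / 8)"
    proof -
      have "P ^ 3 = P powr 3" using P by (simp flip: powr_numeral)
      also have "\<dots> \<le> P powr (31 / 8)" using P by (intro powr_mono) auto
      finally show ?thesis .
    qed
    have "\<bar>14 / 8 * t - tau_loc * P ^ 4\<bar> = 7 / 4 * (\<bar>tau_fin\<bar> * \<bar>real N ^ 4 - P ^ 4\<bar>)"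
    proof -
      have "14 / 8 * t - tau_loc * P ^ 4 = 7 / 4 * (tau_fin * (real N ^ 4 - P ^ 4))"
        unfolding tau t_def by (simp add: right_diff_distrib)
      moreover have "\<bar>7 / 4 * (x * y)\<bar> = 7 / 4 * (\<bar>x\<bar> * \<bar>y\<bar>)" for x y :: real by (simp add: abs_mult)
      ultimately show ?thesis by (simp only:)
    qed
    also have "\<dots> \<le> 7 / 4 * (\<bar>tau_fin\<bar> * (4 * P powr (31 / 8)))"
      using pw P3 by (intro mult_left_mono) auto
    finally have 2: "\<bar>14 / 8 * t - tau_loc * P ^ 4\<bar> \<le> 7 * \<bar>tau_fin\<bar> * P powr (31 / 8)" by simp
    have 3: "z \<le> C * P powr (31 / 8)" unfolding z_def using C(1) NP by (intro mult_left_mono powr_mono2) auto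
    have "\<bar>N_loc P - tau_loc * P ^ 4\<bar> \<le> 14 / 8 * (C * P powr (31 / 8)) + 7 * \<bar>tau_fin\<bar> * P powr (31 / 8)"
      using 1 2 3 by linarith
    then show ?thesis by (simp add: C'_def algebra_simps)
  qed
  then show ?thesis using that C'0 by blast
qed

theorem theorem1p1:
  fixes \<epsilon> :: real
  assumes "\<epsilon> > 0"
  shows "(\<lambda>P. N_loc P - tau_loc * P ^ 4) \<in> O[at_top](\<lambda>P. P powr (4 - 1 / 8 + \<epsilon>))"
proof -
  obtain C where C: "C \<ge> 0" "\<And>P. P \<ge> 2 \<Longrightarrow> \<bar>N_loc P - tau_loc * P ^ 4\<bar> \<le> C * P powr (31 / 8)"
    using N_loc_asymptotic by blast
  show ?thesis
  proof (rule bigoI)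
    show "eventually (\<lambda>P. norm (N_loc P - tau_loc * P ^ 4) \<le> C * norm (P powr (4 - 1 / 8 + \<epsilon>))) at_top"
      using eventually_ge_at_top[of 2]
    proof eventually_elim
      fix P :: real assume P: "P \<ge> 2"
      \<comment> \<open>31/8 = 4 - 1/8, and for P >= 1 the power grows with its exponent.\<close>
      have "P powr (31 / 8) \<le> P powr (4 - 1 / 8 + \<epsilon>)" using P assms by (intro powr_mono) auto
      then have "C * P powr (31 / 8) \<le> C * P powr (4 - 1 / 8 + \<epsilon>)" using C(1) by (rule mult_left_mono)
      then show "norm (N_loc P - tau_loc * P ^ 4) \<le> C * norm (P powr (4 - 1 / 8 + \<epsilon>))" using C(2)[OF P] by simp
    qed
  qed
qed

end
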